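(* Let $(M,g)$ be a Riemannian manifold of dimension $n$ with curvature tensor $R$ and sectional curvature $K$, and let $\overline K$ be the sectional curvature of the Riemannian metric $\bar g$ on the frame bundle $L(M)$ defined in the context from the functions $\alpha,\beta$. Let $u=(u_1,\ldots,u_n)\in L(M)$ be a frame at $x\in M$ and let $X,Y\in T_xM$ be two orthonormal vectors. Then, at $u$, for all $i,j\in\{1,\ldots,n\}$: $$\overline K(X^h,Y^h)=K(X,Y)-\frac34\sum_k\alpha_k|R(X,Y)u_k|^2,$$ $$\overline K(X^h,Y^{v,i})=\frac{\alpha_i^2}{4(\alpha_i+\beta_ig(Y,u_i)^2)}|R(u_i,Y)X|^2,$$ $$\overline K(X^{v,i},Y^{v,i})=\frac{A_i\left(g(X,u_i)^2+g(Y,u_i)^2\right)+B_i}{\alpha_i+\beta_i\left(g(X,u_i)^2+g(Y,u_i)^2\right)},$$ $$\overline K(X^{v,i},Y^{v,j})=0\quad\text{for } i\neq j.$$ In particular, if $(M,g)$ is of constant sectional curvature $\kappa$, then $$\overline K(X^h,Y^h)=\kappa-\frac34\kappa^2\sum_k\alpha_k\left(g(X,u_k)^2+g(Y,u_k)^2\right),$$ $$\overline K(X^h,Y^{v,i})=\frac{\kappa^2\alpha_i^2g(X,u_i)^2}{4(\alpha_i+\beta_ig(Y,u_i)^2)}\geq0.$$ If, moreover, $\kappa>0$ and $\sum_{k=1}^n\alpha(t_k)t_k<\frac{4}{3\kappa}$ for all $t_1,\ldots,t_n>0$, then $\overline K(X^h,Y^h)>0$.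
   Context: $L(M)$ is the bundle of linear frames; its points over $x\in M$ are the bases $u=(u_1,\ldots,u_n)$ of $T_xM$. $X^h$ denotes the horizontal lift to $L(M)$ (with respect to the Levi-Civita connection $\nabla$ of $g$) of a tangent vector $X$. The vertical lift $X^{v,i}$ ($i=1,\ldots,n$) is given by $X^{v,i}_u=\frac{d}{dt}\big|_{t=0}(u_1,\ldots,u_{i-1},u_i+tX,u_{i+1},\ldots,u_n)$. $\overline K(V,W)$ denotes the sectional curvature of $\bar g$ on the plane spanned by $V,W\in T_uL(M)$. $R(X,Y)Z=\nabla_X\nabla_YZ-\nabla_Y\nabla_XZ-\nabla_{[X,Y]}Z$. Let $\alpha,\beta:[0,\infty)\to\mathbb{R}$ be smooth functions with $\alpha(t)>0$ and $\alpha(t)+t\beta(t)>0$ for all $t\ge0$. Write $\alpha_i=\alpha(|u_i|^2)$, $\beta_i=\beta(|u_i|^2)$, $\alpha_i'=\alpha'(|u_i|^2)$, $\alpha_i''=\alpha''(|u_i|^2)$, $\beta_i'=\beta'(|u_i|^2)$, where $|u_i|^2=g(u_i,u_i)$. The Riemannian metric $\bar g$ on $L(M)$ is defined by $\bar g(X^h,Y^h)_u=g(X,Y)$; $\bar g(X^h,Y^{v,i})_u=0$; $\bar g(X^{v,i},Y^{v,j})_u=0$ for $i\ne j$; $\bar g(X^{v,i},Y^{v,i})_u=\alpha_i\,g(X,Y)+\beta_i\,g(X,u_i)g(Y,u_i)$. The quantities $A_i,B_i$ are $$A_i=\frac{3(\alpha_i')^2-2\alpha_i\alpha_i''}{\alpha_i^2}+\frac{(\alpha_i\beta_i'-2\alpha_i'\beta_i)(\alpha_i+|u_i|^2\alpha_i')}{\alpha_i^2(\alpha_i+|u_i|^2\beta_i)},\qquad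 B_i=\frac{\alpha_i\beta_i-2\alpha_i\alpha_i'-(\alpha_i')^2|u_i|^2}{\alpha_i(\alpha_i+|u_i|^2\beta_i)}.$$ *)

theory Defs
  imports "HOL-Analysis.Analysis" "HOL-Library.Function_Algebras"
begin

text \<open>Pointwise real vector space structure on functions; tangent vectors are represented below as
  functions on charts.\<close>

instantiation "fun" :: (type, real_vector) real_vector
begin

definition scaleR_fun :: "real \<Rightarrow> ('a \<Rightarrow> 'b) \<Rightarrow> 'a \<Rightarrow> 'b"
  where "scaleR_fun r f = (\<lambda>x. r *\<^sub>R f x)"

instance
  by standard (auto simp: scaleR_fun_def fun_eq_iff scaleR_add_right scaleR_add_left)

end


section \<open>Smooth maps\<close>

primrec Ck_on :: "nat \<Rightarrow> 'a::real_normed_vector set \<Rightarrow> ('a \<Rightarrow> 'b::real_normed_vector) \<Rightarrow> bool"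
  where
    "Ck_on 0 S f \<longleftrightarrow> continuous_on S f"
  | "Ck_on (Suc k) S f \<longleftrightarrow>
      (\<forall>x\<in>S. f differentiable (at x)) \<and>
      (\<forall>v. Ck_on k S (\<lambda>x. frechet_derivative f (at x) v))"

text \<open>Only used on open sets.\<close>

definition smooth_on :: "'a::real_normed_vector set \<Rightarrow> ('a \<Rightarrow> 'b::real_normed_vector) \<Rightarrow> bool"
  where "smooth_on S f \<longleftrightarrow> (\<forall>k. Ck_on k S f)"

text \<open>Smoothness of a function on the closed half line, with one-sided derivatives at \<open>0\<close>;
  the values at negative arguments are irrelevant.\<close>

definition smooth_half_line :: "(real \<Rightarrow> real) \<Rightarrow> bool"
  where "smooth_half_line f \<longleftrightarrow>
    (\<exists>D :: nat \<Rightarrow> real \<Rightarrow> real. (\<forall>t\<ge>0. D 0 t = f t) \<and>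
      (\<forall>k. \<forall>t\<ge>0. (D k has_real_derivative D (Suc k) t) (at t within {0..})))"


section \<open>Manifolds\<close>

text \<open>A chart is a pair of its domain and its coordinate map into the model space \<open>'e\<close>.
  A manifold is given by an atlas; its underlying set is the union of the chart domains and its
  topology is the one induced by the charts.\<close>

type_synonym ('a, 'e) chart = "'a set \<times> ('a \<Rightarrow> 'e)"

abbreviation chart_inv :: "('a, 'e) chart \<Rightarrow> 'e \<Rightarrow> 'a"
  where "chart_inv c \<equiv> inv_into (fst c) (snd c)"

definition points :: "('a, 'e) chart set \<Rightarrow> 'a set"
  where "points A = (\<Union>c\<in>A. fst c)"

definition charts_at :: "('a, 'e) chart set \<Rightarrow> 'a \<Rightarrow> ('a, 'e) chart set"
  where "charts_at A p = {c \<in> A. p \<in> fst c}"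

definition smooth_atlas :: "('a, 'e::euclidean_space) chart set \<Rightarrow> bool"
  where "smooth_atlas A \<longleftrightarrow>
    (\<forall>c\<in>A. inj_on (snd c) (fst c) \<and> open (snd c ` fst c)) \<and>
    (\<forall>c\<in>A. \<forall>d\<in>A. open (snd c ` (fst c \<inter> fst d)) \<and>
       smooth_on (snd c ` (fst c \<inter> fst d)) (snd d \<circ> chart_inv c))"

definition atlas_topology :: "('a, 'e::euclidean_space) chart set \<Rightarrow> 'a topology"
  where "atlas_topology A =
    topology (\<lambda>W. W \<subseteq> points A \<and> (\<forall>c\<in>A. open (snd c ` (W \<inter> fst c))))"

definition manifold :: "('a, 'e::euclidean_space) chart set \<Rightarrow> bool"
  where "manifold A \<longleftrightarrow> smooth_atlas A \<and>
    Hausdorff_space (atlas_topology A) \<and> second_countable (atlas_topology A)"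


section \<open>Tangent vectors\<close>

text \<open>A tangent vector at \<open>p\<close> is the family of its coordinate representations in all charts around
  \<open>p\<close>, related to each other by the derivatives of the transition maps. By convention the family
  is \<open>0\<close> on everything that is not a chart around \<open>p\<close>, so that equality of tangent vectors is
  equality of functions.\<close>

type_synonym ('a, 'e) tvec = "('a, 'e) chart \<Rightarrow> 'e"

definition tangent_space :: "('a, 'e::euclidean_space) chart set \<Rightarrow> 'a \<Rightarrow> ('a, 'e) tvec set"
  where "tangent_space A p =
    {v. (\<forall>c. c \<notin> charts_at A p \<longrightarrow> v c = 0) \<and>
        (\<forall>c\<in>charts_at A p. \<forall>d\<in>charts_at A p.
          v d = frechet_derivative (snd d \<circ> chart_inv c) (at (snd c p)) (v c))}"

text \<open>The tangent vector at \<open>p\<close> with representation \<open>a\<close> in the chart \<open>c\<close>.\<close>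

definition coord_vec ::
    "('a, 'e::euclidean_space) chart set \<Rightarrow> ('a, 'e) chart \<Rightarrow> 'a \<Rightarrow> 'e \<Rightarrow> ('a, 'e) tvec"
  where "coord_vec A c p a =
    (\<lambda>d. if d \<in> charts_at A p
         then frechet_derivative (snd d \<circ> chart_inv c) (at (snd c p)) a else 0)"

text \<open>The velocity of a curve at time \<open>0\<close>.\<close>

definition velocity ::
    "('a, 'e::euclidean_space) chart set \<Rightarrow> (real \<Rightarrow> 'a) \<Rightarrow> ('a, 'e) tvec"
  where "velocity A \<gamma> =
    (\<lambda>c. if c \<in> charts_at A (\<gamma> 0) then vector_derivative (\<lambda>t. snd c (\<gamma> t)) (at 0) else 0)"

definition smooth_curve :: "('a, 'e::euclidean_space) chart set \<Rightarrow> (real \<Rightarrow> 'a) \<Rightarrow> bool"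
  where "smooth_curve A \<gamma> \<longleftrightarrow>
    (\<exists>\<epsilon>>0. \<gamma> ` {-\<epsilon><..<\<epsilon>} \<subseteq> points A \<and>
      (\<forall>c\<in>A. open {t \<in> {-\<epsilon><..<\<epsilon>}. \<gamma> t \<in> fst c} \<and>
        smooth_on {t \<in> {-\<epsilon><..<\<epsilon>}. \<gamma> t \<in> fst c} (\<lambda>t. snd c (\<gamma> t))))"

definition smooth_vector_field ::
    "('a, 'e::euclidean_space) chart set \<Rightarrow> 'a set \<Rightarrow> ('a \<Rightarrow> ('a, 'e) tvec) \<Rightarrow> bool"
  where "smooth_vector_field A W X \<longleftrightarrow>
    (\<forall>p\<in>W. X p \<in> tangent_space A p) \<and>
    (\<forall>c\<in>A. smooth_on (snd c ` (W \<inter> fst c)) (\<lambda>y. X (chart_inv c y) c))"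


section \<open>Riemannian metrics, Levi-Civita connection and curvature\<close>

definition sym_bilinear_on :: "'v::real_vector set \<Rightarrow> ('v \<Rightarrow> 'v \<Rightarrow> real) \<Rightarrow> bool"
  where "sym_bilinear_on V b \<longleftrightarrow>
    (\<forall>v\<in>V. \<forall>w\<in>V. b v w = b w v) \<and>
    (\<forall>v\<in>V. \<forall>w\<in>V. \<forall>z\<in>V. \<forall>r s. b (r *\<^sub>R v + s *\<^sub>R w) z = r * b v z + s * b w z)"

type_synonym ('a, 'e) metric = "'a \<Rightarrow> ('a, 'e) tvec \<Rightarrow> ('a, 'e) tvec \<Rightarrow> real"

text \<open>The metric in the chart \<open>c\<close>, as a bilinear form at the point \<open>y\<close> of the image of \<open>c\<close>.\<close>

definition metric_coeff ::
    "('a, 'e::euclidean_space) chart set \<Rightarrow> ('a, 'e) metric \<Rightarrow> ('a, 'e) chart \<Rightarrow> 'e \<Rightarrow> 'e \<Rightarrow> 'e \<Rightarrow> real"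
  where "metric_coeff A g c y a b =
    g (chart_inv c y) (coord_vec A c (chart_inv c y) a) (coord_vec A c (chart_inv c y) b)"

definition riemannian_metric ::
    "('a, 'e::euclidean_space) chart set \<Rightarrow> ('a, 'e) metric \<Rightarrow> bool"
  where "riemannian_metric A g \<longleftrightarrow>
    (\<forall>p\<in>points A. sym_bilinear_on (tangent_space A p) (g p) \<and>
       (\<forall>v\<in>tangent_space A p. v \<noteq> 0 \<longrightarrow> g p v v > 0)) \<and>
    (\<forall>c\<in>A. \<forall>a b. smooth_on (snd c ` fst c) (\<lambda>y. metric_coeff A g c y a b))"

text \<open>The Christoffel symbols of the Levi-Civita connection in the chart \<open>c\<close>, as a bilinear map:
  the covariant derivative is \<open>\<nabla>\<^sub>a Y = D\<^sub>a Y + \<Gamma>(a, Y)\<close>. Symmetry of \<open>\<Gamma>\<close> says that \<open>\<nabla>\<close> is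
  torsion-free, and the last condition says that \<open>\<nabla>\<close> is metric.\<close>

definition christoffel ::
    "('a, 'e::euclidean_space) chart set \<Rightarrow> ('a, 'e) metric \<Rightarrow> ('a, 'e) chart \<Rightarrow> 'a \<Rightarrow> 'e \<Rightarrow> 'e \<Rightarrow> 'e"
  where "christoffel A g c p =
    (THE \<Gamma>. bilinear \<Gamma> \<and> (\<forall>a b. \<Gamma> a b = \<Gamma> b a) \<and>
      (\<forall>w a b. frechet_derivative (\<lambda>y. metric_coeff A g c y a b) (at (snd c p)) w =
        metric_coeff A g c (snd c p) (\<Gamma> w a) b + metric_coeff A g c (snd c p) a (\<Gamma> w b)))"

definition covariant_derivative ::
    "('a, 'e::euclidean_space) chart set \<Rightarrow> ('a, 'e) metric \<Rightarrow>
     ('a \<Rightarrow> ('a, 'e) tvec) \<Rightarrow> ('a \<Rightarrow> ('a, 'e) tvec) \<Rightarrow> 'a \<Rightarrow> ('a, 'e) tvec"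
  where "covariant_derivative A g X Y p =
    (\<lambda>c. if c \<in> charts_at A p
         then frechet_derivative (\<lambda>y. Y (chart_inv c y) c) (at (snd c p)) (X p c)
              + christoffel A g c p (X p c) (Y p c)
         else 0)"

definition lie_bracket ::
    "('a, 'e::euclidean_space) chart set \<Rightarrow>
     ('a \<Rightarrow> ('a, 'e) tvec) \<Rightarrow> ('a \<Rightarrow> ('a, 'e) tvec) \<Rightarrow> 'a \<Rightarrow> ('a, 'e) tvec"
  where "lie_bracket A X Y p =
    (\<lambda>c. if c \<in> charts_at A p
         then frechet_derivative (\<lambda>y. Y (chart_inv c y) c) (at (snd c p)) (X p c)
              - frechet_derivative (\<lambda>y. X (chart_inv c y) c) (at (snd c p)) (Y p c)
         else 0)"

definition field_curvature ::
    "('a, 'e::euclidean_space) chart set \<Rightarrow> ('a, 'e) metric \<Rightarrow> ('a \<Rightarrow> ('a, 'e) tvec) \<Rightarrow>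
     ('a \<Rightarrow> ('a, 'e) tvec) \<Rightarrow> ('a \<Rightarrow> ('a, 'e) tvec) \<Rightarrow> 'a \<Rightarrow> ('a, 'e) tvec"
  where "field_curvature A g X Y Z p =
    covariant_derivative A g X (covariant_derivative A g Y Z) p
    - covariant_derivative A g Y (covariant_derivative A g X Z) p
    - covariant_derivative A g (lie_bracket A X Y) Z p"

text \<open>\<open>curvature A g p x y z\<close> is \<open>R(x,y)z\<close> for tangent vectors \<open>x\<close>, \<open>y\<close>, \<open>z\<close> at \<open>p\<close>: the common
  value obtained from all local extensions to smooth vector fields.\<close>

definition curvature ::
    "('a, 'e::euclidean_space) chart set \<Rightarrow> ('a, 'e) metric \<Rightarrow> 'a \<Rightarrow>
     ('a, 'e) tvec \<Rightarrow> ('a, 'e) tvec \<Rightarrow> ('a, 'e) tvec \<Rightarrow> ('a, 'e) tvec"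
  where "curvature A g p x y z =
    (THE r. \<forall>W X Y Z. openin (atlas_topology A) W \<and> p \<in> W \<and>
       smooth_vector_field A W X \<and> smooth_vector_field A W Y \<and> smooth_vector_field A W Z \<and>
       X p = x \<and> Y p = y \<and> Z p = z \<longrightarrow> field_curvature A g X Y Z p = r)"

definition sectional_curvature ::
    "('a, 'e::euclidean_space) chart set \<Rightarrow> ('a, 'e) metric \<Rightarrow> 'a \<Rightarrow>
     ('a, 'e) tvec \<Rightarrow> ('a, 'e) tvec \<Rightarrow> real"
  where "sectional_curvature A g p x y =
    g p (curvature A g p x y y) x / (g p x x * g p y y - (g p x y)\<^sup>2)"

definition constant_sectional_curvature ::
    "('a, 'e::euclidean_space) chart set \<Rightarrow> ('a, 'e) metric \<Rightarrow> real \<Rightarrow> bool"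
  where "constant_sectional_curvature A g \<kappa> \<longleftrightarrow>
    (\<forall>p\<in>points A. \<forall>x\<in>tangent_space A p. \<forall>y\<in>tangent_space A p.
      x \<noteq> y \<and> independent {x, y} \<longrightarrow> sectional_curvature A g p x y = \<kappa>)"

text \<open>Covariant derivative at time \<open>0\<close> of a vector field \<open>Y\<close> along a curve \<open>\<gamma>\<close>.\<close>

definition covariant_derivative_along ::
    "('a, 'e::euclidean_space) chart set \<Rightarrow> ('a, 'e) metric \<Rightarrow>
     (real \<Rightarrow> 'a) \<Rightarrow> (real \<Rightarrow> ('a, 'e) tvec) \<Rightarrow> ('a, 'e) tvec"
  where "covariant_derivative_along A g \<gamma> Y =
    (\<lambda>c. if c \<in> charts_at A (\<gamma> 0)
         then vector_derivative (\<lambda>t. Y t c) (at 0)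
              + christoffel A g c (\<gamma> 0) (velocity A \<gamma> c) (Y 0 c)
         else 0)"


section \<open>The frame bundle\<close>

text \<open>A point of the frame bundle of an \<open>n\<close>-dimensional manifold, \<open>n = CARD('n)\<close>, is a pair of a
  base point and a basis of its tangent space indexed by \<open>'n\<close>.\<close>

type_synonym ('a, 'n) frame = "'a \<times> ('n \<Rightarrow> ('a, real^'n) tvec)"

definition frames :: "('a, real^'n::finite) chart set \<Rightarrow> ('a, 'n) frame set"
  where "frames A = {(x, u). x \<in> points A \<and>
    inj u \<and> independent (range u) \<and> span (range u) = tangent_space A x}"

definition frame_chart ::
    "('a, real^'n::finite) chart set \<Rightarrow> ('a, real^'n) chart \<Rightarrow>
     (('a, 'n) frame, (real^'n) \<times> (real^'n^'n)) chart"
  where "frame_chart A c = ({(x, u) \<in> frames A. x \<in> fst c}, \<lambda>(x, u). (snd c x, \<chi> i. u i c))"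

definition frame_atlas ::
    "('a, real^'n::finite) chart set \<Rightarrow> (('a, 'n) frame, (real^'n) \<times> (real^'n^'n)) chart set"
  where "frame_atlas A = frame_chart A ` A"

type_synonym ('a, 'n) frame_tvec = "(('a, 'n) frame, (real^'n) \<times> (real^'n^'n)) tvec"

text \<open>A tangent vector of the frame bundle is horizontal if it is the velocity of a curve of frames
  all of whose members have vanishing covariant derivative (along the base curve) at time \<open>0\<close>; the
  horizontal lift of \<open>X\<close> is the horizontal vector projecting to \<open>X\<close>.\<close>

definition horizontal_lift ::
    "('a, real^'n::finite) chart set \<Rightarrow> ('a, real^'n) metric \<Rightarrow> ('a, 'n) frame \<Rightarrow>
     ('a, real^'n) tvec \<Rightarrow> ('a, 'n) frame_tvec"
  where "horizontal_lift A g p X =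
    (THE V. \<exists>\<gamma>. smooth_curve (frame_atlas A) \<gamma> \<and> \<gamma> 0 = p \<and>
       velocity (frame_atlas A) \<gamma> = V \<and> velocity A (fst \<circ> \<gamma>) = X \<and>
       (\<forall>i. covariant_derivative_along A g (fst \<circ> \<gamma>) (\<lambda>t. snd (\<gamma> t) i) = 0))"

definition vertical_lift ::
    "('a, real^'n::finite) chart set \<Rightarrow> ('a, 'n) frame \<Rightarrow> 'n \<Rightarrow>
     ('a, real^'n) tvec \<Rightarrow> ('a, 'n) frame_tvec"
  where "vertical_lift A p i X =
    velocity (frame_atlas A) (\<lambda>t. (fst p, (snd p)(i := snd p i + t *\<^sub>R X)))"

text \<open>The metric on the frame bundle: at each frame, the symmetric bilinear form with the prescribed
  values on lifts (set to \<open>0\<close> outside the tangent space to make it unique as a function).\<close>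

definition frame_metric ::
    "('a, real^'n::finite) chart set \<Rightarrow> ('a, real^'n) metric \<Rightarrow> (real \<Rightarrow> real) \<Rightarrow> (real \<Rightarrow> real) \<Rightarrow>
     (('a, 'n) frame, (real^'n) \<times> (real^'n^'n)) metric"
  where "frame_metric A g \<alpha> \<beta> p =
    (let x = fst p; u = snd p; T = tangent_space (frame_atlas A) p;
         h = horizontal_lift A g p; v = vertical_lift A p
     in THE b. sym_bilinear_on T b \<and> (\<forall>V W. V \<notin> T \<or> W \<notin> T \<longrightarrow> b V W = 0) \<and>
       (\<forall>X\<in>tangent_space A x. \<forall>Y\<in>tangent_space A x.
          b (h X) (h Y) = g x X Y \<and>
          (\<forall>i. b (h X) (v i Y) = 0) \<and>
          (\<forall>i j. i \<noteq> j \<longrightarrow> b (v i X) (v j Y) = 0) \<and>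
          (\<forall>i. b (v i X) (v i Y) =
             \<alpha> (g x (u i) (u i)) * g x X Y +
             \<beta> (g x (u i) (u i)) * g x X (u i) * g x Y (u i))))"

text \<open>The quantities \<open>A\<^sub>i\<close> and \<open>B\<^sub>i\<close> are these functions at \<open>t = |u\<^sub>i|\<^sup>2\<close>.\<close>

definition coeff_A :: "(real \<Rightarrow> real) \<Rightarrow> (real \<Rightarrow> real) \<Rightarrow> real \<Rightarrow> real"
  where "coeff_A \<alpha> \<beta> t =
    (3 * (deriv \<alpha> t)\<^sup>2 - 2 * \<alpha> t * deriv (deriv \<alpha>) t) / (\<alpha> t)\<^sup>2 +
    (\<alpha> t * deriv \<beta> t - 2 * deriv \<alpha> t * \<beta> t) * (\<alpha> t + t * deriv \<alpha> t) /
      ((\<alpha> t)\<^sup>2 * (\<alpha> t + t * \<beta> t))"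

definition coeff_B :: "(real \<Rightarrow> real) \<Rightarrow> (real \<Rightarrow> real) \<Rightarrow> real \<Rightarrow> real"
  where "coeff_B \<alpha> \<beta> t =
    (\<alpha> t * \<beta> t - 2 * \<alpha> t * deriv \<alpha> t - (deriv \<alpha> t)\<^sup>2 * t) / (\<alpha> t * (\<alpha> t + t * \<beta> t))"

end

theory Submission
  imports Defs
begin

text \<open>Sectional curvature is determined pointwise by the 2-jet of the metric: for constant coordinate
  fields \<open>v\<close>, \<open>w\<close> the product rule for \<open>\<nabla>\<close> gives
  \<open>G(R(v,w)w, v) = \<partial>\<^sub>v \<partial>\<^sub>w G(w,v) - \<partial>\<^sub>v\<^sup>2 G(w,w) / 2 - \<partial>\<^sub>w\<^sup>2 G(v,v) / 2 - G(\<Gamma>(w,w), \<Gamma>(v,v)) + |\<Gamma>(v,w)|\<^sup>2\<close>,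
  so no derivative of the Christoffel symbols of the frame metric is needed.

  A change of coordinates on the base induces one on the frame bundle that pulls the frame metric back
  to the frame metric of the pulled back metric. Hence one may assume that the Christoffel symbols of
  \<open>g\<close> vanish at the base point. There horizontal and vertical lifts are constant coordinate vectors,
  the Koszul formula gives the Christoffel symbols of the frame metric, and the four curvatures come out
  of the displayed formula. For constant curvature, the usual polarisation argument determines \<open>R\<close>, and
  Bessel's inequality together with \<open>\<Sum>\<^sub>k \<alpha>(t\<^sub>k) t\<^sub>k < 4 / (3 \<kappa>)\<close> gives positivity.\<close>

section \<open>Calculus of \<open>C\<^sup>k\<close> maps\<close>

text \<open>The frame metric is built from the Christoffel symbols of \<open>g\<close>, so its
  second derivatives reach second derivatives of these symbols. Two things keep the computation
  small. Fibre components are differentiated covariantly (\<open>cov\<close>), which absorbs the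
  derivatives of \<open>g\<close>. And at a normal point a doubly differentiated fibre component is
  either paired with a vertical component that vanishes or has a vertical argument; so only first
  derivatives of the Christoffel symbols survive, in combinations that reduce to their antisymmetric
  part \<open>R\<close>.

  Christoffel symbols, curvature, horizontal lifts and the frame metric are all definite
  descriptions. Existence and uniqueness of each must be shown before it can be computed; these
  proofs also yield the coordinate formulas that link the manifold to the local computation.

  The functions \<alpha> and \<beta> are only evaluated at |u_i|^2 > 0, because members of a basis
  do not vanish. Their smoothness is therefore transferred to the open half line, where one-sided
  derivatives are two-sided and \<open>deriv\<close> has its usual meaning.\<close>

abbreviation fd :: "('a::real_normed_vector \<Rightarrow> 'b::real_normed_vector) \<Rightarrow> 'a \<Rightarrow> 'a \<Rightarrow> 'b"
  where "fd f x \<equiv> frechet_derivative f (at x)"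

lemma fd_unique: "(f has_derivative f') (at x) \<Longrightarrow> fd f x = f'"
  by (metis frechet_derivative_at)

lemma has_derivative_fd: "f differentiable (at x) \<Longrightarrow> (f has_derivative fd f x) (at x)"
  by (simp add: frechet_derivative_works)

lemma fd_cong:
  assumes "open S" "x \<in> S" "\<And>y. y \<in> S \<Longrightarrow> f y = g y"
  shows "fd f x = fd g x"
proof -
  have "(f has_derivative D) (at x) \<longleftrightarrow> (g has_derivative D) (at x)" for D
    using assms by (metis has_derivative_transform_within_open)
  then show ?thesis by (simp add: frechet_derivative_def)
qed

lemma differentiable_cong:
  assumes "open S" "x \<in> S" "\<And>y. y \<in> S \<Longrightarrow> f y = g y"
  shows "f differentiable (at x) \<longleftrightarrow> g differentiable (at x)"
proof -
  have "(f has_derivative D) (at x) \<longleftrightarrow> (g has_derivative D) (at x)" for D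
    using assms by (metis has_derivative_transform_within_open)
  then show ?thesis by (simp add: differentiable_def)
qed

text \<open>A derivative at a point of an open set depends only on values in that set. The closure
  lemmas below all rest on this: compute the derivative on S, show that the result is of class k,
  and transport it back.\<close>

lemma Ck_on_cong:
  assumes "open S" "\<And>y. y \<in> S \<Longrightarrow> f y = g y"
  shows "Ck_on k S f \<longleftrightarrow> Ck_on k S g"
  using assms(2)
proof (induction k arbitrary: f g)
  case 0
  then show ?case by (auto intro: continuous_on_cong[THEN iffD1])
next
  case (Suc k)
  have "fd f x = fd g x" if "x \<in> S" for x
    using fd_cong[OF assms(1) that] Suc.prems by blast
  moreover have "f differentiable (at x) \<longleftrightarrow> g differentiable (at x)" if "x \<in> S" for x
    using differentiable_cong[OF assms(1) that] Suc.prems by blast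
  ultimately show ?case
    using Suc.IH[of "\<lambda>x. fd f x _" "\<lambda>x. fd g x _"] by simp
qed

lemma Ck_on_transform:
  "Ck_on k S g \<Longrightarrow> open S \<Longrightarrow> (\<And>y. y \<in> S \<Longrightarrow> f y = g y) \<Longrightarrow> Ck_on k S f"
  using Ck_on_cong by blast

lemma Ck_on_subset: "Ck_on k S f \<Longrightarrow> T \<subseteq> S \<Longrightarrow> Ck_on k T f"
  by (induction k arbitrary: f) (auto intro: continuous_on_subset)

lemma Ck_on_Suc_imp: "Ck_on (Suc k) S f \<Longrightarrow> Ck_on k S f"
proof (induction k arbitrary: f)
  case 0
  then show ?case
    by (simp add: continuous_at_imp_continuous_on differentiable_imp_continuous_within)
next
  case (Suc k)
  then show ?case by (metis Ck_on.simps(2))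
qed

lemma Ck_on_const: "Ck_on k S (\<lambda>x. c)"
  by (induction k arbitrary: c) auto

lemma Ck_on_linear:
  assumes "bounded_linear f"
  shows "Ck_on k S f"
proof (cases k)
  case 0
  then show ?thesis using assms by (simp add: linear_continuous_on)
next
  case (Suc k)
  have "fd f x = f" for x
    using assms by (intro fd_unique bounded_linear_imp_has_derivative)
  then show ?thesis
    using assms Suc by (auto simp: Ck_on_const intro: bounded_linear_imp_differentiable)
qed

lemma Ck_on_add:
  assumes "open S" "Ck_on k S f" "Ck_on k S g"
  shows "Ck_on k S (\<lambda>x. f x + g x)"
  using assms(2,3)
proof (induction k arbitrary: f g)
  case 0
  then show ?case by (auto intro: continuous_intros)
next
  case (Suc k)
  have eq: "fd (\<lambda>x. f x + g x) x v = fd f x v + fd g x v" if "x \<in> S" for x v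
  proof -
    have "((\<lambda>x. f x + g x) has_derivative (\<lambda>v. fd f x v + fd g x v)) (at x)"
      using Suc.prems that by (intro has_derivative_add has_derivative_fd) auto
    then show ?thesis by (simp add: fd_unique)
  qed
  have C: "Ck_on k S (\<lambda>x. fd f x v + fd g x v)" for v
    using Suc by simp
  have "Ck_on k S (\<lambda>x. fd (\<lambda>x. f x + g x) x v)" for v
    by (rule Ck_on_transform[OF C assms(1) eq])
  then show ?case using Suc.prems by auto
qed

lemma (in bounded_bilinear) Ck_on_bilinear:
  assumes "open S" "Ck_on k S f" "Ck_on k S g"
  shows "Ck_on k S (\<lambda>x. prod (f x) (g x))"
  using assms(2,3)
proof (induction k arbitrary: f g)
  case 0
  then show ?case by (auto intro: continuous_on)
next
  case (Suc k)
  have *: "((\<lambda>x. prod (f x) (g x)) has_derivative (\<lambda>v. prod (f x) (fd g x v) + prod (fd f x v) (g x))) (at x)"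
    if "x \<in> S" for x
    by (rule FDERIV[OF has_derivative_fd has_derivative_fd]) (use Suc.prems that in auto)
  have eq: "fd (\<lambda>x. prod (f x) (g x)) x v = prod (f x) (fd g x v) + prod (fd f x v) (g x)" if "x \<in> S" for x v
    by (simp add: fd_unique[OF *[OF that]])
  have "Ck_on k S f" "Ck_on k S g"
    using Ck_on_Suc_imp[OF Suc.prems(1)] Ck_on_Suc_imp[OF Suc.prems(2)] .
  have C: "Ck_on k S (\<lambda>x. prod (f x) (fd g x v) + prod (fd f x v) (g x))" for v
    by (rule Ck_on_add[OF assms(1) Suc.IH Suc.IH]) (use Suc.prems \<open>Ck_on k S f\<close> \<open>Ck_on k S g\<close> in auto)
  have "Ck_on k S (\<lambda>x. fd (\<lambda>x. prod (f x) (g x)) x v)" for v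
    by (rule Ck_on_transform[OF C assms(1) eq])
  then show ?case using differentiableI[OF *] by simp
qed

lemma Ck_on_sum:
  assumes "open S" "\<And>i. i \<in> I \<Longrightarrow> Ck_on k S (f i)"
  shows "Ck_on k S (\<lambda>x. \<Sum>i\<in>I. f i x)"
  using assms(2) by (induction I rule: infinite_finite_induct) (simp_all add: Ck_on_const Ck_on_add[OF assms(1)])

lemma Ck_on_linear_compose:
  assumes "open S" "bounded_linear L" "Ck_on k S f"
  shows "Ck_on k S (\<lambda>x. L (f x))"
  using assms(3)
proof (induction k arbitrary: f)
  case 0
  then show ?case using assms by (simp add: bounded_linear.continuous_on)
next
  case (Suc k)
  have *: "((\<lambda>x. L (f x)) has_derivative (\<lambda>v. L (fd f x v))) (at x)" if "x \<in> S" for x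
    by (rule bounded_linear.has_derivative[OF assms(2) has_derivative_fd]) (use Suc.prems that in simp)
  have eq: "fd (\<lambda>x. L (f x)) x v = L (fd f x v)" if "x \<in> S" for x v
    by (simp add: fd_unique[OF *[OF that]])
  have C: "Ck_on k S (\<lambda>x. L (fd f x v))" for v
    using Suc by simp
  have "Ck_on k S (\<lambda>x. fd (\<lambda>x. L (f x)) x v)" for v
    by (rule Ck_on_transform[OF C assms(1) eq])
  then show ?case using differentiableI[OF *] by simp
qed

lemma linear_sum_Basis:
  fixes f :: "'a::euclidean_space \<Rightarrow> 'b::real_vector"
  assumes "linear f"
  shows "f v = (\<Sum>b\<in>Basis. (v \<bullet> b) *\<^sub>R f b)"
proof -
  have "f v = f (\<Sum>b\<in>Basis. (v \<bullet> b) *\<^sub>R b)"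
    by (simp add: euclidean_representation)
  also have "\<dots> = (\<Sum>b\<in>Basis. (v \<bullet> b) *\<^sub>R f b)"
    using assms by (simp add: linear_sum linear_cmul)
  finally show ?thesis .
qed

text \<open>In the chain rule the direction \<open>fd h x v\<close> varies with x, while
  \<open>Ck_on\<close> controls derivatives in fixed directions only. Expanding the direction in a
  basis leaves products of class k, which is why the middle space is Euclidean.\<close>

lemma Ck_on_compose:
  fixes h :: "'a::real_normed_vector \<Rightarrow> 'b::euclidean_space"
  assumes "open S" "open T" "Ck_on k S h" "Ck_on k T f" "h ` S \<subseteq> T"
  shows "Ck_on k S (\<lambda>x. f (h x))"
  using assms(3,4)
proof (induction k arbitrary: f)
  case 0
  then show ?case using continuous_on_compose2[of T f S h] assms(5) by simp
next
  case (Suc k)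
  have *: "((\<lambda>x. f (h x)) has_derivative (\<lambda>v. fd f (h x) (fd h x v))) (at x)" if "x \<in> S" for x
    by (rule has_derivative_compose[OF has_derivative_fd has_derivative_fd]) (use Suc.prems that assms(5) in auto)
  have eq: "fd (\<lambda>x. f (h x)) x v = (\<Sum>b\<in>Basis. (fd h x v \<bullet> b) *\<^sub>R fd f (h x) b)" if "x \<in> S" for x v
  proof -
    have "linear (fd f (h x))"
      using Suc.prems that assms(5) by (intro linear_frechet_derivative) auto
    then show ?thesis unfolding fd_unique[OF *[OF that]] by (rule linear_sum_Basis)
  qed
  have C: "Ck_on k S (\<lambda>x. \<Sum>b\<in>Basis. (fd h x v \<bullet> b) *\<^sub>R fd f (h x) b)" for v
  proof (intro Ck_on_sum assms(1) bounded_bilinear.Ck_on_bilinear[OF bounded_bilinear_scaleR])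
    show "Ck_on k S (\<lambda>x. fd h x v \<bullet> b)" for b
      by (rule Ck_on_linear_compose[OF assms(1) bounded_linear_inner_left]) (use Suc.prems in auto)
    show "Ck_on k S (\<lambda>x. fd f (h x) b)" for b
      by (rule Suc.IH) (use Suc.prems Ck_on_Suc_imp in auto)
  qed
  have "Ck_on k S (\<lambda>x. fd (\<lambda>x. f (h x)) x v)" for v
    by (rule Ck_on_transform[OF C assms(1) eq])
  then show ?case using differentiableI[OF *] by simp
qed

section \<open>Closure properties of smooth maps\<close>

lemma smooth_on_cong: "open S \<Longrightarrow> (\<And>y. y \<in> S \<Longrightarrow> f y = g y) \<Longrightarrow> smooth_on S f \<longleftrightarrow> smooth_on S g"
  unfolding smooth_on_def using Ck_on_cong by blast

lemma smooth_on_transform: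
  "smooth_on S g \<Longrightarrow> open S \<Longrightarrow> (\<And>y. y \<in> S \<Longrightarrow> f y = g y) \<Longrightarrow> smooth_on S f"
  using smooth_on_cong by blast

lemma smooth_on_subset: "smooth_on S f \<Longrightarrow> T \<subseteq> S \<Longrightarrow> smooth_on T f"
  unfolding smooth_on_def using Ck_on_subset by blast

lemma smooth_on_const: "smooth_on S (\<lambda>x. c)"
  unfolding smooth_on_def using Ck_on_const by blast

lemma smooth_on_linear: "bounded_linear f \<Longrightarrow> smooth_on S f"
  unfolding smooth_on_def using Ck_on_linear by blast

lemma smooth_on_add: "open S \<Longrightarrow> smooth_on S f \<Longrightarrow> smooth_on S g \<Longrightarrow> smooth_on S (\<lambda>x. f x + g x)"
  unfolding smooth_on_def by (auto intro: Ck_on_add[where f = f and g = g])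

lemma (in bounded_bilinear) smooth_on_bilinear:
  "open S \<Longrightarrow> smooth_on S f \<Longrightarrow> smooth_on S g \<Longrightarrow> smooth_on S (\<lambda>x. prod (f x) (g x))"
  unfolding smooth_on_def by (auto intro: Ck_on_bilinear[where f = f and g = g])

lemmas smooth_on_mult = bounded_bilinear.smooth_on_bilinear[OF bounded_bilinear_mult]
lemmas smooth_on_scaleR = bounded_bilinear.smooth_on_bilinear[OF bounded_bilinear_scaleR]

lemma smooth_on_sum:
  "open S \<Longrightarrow> (\<And>i. i \<in> I \<Longrightarrow> smooth_on S (f i)) \<Longrightarrow> smooth_on S (\<lambda>x. \<Sum>i\<in>I. f i x)"
  unfolding smooth_on_def by (auto intro: Ck_on_sum[where f = f])

lemma smooth_on_linear_compose:
  "open S \<Longrightarrow> bounded_linear L \<Longrightarrow> smooth_on S f \<Longrightarrow> smooth_on S (\<lambda>x. L (f x))"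
  unfolding smooth_on_def by (auto intro: Ck_on_linear_compose[where f = f and L = L])

lemma smooth_on_minus: "open S \<Longrightarrow> smooth_on S f \<Longrightarrow> smooth_on S (\<lambda>x. - f x)"
  by (rule smooth_on_linear_compose[OF _ bounded_linear_minus[OF bounded_linear_ident], of S f])

lemma smooth_on_diff: "open S \<Longrightarrow> smooth_on S f \<Longrightarrow> smooth_on S g \<Longrightarrow> smooth_on S (\<lambda>x. f x - g x)"
  using smooth_on_add[OF _ _ smooth_on_minus, of S f g] by simp

lemma smooth_on_compose:
  fixes h :: "'a::real_normed_vector \<Rightarrow> 'b::euclidean_space"
  shows "open S \<Longrightarrow> open T \<Longrightarrow> smooth_on S h \<Longrightarrow> smooth_on T f \<Longrightarrow> h ` S \<subseteq> T \<Longrightarrow> smooth_on S (\<lambda>x. f (h x))"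
  unfolding smooth_on_def by (auto intro: Ck_on_compose[where f = f and h = h and T = T])

lemma smooth_on_inner_left: "open S \<Longrightarrow> smooth_on S f \<Longrightarrow> smooth_on S (\<lambda>x. f x \<bullet> b)"
  by (rule smooth_on_linear_compose[OF _ bounded_linear_inner_left])

lemma smooth_on_differentiable: "smooth_on S f \<Longrightarrow> x \<in> S \<Longrightarrow> f differentiable (at x)"
  unfolding smooth_on_def by (metis Ck_on.simps(2))

lemma smooth_on_has_derivative: "smooth_on S f \<Longrightarrow> x \<in> S \<Longrightarrow> (f has_derivative fd f x) (at x)"
  by (intro has_derivative_fd smooth_on_differentiable)

lemma smooth_on_linear_fd: "smooth_on S f \<Longrightarrow> x \<in> S \<Longrightarrow> linear (fd f x)"
  by (intro linear_frechet_derivative smooth_on_differentiable)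

lemma smooth_on_fd: "smooth_on S f \<Longrightarrow> smooth_on S (\<lambda>x. fd f x v)"
  unfolding smooth_on_def by (metis Ck_on.simps(2))

lemma smooth_on_continuous: "smooth_on S f \<Longrightarrow> continuous_on S f"
  unfolding smooth_on_def by (metis Ck_on.simps(1))

lemma smooth_on_componentwise:
  fixes f :: "'a::real_normed_vector \<Rightarrow> 'b::euclidean_space"
  assumes "open S" "\<And>b. b \<in> Basis \<Longrightarrow> smooth_on S (\<lambda>x. f x \<bullet> b)"
  shows "smooth_on S f"
proof -
  have "smooth_on S (\<lambda>x. \<Sum>b\<in>Basis. (f x \<bullet> b) *\<^sub>R b)"
    using assms by (intro smooth_on_sum smooth_on_scaleR smooth_on_const) auto
  then show ?thesis by (simp add: euclidean_representation)
qed

lemma smooth_on_Pair: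
  assumes "open S" "smooth_on S f" "smooth_on S g"
  shows "smooth_on S (\<lambda>x. (f x, g x))"
proof -
  have "smooth_on S (\<lambda>x. (f x, 0) + (0, g x))"
    using assms by (intro smooth_on_add smooth_on_linear_compose[where L = "\<lambda>z. (z, 0)"]
      smooth_on_linear_compose[where L = "\<lambda>z. (0, z)"] bounded_linear_Pair bounded_linear_ident bounded_linear_zero)
  then show ?thesis by simp
qed

lemma smooth_on_vec:
  fixes f :: "'n::finite \<Rightarrow> 'a::real_normed_vector \<Rightarrow> 'b::euclidean_space"
  assumes "open S" "\<And>i. smooth_on S (f i)"
  shows "smooth_on S (\<lambda>x. \<chi> i. f i x)"
proof (rule smooth_on_componentwise[OF assms(1)])
  fix b :: "'b^'n" assume "b \<in> Basis"
  then obtain i c where "b = axis i c" "c \<in> Basis" by (auto simp: Basis_vec_def)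
  then show "smooth_on S (\<lambda>x. (\<chi> i. f i x) \<bullet> b)"
    using smooth_on_inner_left[OF assms(1) assms(2)] by (simp add: inner_axis)
qed

text \<open>A basis separates the two ways in which x enters: through \<open>L x b\<close> for fixed
  b and through the coordinates of \<open>p x\<close>. Metrics, Christoffel symbols and Jacobians
  can thus stay plain curried functions that are smooth for each fixed argument.\<close>

lemma smooth_on_linear_family:
  fixes L :: "'a::real_normed_vector \<Rightarrow> 'b::euclidean_space \<Rightarrow> 'c::real_normed_vector"
  assumes "open S" "\<And>x. x \<in> S \<Longrightarrow> linear (L x)" "\<And>b. smooth_on S (\<lambda>x. L x b)" "smooth_on S p"
  shows "smooth_on S (\<lambda>x. L x (p x))"
proof -
  have "smooth_on S (\<lambda>x. \<Sum>b\<in>Basis. (p x \<bullet> b) *\<^sub>R L x b)"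
    by (intro smooth_on_sum smooth_on_scaleR smooth_on_inner_left assms(1,3,4))
  then show ?thesis
    by (rule smooth_on_transform[OF _ assms(1)]) (rule linear_sum_Basis[OF assms(2)])
qed

lemma smooth_on_bilinear_family:
  fixes B :: "'a::real_normed_vector \<Rightarrow> 'b::euclidean_space \<Rightarrow> 'c::euclidean_space \<Rightarrow> 'd::real_normed_vector"
  assumes "open S" "\<And>x. x \<in> S \<Longrightarrow> bilinear (B x)" "\<And>a b. smooth_on S (\<lambda>x. B x a b)"
    "smooth_on S p" "smooth_on S q"
  shows "smooth_on S (\<lambda>x. B x (p x) (q x))"
proof (rule smooth_on_linear_family[where L = "\<lambda>x. B x (p x)", OF assms(1) _ _ assms(5)])
  show "linear (B x (p x))" if "x \<in> S" for x
    using assms(2)[OF that] by (simp add: bilinear_def)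
  show "smooth_on S (\<lambda>x. B x (p x) b)" for b
    by (rule smooth_on_linear_family[where L = "\<lambda>x p. B x p b", OF assms(1) _ assms(3,4)])
      (use assms(2) in \<open>simp add: bilinear_def\<close>)
qed

lemma has_derivative_linear_family:
  fixes L :: "'a::real_normed_vector \<Rightarrow> 'b::euclidean_space \<Rightarrow> 'c::real_normed_vector"
  assumes "open S" "x \<in> S" "\<And>y. y \<in> S \<Longrightarrow> linear (L y)" "\<And>b. smooth_on S (\<lambda>y. L y b)"
    "(p has_derivative p') (at x)"
  shows "((\<lambda>y. L y (p y)) has_derivative (\<lambda>h. fd (\<lambda>y. L y (p x)) x h + L x (p' h))) (at x)"
proof -
  have *: "((\<lambda>y. L y b) has_derivative (\<lambda>h. fd (\<lambda>y. L y b) x h)) (at x)" for b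
    using assms by (intro smooth_on_has_derivative[of S]) auto
  have D: "((\<lambda>y. \<Sum>b\<in>Basis. (p y \<bullet> b) *\<^sub>R L y b) has_derivative
     (\<lambda>h. \<Sum>b\<in>Basis. (p x \<bullet> b) *\<^sub>R fd (\<lambda>y. L y b) x h + (p' h \<bullet> b) *\<^sub>R L x b)) (at x)"
    by (intro has_derivative_sum has_derivative_scaleR has_derivative_inner_left assms(5) *)
  have D0: "((\<lambda>y. \<Sum>b\<in>Basis. (p x \<bullet> b) *\<^sub>R L y b) has_derivative
     (\<lambda>h. \<Sum>b\<in>Basis. (p x \<bullet> b) *\<^sub>R fd (\<lambda>y. L y b) x h)) (at x)"
    by (intro has_derivative_sum has_derivative_scaleR_right *)
  have "((\<lambda>y. L y (p x)) has_derivative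
     (\<lambda>h. \<Sum>b\<in>Basis. (p x \<bullet> b) *\<^sub>R fd (\<lambda>y. L y b) x h)) (at x)"
    by (rule has_derivative_transform_within_open[OF D0 assms(1,2)])
       (simp add: linear_sum_Basis[OF assms(3), of _ "p x"])
  then have "(\<Sum>b\<in>Basis. (p x \<bullet> b) *\<^sub>R fd (\<lambda>y. L y b) x h) = fd (\<lambda>y. L y (p x)) x h" for h
    by (simp add: fd_unique)
  moreover have "(\<Sum>b\<in>Basis. (p' h \<bullet> b) *\<^sub>R L x b) = L x (p' h)" for h
    by (simp add: linear_sum_Basis[OF assms(3)[OF assms(2)], of "p' h"])
  ultimately have "((\<lambda>y. \<Sum>b\<in>Basis. (p y \<bullet> b) *\<^sub>R L y b) has_derivative
     (\<lambda>h. fd (\<lambda>y. L y (p x)) x h + L x (p' h))) (at x)"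
    using D by (simp add: sum.distrib)
  then show ?thesis
    by (rule has_derivative_transform_within_open[OF _ assms(1,2)])
       (simp add: linear_sum_Basis[OF assms(3), of _ "p _"])
qed

lemma has_derivative_bilinear_family:
  fixes B :: "'a::real_normed_vector \<Rightarrow> 'b::euclidean_space \<Rightarrow> 'c::euclidean_space \<Rightarrow> 'd::real_normed_vector"
  assumes S: "open S" "x \<in> S" and B: "\<And>y. y \<in> S \<Longrightarrow> bilinear (B y)" "\<And>a b. smooth_on S (\<lambda>y. B y a b)"
    and p: "smooth_on S p" and q: "(q has_derivative q') (at x)"
  shows "((\<lambda>y. B y (p y) (q y)) has_derivative
     (\<lambda>h. fd (\<lambda>y. B y (p x) (q x)) x h + B x (fd p x h) (q x) + B x (p x) (q' h))) (at x)"
proof -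
  have l: "linear (B y a)" "linear (\<lambda>a. B y a b)" if "y \<in> S" for y a b
    using B(1)[OF that] by (auto simp: bilinear_def)
  have sm: "smooth_on S (\<lambda>y. B y (p y) b)" for b
    by (rule smooth_on_linear_family[where L = "\<lambda>y a. B y a b", OF S(1) l(2) B(2) p])
  have "((\<lambda>y. B y (p y) (q y)) has_derivative (\<lambda>h. fd (\<lambda>y. B y (p y) (q x)) x h + B x (p x) (q' h))) (at x)"
    by (rule has_derivative_linear_family[where L = "\<lambda>y. B y (p y)", OF S l(1) sm q])
  moreover have "((\<lambda>y. B y (p y) (q x)) has_derivative
       (\<lambda>h. fd (\<lambda>y. B y (p x) (q x)) x h + B x (fd p x h) (q x))) (at x)"
    by (rule has_derivative_linear_family[where L = "\<lambda>y a. B y a (q x)", OF S l(2) B(2)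
      smooth_on_has_derivative[OF p S(2)]])
  ultimately show ?thesis by (simp add: fd_unique)
qed

lemma smooth_on_fst_comp: "open S \<Longrightarrow> smooth_on S f \<Longrightarrow> smooth_on S (\<lambda>x. fst (f x))"
  by (rule smooth_on_linear_compose[OF _ bounded_linear_fst])

lemma smooth_on_vec_nth: "open S \<Longrightarrow> smooth_on S f \<Longrightarrow> smooth_on S (\<lambda>x. f x $ i)"
  by (rule smooth_on_linear_compose[OF _ bounded_linear_vec_nth])

lemma smooth_on_ident: "smooth_on S (\<lambda>x. x)"
  by (rule smooth_on_linear[OF bounded_linear_ident])

lemma smooth_on_fst: "smooth_on S fst"
  by (rule smooth_on_linear[OF bounded_linear_fst])

lemma smooth_on_snd: "smooth_on S snd"
  by (rule smooth_on_linear[OF bounded_linear_snd])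

lemma bounded_linear_euclidean: "linear f \<Longrightarrow> bounded_linear (f :: 'a::euclidean_space \<Rightarrow> 'b::real_normed_vector)"
  by (simp add: linear_conv_bounded_linear)

lemma smooth_on_chain:
  assumes "smooth_on S f" "(h has_derivative h') (at x)" "h x \<in> S"
  shows "((\<lambda>y. f (h y)) has_derivative (\<lambda>v. fd f (h x) (h' v))) (at x)"
  by (rule has_derivative_compose[of h h' x UNIV f, OF assms(2) smooth_on_has_derivative[OF assms(1,3)]])

section \<open>Symmetry of second derivatives\<close>

lemma second_difference_mean_value:
  fixes f :: "'a::real_normed_vector \<Rightarrow> real"
  assumes S: "open S" "smooth_on S f" and h: "0 < h" "\<And>s t. s \<in> {0..h} \<Longrightarrow> t \<in> {0..h} \<Longrightarrow> x + s *\<^sub>R a + t *\<^sub>R b \<in> S"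
  obtains s t where "s \<in> {0..h}" "t \<in> {0..h}"
    "f (x + h *\<^sub>R a + h *\<^sub>R b) - f (x + h *\<^sub>R a) - f (x + h *\<^sub>R b) + f x =
      h\<^sup>2 * fd (\<lambda>y. fd f y a) (x + s *\<^sub>R a + t *\<^sub>R b) b"
proof -
  \<comment> \<open>The second difference is the increment of \<phi> over the interval from 0 to h.
    The mean value theorem is applied to \<phi> in direction a, and then to the resulting difference
    in direction b.\<close>
  define \<phi> where "\<phi> s = f (x + h *\<^sub>R b + s *\<^sub>R a) - f (x + s *\<^sub>R a)" for s
  have D: "((\<lambda>s. f (y + s *\<^sub>R v)) has_real_derivative fd f (y + s *\<^sub>R v) v) (at s)"
    if "smooth_on S f" "y + s *\<^sub>R v \<in> S" for f :: "'a \<Rightarrow> real" and y v s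
  proof -
    have "((\<lambda>s. y + s *\<^sub>R v) has_derivative (\<lambda>s. 0 + s *\<^sub>R v)) (at s)"
      by (intro has_derivative_add has_derivative_const has_derivative_scaleR_left has_derivative_ident)
    from smooth_on_chain[OF that(1) this that(2)]
    have "((\<lambda>s. f (y + s *\<^sub>R v)) has_derivative (\<lambda>t. fd f (y + s *\<^sub>R v) (t *\<^sub>R v))) (at s)"
      by simp
    moreover have "fd f (y + s *\<^sub>R v) (t *\<^sub>R v) = fd f (y + s *\<^sub>R v) v * t" for t
      using linear_cmul[OF smooth_on_linear_fd[OF that]] by simp
    ultimately show ?thesis by (simp add: has_field_derivative_def)
  qed
  have "DERIV \<phi> s :> fd f (x + h *\<^sub>R b + s *\<^sub>R a) a - fd f (x + s *\<^sub>R a) a" if "0 \<le> s" "s \<le> h" for s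
    unfolding \<phi>_def
    by (rule DERIV_diff[OF D[OF S(2)] D[OF S(2)]])
      (use h(2)[of s h] h(2)[of s 0] that h(1) in \<open>simp_all add: add.commute add.left_commute\<close>)
  from MVT2[OF h(1) this] obtain s where s: "0 < s" "s < h"
    "\<phi> h - \<phi> 0 = h * (fd f (x + h *\<^sub>R b + s *\<^sub>R a) a - fd f (x + s *\<^sub>R a) a)" by auto
  have "DERIV (\<lambda>t. fd f (x + s *\<^sub>R a + t *\<^sub>R b) a) t :> fd (\<lambda>y. fd f y a) (x + s *\<^sub>R a + t *\<^sub>R b) b"
    if "0 \<le> t" "t \<le> h" for t
    using h(2)[of s t] s(1,2) that by (intro D[OF smooth_on_fd[OF S(2)]]) auto
  from MVT2[OF h(1) this] obtain t where t: "0 < t" "t < h"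
    "fd f (x + s *\<^sub>R a + h *\<^sub>R b) a - fd f (x + s *\<^sub>R a) a = h * fd (\<lambda>y. fd f y a) (x + s *\<^sub>R a + t *\<^sub>R b) b" by auto
  have "x + h *\<^sub>R b + s *\<^sub>R a = x + s *\<^sub>R a + h *\<^sub>R b" by (simp only: ac_simps)
  then have "\<phi> h - \<phi> 0 = h * (h * fd (\<lambda>y. fd f y a) (x + s *\<^sub>R a + t *\<^sub>R b) b)"
    by (simp only: s(3) t(3))
  moreover have eq: "x + h *\<^sub>R b + h *\<^sub>R a = x + h *\<^sub>R a + h *\<^sub>R b" by (simp only: ac_simps)
  have "\<phi> h = f (x + h *\<^sub>R a + h *\<^sub>R b) - f (x + h *\<^sub>R a)" by (simp only: \<phi>_def eq)
  moreover have "\<phi> 0 = f (x + h *\<^sub>R b) - f x" by (simp add: \<phi>_def)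
  ultimately show thesis
    using s t by (intro that[of s t]) (auto simp: power2_eq_square algebra_simps)
qed

text \<open>The second difference over a parallelogram is symmetric in a and b, and equals h^2 times
  either mixed derivative at some point of the parallelogram. As it shrinks to x, continuity
  identifies the two values.\<close>

lemma smooth_on_fd_fd_commute_real:
  fixes f :: "'a::real_normed_vector \<Rightarrow> real"
  assumes S: "open S" "smooth_on S f" "x \<in> S"
  shows "fd (\<lambda>y. fd f y a) x b = fd (\<lambda>y. fd f y b) x a"
proof (rule ccontr)
  let ?F = "\<lambda>y. fd (\<lambda>y. fd f y a) y b" and ?G = "\<lambda>y. fd (\<lambda>y. fd f y b) y a"
  assume ne: "?F x \<noteq> ?G x"
  define e where "e = \<bar>?F x - ?G x\<bar> / 2"
  have e: "e > 0" using ne by (simp add: e_def)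
  have "continuous (at x) ?F" "continuous (at x) ?G"
    using smooth_on_continuous[OF smooth_on_fd[OF smooth_on_fd[OF S(2)]]] S(1,3)
    by (auto simp: continuous_on_eq_continuous_at)
  then obtain d1 d2 where d: "d1 > 0" "\<And>y. dist y x < d1 \<Longrightarrow> dist (?F y) (?F x) < e"
      "d2 > 0" "\<And>y. dist y x < d2 \<Longrightarrow> dist (?G y) (?G x) < e"
    using e unfolding continuous_at_eps_delta by metis
  obtain r where r: "r > 0" "ball x r \<subseteq> S" using S openE by blast
  define \<rho> where "\<rho> = min r (min d1 d2)"
  have \<rho>: "\<rho> > 0" using r d by (simp add: \<rho>_def)
  \<comment> \<open>This size keeps the whole parallelogram within \<rho> of x; the summand 1 keeps
    the denominator positive when a and b both vanish.\<close>
  define h where "h = \<rho> / (norm a + norm b + 1)"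
  have h: "h > 0" using \<rho> unfolding h_def
    by (intro divide_pos_pos add_nonneg_pos) auto
  have near: "dist (x + s *\<^sub>R a + t *\<^sub>R b) x < \<rho>" if "s \<in> {0..h}" "t \<in> {0..h}" for s t
  proof -
    have "dist (x + s *\<^sub>R a + t *\<^sub>R b) x = norm (s *\<^sub>R a + t *\<^sub>R b)"
      by (simp add: dist_norm add.assoc)
    also have "\<dots> \<le> s * norm a + t * norm b"
      using that norm_triangle_ineq[of "s *\<^sub>R a" "t *\<^sub>R b"] by simp
    also have "\<dots> \<le> h * norm a + h * norm b"
      using that by (intro add_mono mult_right_mono) auto
    also have "\<dots> < h * (norm a + norm b + 1)" using h by (simp add: algebra_simps)
    also have "norm a + norm b + 1 > 0" by (simp add: add_nonneg_pos)
    then have "h * (norm a + norm b + 1) = \<rho>" by (simp add: h_def)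
    finally show ?thesis .
  qed
  then have inS: "x + s *\<^sub>R a + t *\<^sub>R b \<in> S" if "s \<in> {0..h}" "t \<in> {0..h}" for s t
    using that r(2) by (fastforce simp: \<rho>_def dist_commute)
  then have inS': "x + s *\<^sub>R b + t *\<^sub>R a \<in> S" if "s \<in> {0..h}" "t \<in> {0..h}" for s t
    using that by (metis add.assoc add.commute)
  obtain s t where st: "s \<in> {0..h}" "t \<in> {0..h}" and 1:
    "f (x + h *\<^sub>R a + h *\<^sub>R b) - f (x + h *\<^sub>R a) - f (x + h *\<^sub>R b) + f x = h\<^sup>2 * ?F (x + s *\<^sub>R a + t *\<^sub>R b)"
    using second_difference_mean_value[OF S(1,2) h inS] by blast
  obtain s' t' where st': "s' \<in> {0..h}" "t' \<in> {0..h}" and 2: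
    "f (x + h *\<^sub>R b + h *\<^sub>R a) - f (x + h *\<^sub>R b) - f (x + h *\<^sub>R a) + f x = h\<^sup>2 * ?G (x + s' *\<^sub>R b + t' *\<^sub>R a)"
    using second_difference_mean_value[OF S(1,2) h inS'] by blast
  have sw: "x + h *\<^sub>R b + h *\<^sub>R a = x + h *\<^sub>R a + h *\<^sub>R b" by (simp only: ac_simps)
  from 1 2[unfolded sw] have "h\<^sup>2 * ?F (x + s *\<^sub>R a + t *\<^sub>R b) = h\<^sup>2 * ?G (x + s' *\<^sub>R b + t' *\<^sub>R a)"
    by linarith
  then have eq: "?F (x + s *\<^sub>R a + t *\<^sub>R b) = ?G (x + s' *\<^sub>R b + t' *\<^sub>R a)"
    using h by simp
  have "dist (?F (x + s *\<^sub>R a + t *\<^sub>R b)) (?F x) < e"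
    using near[OF st] by (intro d(2)) (simp add: \<rho>_def)
  moreover have sw': "x + s' *\<^sub>R b + t' *\<^sub>R a = x + t' *\<^sub>R a + s' *\<^sub>R b" by (simp only: ac_simps)
  have "dist (?G (x + s' *\<^sub>R b + t' *\<^sub>R a)) (?G x) < e"
    using near[OF st'(2,1)] unfolding sw' by (intro d(4)) (simp add: \<rho>_def)
  ultimately have "\<bar>?F x - ?G x\<bar> < 2 * e"
    unfolding eq dist_real_def by arith
  then show False by (simp add: e_def)
qed

lemma fd_inner_left:
  assumes "f differentiable (at x)"
  shows "fd (\<lambda>y. f y \<bullet> c) x v = fd f x v \<bullet> c"
proof -
  have "((\<lambda>y. f y \<bullet> c) has_derivative (\<lambda>v. fd f x v \<bullet> c)) (at x)"
    by (intro has_derivative_inner_left has_derivative_fd assms)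
  then show ?thesis by (simp add: fd_unique)
qed

lemma smooth_on_fd_fd_commute:
  fixes f :: "'a::real_normed_vector \<Rightarrow> 'b::euclidean_space"
  assumes S: "open S" "smooth_on S f" "x \<in> S"
  shows "fd (\<lambda>y. fd f y a) x b = fd (\<lambda>y. fd f y b) x a"
proof (rule euclidean_eqI)
  fix c :: 'b
  have *: "fd (\<lambda>y. fd f y a) x b \<bullet> c = fd (\<lambda>y. fd (\<lambda>y. f y \<bullet> c) y a) x b" for a b
  proof -
    have "fd (\<lambda>y. fd f y a) x b \<bullet> c = fd (\<lambda>y. fd f y a \<bullet> c) x b"
      by (rule fd_inner_left[OF smooth_on_differentiable[OF smooth_on_fd[OF S(2)] S(3)], symmetric])
    also have "fd (\<lambda>y. fd f y a \<bullet> c) x = fd (\<lambda>y. fd (\<lambda>y. f y \<bullet> c) y a) x"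
      by (rule fd_cong[OF S(1,3)]) (rule fd_inner_left[OF smooth_on_differentiable[OF S(2)], symmetric])
    finally show ?thesis .
  qed
  show "fd (\<lambda>y. fd f y a) x b \<bullet> c = fd (\<lambda>y. fd f y b) x a \<bullet> c"
    unfolding * by (rule smooth_on_fd_fd_commute_real[OF S(1) smooth_on_inner_left[OF S(1,2)] S(3)])
qed

section \<open>Smooth dependence of solutions of linear equations\<close>

lemma Ck_on_diff:
  assumes "open S" "Ck_on k S f" "Ck_on k S g"
  shows "Ck_on k S (\<lambda>x. f x - g x)"
  using Ck_on_add[OF assms(1,2) Ck_on_linear_compose[OF assms(1) bounded_linear_minus[OF bounded_linear_ident] assms(3)]]
  by simp

text \<open>The local inverse comes from the inverse function theorem applied to
  \<open>(x, v) \<mapsto> (x, L x v)\<close>.\<close>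

lemma differentiable_linear_solver:
  fixes L :: "'a::euclidean_space \<Rightarrow> 'b::euclidean_space \<Rightarrow> 'b"
  assumes S: "open S" "x \<in> S" and L: "\<And>y. y \<in> S \<Longrightarrow> linear (L y)" "\<And>y. y \<in> S \<Longrightarrow> inj (L y)"
      "\<And>b. smooth_on S (\<lambda>y. L y b)"
  obtains H where "H differentiable (at (x, L x v))" "\<And>y w. y \<in> S \<Longrightarrow> H (y, L y w) = w"
proof -
  define F where "F = (\<lambda>z. (fst z, L (fst z) (snd z)))"
  obtain M where M: "linear M" "\<And>w. M (L x w) = w" "\<And>w. L x (M w) = w"
    using linear_injective_isomorphism[OF L(1)[OF S(2)] L(2)[OF S(2)]] by auto
  define G where "G = inv_into (S \<times> UNIV) F"
  have oS: "open (S \<times> (UNIV :: 'b set))" by (rule open_Times[OF S(1) open_UNIV])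
  have inj: "inj_on F (S \<times> UNIV)"
  proof (rule inj_onI)
    fix z w assume *: "z \<in> S \<times> UNIV" "F z = F w"
    have eq: "fst z = fst w" "L (fst w) (snd z) = L (fst w) (snd w)"
      using *(2) by (auto simp: F_def)
    have "inj (L (fst w))" using * eq(1) by (intro L(2)) auto
    from injD[OF this eq(2)] show "z = w" by (rule prod_eqI[OF eq(1)])
  qed
  have smF: "smooth_on (S \<times> UNIV) (\<lambda>z. L (fst z) (snd z))"
  proof (rule smooth_on_linear_family[where L = "\<lambda>z. L (fst z)" and p = snd, OF oS])
    show "smooth_on (S \<times> (UNIV :: 'b set)) (\<lambda>z. L (fst z) b)" for b
      using smooth_on_compose[OF oS S(1) smooth_on_fst L(3)[of b]] by auto
    show "linear (L (fst z))" if "z \<in> S \<times> UNIV" for z :: "'a \<times> 'b" using that L(1) by (simp add: mem_Times_iff)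
  qed (rule smooth_on_snd)
  define F' where "F' = fd (\<lambda>z. L (fst z) (snd z)) (x, v)"
  have DL: "((\<lambda>z. L (fst z) (snd z)) has_derivative F') (at (x, v))"
    unfolding F'_def using S(2) by (intro smooth_on_has_derivative[OF smF]) simp
  have linF': "linear F'" by (rule has_derivative_linear[OF DL])
  have F'2: "F' (0, w) = L x w" for w
  proof -
    have "((\<lambda>y. (x, y)) has_derivative (\<lambda>w. (0, w))) (at v)"
      by (intro has_derivative_Pair has_derivative_const has_derivative_ident)
    from has_derivative_compose[OF this, of "\<lambda>z. L (fst z) (snd z)" F'] DL
    have "((\<lambda>y. L x y) has_derivative (\<lambda>w. F' (0, w))) (at v)"
      by simp
    moreover have "(L x has_derivative L x) (at v)"
      by (intro bounded_linear_imp_has_derivative bounded_linear_euclidean L(1) S(2))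
    ultimately show ?thesis by (metis has_derivative_unique)
  qed
  have F'1: "F' (h, w) = F' (h, 0) + L x w" for h w
    using linear_add[OF linF', of "(h, 0)" "(0, w)"] F'2 by simp
  have DF: "(F has_derivative (\<lambda>z. (fst z, F' z))) (at (x, v))"
    unfolding F_def by (intro has_derivative_Pair has_derivative_fst DL has_derivative_ident)
  have cont: "continuous_on (S \<times> UNIV) F"
    unfolding F_def by (intro continuous_on_Pair continuous_on_fst continuous_on_id smooth_on_continuous[OF smF])
  \<comment> \<open>The derivative (h, w) |-> (h, F'(h, 0) + L x w) is triangular, so its inverse is
    explicit: subtract the first column and apply M, the inverse of L x.\<close>
  have "(G has_derivative (\<lambda>z. (fst z, M (snd z - F' (fst z, 0))))) (at (F (x, v)))"
  proof (rule has_derivative_inverse_strong[OF oS _ cont _ DF])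
    show "(\<lambda>z. (fst z, F' z)) \<circ> (\<lambda>z. (fst z, M (snd z - F' (fst z, 0)))) = id"
    proof
      fix z
      have "F' (fst z, M (snd z - F' (fst z, 0))) = snd z"
        by (subst F'1) (simp add: M)
      then show "((\<lambda>z. (fst z, F' z)) \<circ> (\<lambda>z. (fst z, M (snd z - F' (fst z, 0))))) z = id z"
        by simp
    qed
    show "(x, v) \<in> S \<times> UNIV" using S(2) by simp
    show "G (F z) = z" if "z \<in> S \<times> UNIV" for z
      unfolding G_def by (rule inv_into_f_f[OF inj that])
  qed
  then have "(G has_derivative (\<lambda>z. (fst z, M (snd z - F' (fst z, 0))))) (at (x, L x v))"
    by (simp add: F_def)
  from differentiableI[OF bounded_linear.has_derivative[OF bounded_linear_snd this]]
  have "(\<lambda>z. snd (G z)) differentiable (at (x, L x v))" .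
  moreover have "snd (G (y, L y w)) = w" if "y \<in> S" for y w
  proof -
    have "G (F (y, w)) = (y, w)" unfolding G_def using inj that by simp
    then show ?thesis by (simp add: F_def)
  qed
  ultimately show thesis using that[of "\<lambda>z. snd (G z)"] by blast
qed

text \<open>Bootstrapping: the local inverse makes s continuous, and differentiable when r is.
  Differentiating \<open>L y (s y) = r y\<close> shows that each derivative of s solves a system
  with the same L and a right-hand side of one class less, so the induction on k runs over all r and
  s at once. The target is smoothness of the Christoffel symbols.\<close>

lemma smooth_on_linear_solution:
  fixes L :: "'a::euclidean_space \<Rightarrow> 'b::euclidean_space \<Rightarrow> 'b"
  assumes S: "open S" and L: "\<And>y. y \<in> S \<Longrightarrow> linear (L y)" "\<And>y. y \<in> S \<Longrightarrow> inj (L y)"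
      "\<And>b. smooth_on S (\<lambda>y. L y b)"
    and s: "\<And>y. y \<in> S \<Longrightarrow> L y (s y) = r y" and r: "smooth_on S r"
  shows "smooth_on S s"
proof -
  have "Ck_on k S s" if "\<And>y. y \<in> S \<Longrightarrow> L y (s y) = r y" "Ck_on k S r" for k r s
    using that
  proof (induction k arbitrary: r s)
    case 0
    have "isCont s x" if x: "x \<in> S" for x
    proof -
      obtain H where H: "H differentiable (at (x, L x (s x)))" "\<And>y w. y \<in> S \<Longrightarrow> H (y, L y w) = w"
        using differentiable_linear_solver[OF S x L] by metis
      have "isCont r x" using 0(2) S x by (simp add: continuous_on_eq_continuous_at)
      then have "isCont (\<lambda>y. (y, r y)) x" by (intro continuous_Pair continuous_ident)
      moreover have "isCont H (x, r x)" using H(1) 0(1)[OF x] differentiable_imp_continuous_within by metis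
      ultimately have "isCont (\<lambda>y. H (y, r y)) x" using isCont_o2[of x "\<lambda>y. (y, r y)" H] by simp
      moreover have "\<forall>\<^sub>F y in nhds x. H (y, r y) = s y"
        using eventually_nhds_in_open[OF S x] by eventually_elim (metis 0(1) H(2))
      ultimately show ?thesis by (metis isCont_cong)
    qed
    then show ?case by (simp add: continuous_at_imp_continuous_on)
  next
    case (Suc k)
    have d: "s differentiable (at x)" if x: "x \<in> S" for x
    proof -
      obtain H where H: "H differentiable (at (x, L x (s x)))" "\<And>y w. y \<in> S \<Longrightarrow> H (y, L y w) = w"
        using differentiable_linear_solver[OF S x L] by metis
      have "r differentiable (at x)" using Suc.prems(2) x by simp
      from has_derivative_Pair[OF has_derivative_ident has_derivative_fd[OF this]]
      have "((\<lambda>y. H (y, r y)) has_derivative (\<lambda>h. fd H (x, r x) (h, fd r x h))) (at x)"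
        using has_derivative_compose[of "\<lambda>y. (y, r y)" "\<lambda>h. (h, fd r x h)" x UNIV H "fd H (x, r x)"]
          has_derivative_fd[OF H(1)] Suc.prems(1)[OF x] by simp
      then have "(s has_derivative (\<lambda>h. fd H (x, r x) (h, fd r x h))) (at x)"
        by (rule has_derivative_transform_within_open[OF _ S x]) (metis Suc.prems(1) H(2))
      then show ?thesis by (rule differentiableI)
    qed
    have Cr: "Ck_on k S r" "Ck_on k S (\<lambda>y. fd r y v)" for v
      using Ck_on_Suc_imp[OF Suc.prems(2)] Suc.prems(2) by simp_all
    have Cs: "Ck_on k S s" by (rule Suc.IH[OF Suc.prems(1) Cr(1)])
    \<comment> \<open>The right-hand side of the differentiated equation. The term in which L is
      differentiated is expanded in the basis, so that its class is governed by s itself.\<close>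
    let ?r = "\<lambda>v y. fd r y v - (\<Sum>b\<in>Basis. (s y \<bullet> b) *\<^sub>R fd (\<lambda>z. L z b) y v)"
    have eq: "L y (fd s y v) = ?r v y" if y: "y \<in> S" for y v
    proof -
      have "((\<lambda>z. L z (s z)) has_derivative (\<lambda>h. fd (\<lambda>z. L z (s y)) y h + L y (fd s y h))) (at y)"
        by (rule has_derivative_linear_family[where L = L and S = S, OF S y L(1) L(3) has_derivative_fd[OF d[OF y]]])
      then have "fd (\<lambda>z. L z (s z)) y v = fd (\<lambda>z. L z (s y)) y v + L y (fd s y v)"
        by (simp add: fd_unique)
      moreover have "fd (\<lambda>z. L z (s z)) y = fd r y"
        by (rule fd_cong[OF S y Suc.prems(1)])
      moreover have "fd (\<lambda>z. L z (s y)) y = fd (\<lambda>z. \<Sum>b\<in>Basis. (s y \<bullet> b) *\<^sub>R L z b) y"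
        by (rule fd_cong[OF S y]) (rule linear_sum_Basis[OF L(1)])
      moreover have "((\<lambda>z. \<Sum>b\<in>Basis. (s y \<bullet> b) *\<^sub>R L z b) has_derivative
          (\<lambda>v. \<Sum>b\<in>Basis. (s y \<bullet> b) *\<^sub>R fd (\<lambda>z. L z b) y v)) (at y)"
        by (intro has_derivative_sum has_derivative_scaleR_right smooth_on_has_derivative[OF L(3) y])
      ultimately show ?thesis by (simp add: fd_unique)
    qed
    have "Ck_on k S (?r v)" for v
    proof (intro Ck_on_diff Ck_on_sum S Cr bounded_bilinear.Ck_on_bilinear[OF bounded_bilinear_scaleR])
      show "Ck_on k S (\<lambda>y. s y \<bullet> b)" for b
        by (rule Ck_on_linear_compose[OF S bounded_linear_inner_left Cs])
      show "Ck_on k S (\<lambda>y. fd (\<lambda>z. L z b) y v)" for b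
        using smooth_on_fd[OF L(3)] by (simp add: smooth_on_def)
    qed
    then have "Ck_on k S (\<lambda>y. fd s y v)" for v
      by (intro Suc.IH[OF eq])
    then show ?case using d by simp
  qed
  then show ?thesis unfolding smooth_on_def using s r[unfolded smooth_on_def] by metis
qed

text \<open>At a positive argument the derivative within the closed half line is an ordinary one.
  The induction on k treats all members of the family D together, since differentiating
  \<open>D j\<close> produces multiples of \<open>D (Suc j)\<close>.\<close>

lemma smooth_half_line_smooth_on:
  assumes "smooth_half_line f"
  shows "smooth_on {0<..} f"
proof -
  obtain D where D: "\<And>t. t \<ge> 0 \<Longrightarrow> D 0 t = f t"
      "\<And>k t. t \<ge> 0 \<Longrightarrow> (D k has_real_derivative D (Suc k) t) (at t within {0..})"
    using assms unfolding smooth_half_line_def by metis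
  have D': "(D k has_real_derivative D (Suc k) t) (at t)" if "t > 0" for k t
  proof -
    have "at t within {0..} = at t" using that by (intro at_within_interior) auto
    then show ?thesis using D(2)[of t k] that by simp
  qed
  have fdD: "fd (D j) t v = D (Suc j) t * v" if "t > 0" for j t v
    using fd_unique[OF D'[OF that, unfolded has_field_derivative_def]] by simp
  have "Ck_on k {0<..} (D j)" for k j
  proof (induction k arbitrary: j)
    case 0
    have "isCont (D j) t" if "t > 0" for t
      using DERIV_isCont[OF D'[OF that]] .
    then show ?case by (simp add: continuous_at_imp_continuous_on)
  next
    case (Suc k)
    have "Ck_on k {0<..} (\<lambda>t. D (Suc j) t * v)" for v
      by (intro bounded_bilinear.Ck_on_bilinear[OF bounded_bilinear_mult] Suc Ck_on_const open_greaterThan)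
    from Ck_on_transform[OF this open_greaterThan fdD] have "Ck_on k {0<..} (\<lambda>t. fd (D j) t v)" for v
      by simp
    moreover have "D j differentiable (at t)" if "t > 0" for t
      using D'[OF that, unfolded has_field_derivative_def] by (rule differentiableI)
    ultimately show ?case by simp
  qed
  then have "smooth_on {0<..} (D 0)" by (simp add: smooth_on_def)
  then show ?thesis
    by (rule smooth_on_transform[OF _ open_greaterThan]) (simp add: D(1))
qed

section \<open>Riemannian metrics on open sets\<close>

text \<open>The condition of \<open>christoffel\<close>, stated for a bilinear form on a subset of
  the model space; with the coefficients of a chart the two agree by unfolding.\<close>

definition local_christoffel :: "('e::euclidean_space \<Rightarrow> 'e \<Rightarrow> 'e \<Rightarrow> real) \<Rightarrow> 'e \<Rightarrow> 'e \<Rightarrow> 'e \<Rightarrow> 'e"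
  where "local_christoffel G y = (THE \<Gamma>. bilinear \<Gamma> \<and> (\<forall>a b. \<Gamma> a b = \<Gamma> b a) \<and>
      (\<forall>w a b. fd (\<lambda>z. G z a b) y w = G y (\<Gamma> w a) b + G y a (\<Gamma> w b)))"

text \<open>R(a,b)c for constant coordinate fields; their bracket vanishes, so no third term
  appears.\<close>

definition local_curvature :: "('e::euclidean_space \<Rightarrow> 'e \<Rightarrow> 'e \<Rightarrow> real) \<Rightarrow> 'e \<Rightarrow> 'e \<Rightarrow> 'e \<Rightarrow> 'e \<Rightarrow> 'e"
  where "local_curvature G y a b c = fd (\<lambda>z. local_christoffel G z b c) y a - fd (\<lambda>z. local_christoffel G z a c) y b
     + local_christoffel G y a (local_christoffel G y b c) - local_christoffel G y b (local_christoffel G y a c)"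

lemma lc_cong:
  assumes "open S" "y \<in> S" "\<And>z. z \<in> S \<Longrightarrow> G z = H z"
  shows "local_christoffel G y = local_christoffel H y"
proof -
  have "fd (\<lambda>z. G z a b) y = fd (\<lambda>z. H z a b) y" for a b
    by (rule fd_cong[OF assms(1,2)]) (simp add: assms(3))
  then show ?thesis unfolding local_christoffel_def assms(3)[OF assms(2)] by simp
qed

lemma riem_cong:
  assumes "open S" "y \<in> S" "\<And>z. z \<in> S \<Longrightarrow> G z = H z"
  shows "local_curvature G y = local_curvature H y"
proof -
  have "fd (\<lambda>z. local_christoffel G z a b) y = fd (\<lambda>z. local_christoffel H z a b) y" for a b
    by (rule fd_cong[OF assms(1,2)]) (simp add: lc_cong[OF assms(1) _ assms(3)])
  then show ?thesis by (intro ext) (simp add: local_curvature_def lc_cong[OF assms])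
qed

lemma bilinearI:
  assumes "\<And>a b c. B (a + b) c = B a c + B b c" "\<And>r a c. B (r *\<^sub>R a) c = r *\<^sub>R B a c"
    "\<And>a b c. B a (b + c) = B a b + B a c" "\<And>r a c. B a (r *\<^sub>R c) = r *\<^sub>R B a c"
  shows "bilinear B"
  unfolding bilinear_def using assms by (auto intro: linearI)

lemma bilinear_fd_family:
  fixes B :: "'a::real_normed_vector \<Rightarrow> 'b::euclidean_space \<Rightarrow> 'c::euclidean_space \<Rightarrow> 'd::real_normed_vector"
  assumes S: "open S" "y \<in> S" and B: "\<And>z. z \<in> S \<Longrightarrow> bilinear (B z)" "\<And>a b. smooth_on S (\<lambda>z. B z a b)"
  shows "bilinear (\<lambda>a b. fd (\<lambda>z. B z a b) y w)"
proof (rule bilinearI)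
  note D = smooth_on_has_derivative[OF B(2) S(2)]
  show "fd (\<lambda>z. B z (a + b) c) y w = fd (\<lambda>z. B z a c) y w + fd (\<lambda>z. B z b c) y w" for a b c
  proof -
    have "fd (\<lambda>z. B z (a + b) c) y = fd (\<lambda>z. B z a c + B z b c) y"
      by (rule fd_cong[OF S]) (simp add: bilinear_ladd[OF B(1)])
    then show ?thesis using fd_unique[OF has_derivative_add[OF D D]] by simp
  qed
  show "fd (\<lambda>z. B z a (b + c)) y w = fd (\<lambda>z. B z a b) y w + fd (\<lambda>z. B z a c) y w" for a b c
  proof -
    have "fd (\<lambda>z. B z a (b + c)) y = fd (\<lambda>z. B z a b + B z a c) y"
      by (rule fd_cong[OF S]) (simp add: bilinear_radd[OF B(1)])
    then show ?thesis using fd_unique[OF has_derivative_add[OF D D]] by simp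
  qed
  show "fd (\<lambda>z. B z (r *\<^sub>R a) c) y w = r *\<^sub>R fd (\<lambda>z. B z a c) y w" for r a c
  proof -
    have "fd (\<lambda>z. B z (r *\<^sub>R a) c) y = fd (\<lambda>z. r *\<^sub>R B z a c) y"
      by (rule fd_cong[OF S]) (simp add: bilinear_lmul[OF B(1)])
    then show ?thesis using fd_unique[OF has_derivative_scaleR_right[OF D]] by simp
  qed
  show "fd (\<lambda>z. B z a (r *\<^sub>R c)) y w = r *\<^sub>R fd (\<lambda>z. B z a c) y w" for r a c
  proof -
    have "fd (\<lambda>z. B z a (r *\<^sub>R c)) y = fd (\<lambda>z. r *\<^sub>R B z a c) y"
      by (rule fd_cong[OF S]) (simp add: bilinear_rmul[OF B(1)])
    then show ?thesis using fd_unique[OF has_derivative_scaleR_right[OF D]] by simp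
  qed
qed

lemma bilinear_lsum_Basis:
  fixes B :: "'a::euclidean_space \<Rightarrow> 'b::real_vector \<Rightarrow> real"
  shows "bilinear B \<Longrightarrow> B a c = (\<Sum>i\<in>Basis. (a \<bullet> i) * B i c)"
  using linear_sum_Basis[of "\<lambda>a. B a c" a] by (simp add: bilinear_def)

text \<open>Shared by the metric of the base, its pullbacks and the frame metric in coordinates, so
  that connection and curvature are developed once for all of them.\<close>

locale local_metric =
  fixes S :: "'e::euclidean_space set" and G :: "'e \<Rightarrow> 'e \<Rightarrow> 'e \<Rightarrow> real"
  assumes open_S: "open S"
    and bil: "y \<in> S \<Longrightarrow> bilinear (G y)"
    and sym: "y \<in> S \<Longrightarrow> G y a b = G y b a"
    and pos: "y \<in> S \<Longrightarrow> a \<noteq> 0 \<Longrightarrow> G y a a > 0"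
    and smooth: "smooth_on S (\<lambda>y. G y a b)"
begin

abbreviation "\<Gamma> \<equiv> local_christoffel G"
abbreviation "R \<equiv> local_curvature G"

lemmas G_simps = bilinear_ladd[OF bil] bilinear_radd[OF bil] bilinear_lmul[OF bil] bilinear_rmul[OF bil]
  bilinear_lneg[OF bil] bilinear_rneg[OF bil] bilinear_lsub[OF bil] bilinear_rsub[OF bil]
  bilinear_lzero[OF bil] bilinear_rzero[OF bil]

lemma nondeg:
  assumes "y \<in> S" "\<And>c. G y a c = G y b c"
  shows "a = b"
proof (rule ccontr)
  assume "a \<noteq> b"
  then have "G y (a - b) (a - b) > 0" by (intro pos assms(1)) simp
  then show False using assms by (simp add: G_simps)
qed

text \<open>The map sends a to the Euclidean vector that represents the functional G(a, .). It is
  the linear system behind the Christoffel symbols: solved pointwise for existence, and as a smooth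
  family for regularity.\<close>

lemma gram:
  assumes "y \<in> S"
  shows "linear (\<lambda>a. \<Sum>b\<in>Basis. G y a b *\<^sub>R b)" "inj (\<lambda>a. \<Sum>b\<in>Basis. G y a b *\<^sub>R b)"
proof -
  show "linear (\<lambda>a. \<Sum>b\<in>Basis. G y a b *\<^sub>R b)"
    by (rule linearI) (simp_all add: G_simps assms scaleR_add_left sum.distrib scaleR_sum_right)
  show "inj (\<lambda>a. \<Sum>b\<in>Basis. G y a b *\<^sub>R b)"
  proof (rule injI)
    fix a a' assume eq: "(\<Sum>b\<in>Basis. G y a b *\<^sub>R b) = (\<Sum>b\<in>Basis. G y a' b *\<^sub>R b)"
    have "G y a b = G y a' b" if "b \<in> Basis" for b
      using arg_cong[OF eq, of "\<lambda>v. v \<bullet> b"] that by (simp add: inner_sum_left inner_Basis if_distrib cong: if_cong)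
    then have "G y a c = G y a' c" for c
      by (subst (1 2) sym[OF assms], subst (1 2) bilinear_lsum_Basis[OF bil[OF assms]])
        (simp add: sym[OF assms])
    then show "a = a'" by (rule nondeg[OF assms])
  qed
qed

lemma riesz:
  assumes "y \<in> S" "linear f"
  shows "\<exists>a. \<forall>c. G y a c = f c"
proof -
  have "surj (\<lambda>a. \<Sum>b\<in>Basis. G y a b *\<^sub>R b)"
    by (rule linear_injective_imp_surjective[OF gram[OF assms(1)] refl])
  from surjD[OF this, of "\<Sum>b\<in>Basis. f b *\<^sub>R b"]
  obtain a where a: "(\<Sum>b\<in>Basis. G y a b *\<^sub>R b) = (\<Sum>b\<in>Basis. f b *\<^sub>R b)"
    by metis
  have *: "G y a b = f b" if "b \<in> Basis" for b
    using arg_cong[OF a, of "\<lambda>v. v \<bullet> b"] that by (simp add: inner_sum_left inner_Basis if_distrib cong: if_cong)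
  have "G y a c = f c" for c
  proof -
    have "G y a c = (\<Sum>b\<in>Basis. (c \<bullet> b) * G y a b)"
      using linear_sum_Basis[of "G y a" c] bil[OF assms(1)] by (simp add: bilinear_def)
    also have "\<dots> = f c" using linear_sum_Basis[OF assms(2), of c] by (simp add: *)
    finally show ?thesis .
  qed
  then show ?thesis by blast
qed

definition dG :: "'e \<Rightarrow> 'e \<Rightarrow> 'e \<Rightarrow> 'e \<Rightarrow> real"
  where "dG y w a b = fd (\<lambda>z. G z a b) y w"

lemma bilinear_dG: "y \<in> S \<Longrightarrow> bilinear (dG y w)"
  unfolding dG_def by (rule bilinear_fd_family[OF open_S _ bil smooth])

lemma linear_dG: "y \<in> S \<Longrightarrow> linear (\<lambda>w. dG y w a b)"
  unfolding dG_def using smooth_on_linear_fd[OF smooth] by simp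

lemma dG_sym: "y \<in> S \<Longrightarrow> dG y w a b = dG y w b a"
  unfolding dG_def by (rule fun_cong[OF fd_cong[OF open_S _ sym]])

text \<open>The Christoffel symbols of the first kind.\<close>

definition koszul :: "'e \<Rightarrow> 'e \<Rightarrow> 'e \<Rightarrow> 'e \<Rightarrow> real"
  where "koszul y w a b = (dG y w a b + dG y a w b - dG y b w a) / 2"

text \<open>Permuting the arguments in the metric condition and using symmetry forces the Koszul
  formula, so nondegeneracy gives uniqueness. Conversely the Riesz representation of the Koszul
  expression has all the required properties.\<close>

lemma lc_unique:
  assumes y: "y \<in> S"
  shows "\<exists>!\<Gamma>. bilinear \<Gamma> \<and> (\<forall>a b. \<Gamma> a b = \<Gamma> b a) \<and>
      (\<forall>w a b. fd (\<lambda>z. G z a b) y w = G y (\<Gamma> w a) b + G y a (\<Gamma> w b))"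
    and "(\<forall>a b. C a b = C b a) \<Longrightarrow>
      (\<forall>w a b. fd (\<lambda>z. G z a b) y w = G y (C w a) b + G y a (C w b)) \<Longrightarrow> G y (C w a) b = koszul y w a b"
proof -
  show *: "G y (C w a) b = koszul y w a b" if "\<forall>a b. C a b = C b a"
    "\<forall>w a b. fd (\<lambda>z. G z a b) y w = G y (C w a) b + G y a (C w b)" for C w a b
  proof -
    have "dG y w a b = G y (C w a) b + G y a (C w b)" for w a b using that(2) by (simp add: dG_def)
    moreover have "C a w = C w a" "C b w = C w b" "C b a = C a b" using that(1) by auto
    moreover have "G y a (C w b) = G y (C w b) a" "G y w (C a b) = G y (C a b) w" using sym[OF y] by auto
    ultimately show ?thesis by (simp add: koszul_def)
  qed
  note lins = bilinear_ladd[OF bilinear_dG[OF y]] bilinear_radd[OF bilinear_dG[OF y]]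
    bilinear_lmul[OF bilinear_dG[OF y]] bilinear_rmul[OF bilinear_dG[OF y]]
    linear_add[OF linear_dG[OF y]] linear_cmul[OF linear_dG[OF y]]
  have "\<exists>v. \<forall>c. G y v c = koszul y w a c" for w a
    by (rule riesz[OF y]) (rule linearI, simp_all add: koszul_def lins field_simps)
  then obtain C where C: "\<And>w a c. G y (C w a) c = koszul y w a c" by metis
  have "bilinear C"
    by (rule bilinearI; rule nondeg[OF y]) (simp_all add: C G_simps y koszul_def lins field_simps)
  moreover have "C w a = C a w" for w a
    by (rule nondeg[OF y]) (simp add: C koszul_def dG_sym[OF y, of _ a w])
  moreover have "fd (\<lambda>z. G z a b) y w = G y (C w a) b + G y a (C w b)" for w a b
    unfolding sym[OF y, of a "C w b"] C koszul_def
    by (simp add: dG_sym[OF y, of _ b w] dG_sym[OF y, of _ a w] dG_sym[OF y, of _ b a] dG_def[symmetric] field_simps)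
  ultimately show "\<exists>!\<Gamma>. bilinear \<Gamma> \<and> (\<forall>a b. \<Gamma> a b = \<Gamma> b a) \<and>
      (\<forall>w a b. fd (\<lambda>z. G z a b) y w = G y (\<Gamma> w a) b + G y a (\<Gamma> w b))"
  proof (intro ex1I[of _ C] conjI allI)
    fix C' assume "bilinear C' \<and> (\<forall>a b. C' a b = C' b a) \<and>
      (\<forall>w a b. fd (\<lambda>z. G z a b) y w = G y (C' w a) b + G y a (C' w b))"
    then have "G y (C' w a) b = koszul y w a b" for w a b
      by (intro *) simp_all
    then have "G y (C' w a) b = G y (C w a) b" for w a b
      by (simp add: C)
    then have "C' w a = C w a" for w a by (rule nondeg[OF y])
    then show "C' = C" by blast
  qed auto
qed

lemma
  assumes y: "y \<in> S"
  shows bilinear_lc: "bilinear (\<Gamma> y)" and lc_sym: "\<Gamma> y a b = \<Gamma> y b a"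
    and lc_metric: "fd (\<lambda>z. G z a b) y w = G y (\<Gamma> y w a) b + G y a (\<Gamma> y w b)"
    and lc_koszul: "G y (\<Gamma> y w a) b = (fd (\<lambda>z. G z a b) y w + fd (\<lambda>z. G z w b) y a - fd (\<lambda>z. G z w a) y b) / 2"
proof -
  have *: "bilinear (\<Gamma> y) \<and> (\<forall>a b. \<Gamma> y a b = \<Gamma> y b a) \<and>
      (\<forall>w a b. fd (\<lambda>z. G z a b) y w = G y (\<Gamma> y w a) b + G y a (\<Gamma> y w b))"
    unfolding local_christoffel_def using theI'[OF lc_unique(1)[OF y]] .
  then show "bilinear (\<Gamma> y)" "\<Gamma> y a b = \<Gamma> y b a"
    "fd (\<lambda>z. G z a b) y w = G y (\<Gamma> y w a) b + G y a (\<Gamma> y w b)" by blast+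
  show "G y (\<Gamma> y w a) b = (fd (\<lambda>z. G z a b) y w + fd (\<lambda>z. G z w b) y a - fd (\<lambda>z. G z w a) y b) / 2"
    using lc_unique(2)[OF y, of "\<Gamma> y"] * by (simp add: koszul_def dG_def)
qed

lemma lc_eqI:
  assumes "y \<in> S" "bilinear C" "\<And>a b. C a b = C b a"
    "\<And>w a b. fd (\<lambda>z. G z a b) y w = G y (C w a) b + G y a (C w b)"
  shows "\<Gamma> y = C"
  unfolding local_christoffel_def by (rule the1_equality[OF lc_unique(1)[OF assms(1)]]) (use assms in blast)

lemmas lc_simps = bilinear_ladd[OF bilinear_lc] bilinear_radd[OF bilinear_lc] bilinear_lmul[OF bilinear_lc]
  bilinear_rmul[OF bilinear_lc] bilinear_lneg[OF bilinear_lc] bilinear_rneg[OF bilinear_lc]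
  bilinear_lsub[OF bilinear_lc] bilinear_rsub[OF bilinear_lc]
  bilinear_lzero[OF bilinear_lc] bilinear_rzero[OF bilinear_lc]

lemma smooth_lc: "smooth_on S (\<lambda>y. \<Gamma> y w a)"
proof (rule smooth_on_linear_solution[where L = "\<lambda>y v. \<Sum>b\<in>Basis. G y v b *\<^sub>R b"
      and r = "\<lambda>y. \<Sum>b\<in>Basis. koszul y w a b *\<^sub>R b"])
  show "smooth_on S (\<lambda>y. \<Sum>b\<in>Basis. G y v b *\<^sub>R b)" for v
    by (intro smooth_on_sum smooth_on_scaleR open_S smooth smooth_on_const)
  have "smooth_on S (\<lambda>y. dG y w a b)" for w a b
    unfolding dG_def by (rule smooth_on_fd[OF smooth])
  then have "smooth_on S (\<lambda>y. (dG y w a b + dG y a w b - dG y b w a) * (1 / 2))" for b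
    by (intro smooth_on_mult smooth_on_diff smooth_on_add open_S smooth_on_const)
  then show "smooth_on S (\<lambda>y. \<Sum>b\<in>Basis. koszul y w a b *\<^sub>R b)"
    unfolding koszul_def by (intro smooth_on_sum smooth_on_scaleR open_S smooth_on_const) simp
  show "(\<Sum>b\<in>Basis. G y (\<Gamma> y w a) b *\<^sub>R b) = (\<Sum>b\<in>Basis. koszul y w a b *\<^sub>R b)" if "y \<in> S" for y
    by (simp only: lc_koszul[OF that] koszul_def dG_def)
qed (use open_S gram in auto)

lemma bilinear_dlc: "y \<in> S \<Longrightarrow> bilinear (\<lambda>a b. fd (\<lambda>z. \<Gamma> z a b) y w)"
  by (rule bilinear_fd_family[OF open_S _ bilinear_lc smooth_lc])

lemma linear_dlc: "y \<in> S \<Longrightarrow> linear (fd (\<lambda>z. \<Gamma> z a b) y)"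
  by (rule smooth_on_linear_fd[OF smooth_lc])

lemma dlc_sym: "y \<in> S \<Longrightarrow> fd (\<lambda>z. \<Gamma> z a b) y = fd (\<lambda>z. \<Gamma> z b a) y"
  by (rule fd_cong[OF open_S _ lc_sym])

lemmas dlc_simps = bilinear_ladd[OF bilinear_dlc] bilinear_radd[OF bilinear_dlc] bilinear_lmul[OF bilinear_dlc]
  bilinear_rmul[OF bilinear_dlc] linear_add[OF linear_dlc] linear_cmul[OF linear_dlc]

text \<open>Metric compatibility replaces the derivative of the coefficients by Christoffel terms,
  which complete the derivatives of p and q to covariant ones.\<close>

lemma has_derivative_metric:
  assumes y: "y \<in> S" and p: "smooth_on S p" and q: "smooth_on S q"
  shows "((\<lambda>z. G z (p z) (q z)) has_derivative
    (\<lambda>v. G y (fd p y v + \<Gamma> y v (p y)) (q y) + G y (p y) (fd q y v + \<Gamma> y v (q y)))) (at y)"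
proof -
  have "((\<lambda>z. G z (p z) (q z)) has_derivative
    (\<lambda>v. fd (\<lambda>z. G z (p y) (q y)) y v + G y (fd p y v) (q y) + G y (p y) (fd q y v))) (at y)"
    by (rule has_derivative_bilinear_family[where B = G, OF open_S y bil smooth p smooth_on_has_derivative[OF q y]])
  then show ?thesis by (simp add: lc_metric[OF y] G_simps y ac_simps)
qed

lemma fd_metric:
  assumes "y \<in> S" "smooth_on S p" "smooth_on S q"
  shows "fd (\<lambda>z. G z (p z) (q z)) y v =
    G y (fd p y v + \<Gamma> y v (p y)) (q y) + G y (p y) (fd q y v + \<Gamma> y v (q y))"
  using fd_unique[OF has_derivative_metric[OF assms]] by simp

lemma fd_metric_const:
  assumes "y \<in> S" "smooth_on S p"
  shows "fd (\<lambda>z. G z (p z) c) y v = G y (fd p y v + \<Gamma> y v (p y)) c + G y (p y) (\<Gamma> y v c)"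
  using fd_metric[OF assms smooth_on_const[of S c]] by simp

text \<open>For coordinate fields \<open>v\<close>, \<open>w\<close> the sectional curvature needs the Christoffel symbols only at
  the point itself, not their derivatives.\<close>

lemma riem_second_derivatives:
  assumes y: "y \<in> S"
  shows "G y (R y v w w) v =
    fd (\<lambda>z. fd (\<lambda>x. G x w v) z w) y v - fd (\<lambda>z. fd (\<lambda>x. G x w w) z v) y v / 2
    - fd (\<lambda>z. fd (\<lambda>x. G x v v) z w) y w / 2
    - G y (\<Gamma> y w w) (\<Gamma> y v v) + G y (\<Gamma> y v w) (\<Gamma> y v w)"
proof -
  have s2: "smooth_on S (\<lambda>z. fd (\<lambda>x. G x a b) z c)" for a b c
    by (rule smooth_on_fd[OF smooth])
  note D = smooth_on_has_derivative[OF s2 y]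
  \<comment> \<open>By Koszul, G(\<Gamma>(w,w), v) consists of first derivatives of G.
    Differentiating it along v by the product rule isolates the derivative of \<Gamma>(w,w), which
    is thereby expressed by second derivatives of G.\<close>
  have "fd (\<lambda>z. G z (\<Gamma> z w w) v) y v = fd (\<lambda>z. fd (\<lambda>x. G x w v) z w - fd (\<lambda>x. G x w w) z v * (1/2)) y v"
    by (subst fd_cong[OF open_S y, of _ "\<lambda>z. fd (\<lambda>x. G x w v) z w - fd (\<lambda>x. G x w w) z v * (1/2)"])
      (simp_all add: lc_koszul)
  also have "\<dots> = fd (\<lambda>z. fd (\<lambda>x. G x w v) z w) y v - fd (\<lambda>z. fd (\<lambda>x. G x w w) z v) y v / 2"
    using fd_unique[OF has_derivative_diff[OF D has_derivative_mult_left[OF D, where y = "1/2"]]] by simp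
  finally have 1: "G y (fd (\<lambda>z. \<Gamma> z w w) y v + \<Gamma> y v (\<Gamma> y w w)) v + G y (\<Gamma> y w w) (\<Gamma> y v v) =
     fd (\<lambda>z. fd (\<lambda>x. G x w v) z w) y v - fd (\<lambda>z. fd (\<lambda>x. G x w w) z v) y v / 2"
    by (simp add: fd_metric_const[OF y smooth_lc])
  \<comment> \<open>Two of the three Koszul terms cancel because G is symmetric.\<close>
  have eq: "G z (\<Gamma> z v w) v = fd (\<lambda>x. G x v v) z w * (1/2)" if "z \<in> S" for z
  proof -
    have "fd (\<lambda>x. G x w v) z v = fd (\<lambda>x. G x v w) z v"
      by (subst fd_cong[OF open_S that, of _ "\<lambda>x. G x v w"]) (simp_all add: sym)
    then show ?thesis by (simp add: lc_koszul[OF that])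
  qed
  have "fd (\<lambda>z. G z (\<Gamma> z v w) v) y w = fd (\<lambda>z. fd (\<lambda>x. G x v v) z w * (1/2)) y w"
    by (subst fd_cong[OF open_S y eq]) simp_all
  also have "\<dots> = fd (\<lambda>z. fd (\<lambda>x. G x v v) z w) y w / 2"
    using fd_unique[OF has_derivative_mult_left[OF D, where y = "1/2"]] by simp
  finally have 2: "G y (fd (\<lambda>z. \<Gamma> z v w) y w + \<Gamma> y w (\<Gamma> y v w)) v + G y (\<Gamma> y v w) (\<Gamma> y w v) =
     fd (\<lambda>z. fd (\<lambda>x. G x v v) z w) y w / 2"
    by (simp add: fd_metric_const[OF y smooth_lc])
  have "G y (R y v w w) v = G y (fd (\<lambda>z. \<Gamma> z w w) y v + \<Gamma> y v (\<Gamma> y w w)) v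
      - G y (fd (\<lambda>z. \<Gamma> z v w) y w + \<Gamma> y w (\<Gamma> y v w)) v"
    by (simp add: local_curvature_def G_simps y)
  with 1 2 lc_sym[OF y, of w v] show ?thesis by simp
qed

section \<open>Symmetries of the curvature tensor\<close>

lemma riem_antisym: "R y a b c = - R y b a c"
  by (simp add: local_curvature_def)

lemma riem_bianchi: "y \<in> S \<Longrightarrow> R y a b c + R y b c a + R y c a b = 0"
  by (simp add: local_curvature_def dlc_sym[of y b a] dlc_sym[of y c a] dlc_sym[of y c b] lc_sym[of y b a] lc_sym[of y c a]
      lc_sym[of y c b])

text \<open>G(\<nabla>_a \<nabla>_b c, c) + G(\<nabla>_b c, \<nabla>_a c) is half the second
  derivative of G(c,c), hence symmetric in a and b; antisymmetrising the first summand therefore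
  gives zero.\<close>

lemma riem_skew_self:
  assumes y: "y \<in> S"
  shows "G y (R y a b c) c = 0"
proof -
  have s2: "smooth_on S (\<lambda>z. fd (\<lambda>x. G x c c) z d)" for d
    by (rule smooth_on_fd[OF smooth])
  have eq: "G y (fd (\<lambda>z. \<Gamma> z b c) y a + \<Gamma> y a (\<Gamma> y b c)) c + G y (\<Gamma> y b c) (\<Gamma> y a c) =
     fd (\<lambda>z. fd (\<lambda>x. G x c c) z b) y a / 2" for a b
  proof -
    have "G z (\<Gamma> z b c) c = fd (\<lambda>x. G x c c) z b * (1/2)" if "z \<in> S" for z
      using lc_metric[OF that, of c c b] sym[OF that, of c "\<Gamma> z b c"] by simp
    from fd_cong[OF open_S y this]
    have "fd (\<lambda>z. G z (\<Gamma> z b c) c) y a = fd (\<lambda>z. fd (\<lambda>x. G x c c) z b * (1/2)) y a" by simp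
    then show ?thesis
      using fd_unique[OF has_derivative_mult_left[OF smooth_on_has_derivative[OF s2 y], where y = "1/2"]]
      by (simp add: fd_metric_const[OF y smooth_lc])
  qed
  have "fd (\<lambda>z. fd (\<lambda>x. G x c c) z b) y a = fd (\<lambda>z. fd (\<lambda>x. G x c c) z a) y b"
    by (rule smooth_on_fd_fd_commute[OF open_S smooth y])
  with eq[of b a] eq[of a b] show ?thesis
    by (simp add: local_curvature_def G_simps y sym[OF y, of "\<Gamma> y a c" "\<Gamma> y b c"])
qed

lemma riem_linear:
  assumes y: "y \<in> S"
  shows "R y (a + b) c d = R y a c d + R y b c d" "R y c (a + b) d = R y c a d + R y c b d"
    "R y c d (a + b) = R y c d a + R y c d b"
    "R y (r *\<^sub>R a) c d = r *\<^sub>R R y a c d" "R y c (r *\<^sub>R a) d = r *\<^sub>R R y c a d" "R y c d (r *\<^sub>R a) = r *\<^sub>R R y c d a"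
  by (simp_all add: local_curvature_def dlc_simps lc_simps y algebra_simps)

lemma riem_skew:
  assumes y: "y \<in> S"
  shows "G y (R y a b c) d = - G y (R y a b d) c"
  using riem_skew_self[OF y, of a b "c + d"] riem_skew_self[OF y, of a b c] riem_skew_self[OF y, of a b d]
  by (simp add: riem_linear y G_simps)

text \<open>The classical octahedron argument: the four Bianchi identities obtained by rotating the
  arguments cyclically are combined, with terms identified through the two skew-symmetries.\<close>

lemma riem_pair_sym:
  assumes y: "y \<in> S"
  shows "G y (R y a b c) d = G y (R y c d a) b"
proof -
  let ?T = "\<lambda>a b c d. G y (R y a b c) d"
  have 1: "?T a b c d = - ?T b a c d" for a b c d
    using riem_antisym[of y a b c] by (simp add: G_simps y)
  have 2: "?T a b c d + ?T b c a d + ?T c a b d = 0" for a b c d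
    using arg_cong[OF riem_bianchi[OF y, of a b c], of "\<lambda>v. G y v d"] by (simp add: G_simps y)
  note 3 = riem_skew[OF y]
  show ?thesis
    using 2[of a b c d] 2[of b c d a] 2[of c d a b] 2[of d a b c]
      3[of b c d a] 3[of c d b a] 1[of d b c a] 1[of d a c b] 3[of a d c b] 1[of a c d b] 3[of c a d b]
      1[of d a b c] 3[of a b d c] 3[of b d a c]
    by linarith
qed

text \<open>The difference of \<open>R\<close> and the model tensor vanishes on all \<open>T(a,b,b,a)\<close>; polarisation makes it
  totally antisymmetric, and the Bianchi identity then forces it to be zero.\<close>

lemma riem_constant_curvature:
  assumes y: "y \<in> S" and K: "\<And>a b. G y (R y a b b) a = \<kappa> * (G y a a * G y b b - (G y a b)\<^sup>2)"
  shows "R y a b c = \<kappa> *\<^sub>R (G y b c *\<^sub>R a - G y a c *\<^sub>R b)"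
proof -
  define T where "T a b c d = G y (R y a b c) d - \<kappa> * (G y b c * G y a d - G y a c * G y b d)" for a b c d
  have add: "T (a + a') b c d = T a b c d + T a' b c d" "T a (b + b') c d = T a b c d + T a b' c d"
    "T a b (c + c') d = T a b c d + T a b c' d"
    "T a b c (d + d') = T a b c d + T a b c d'" for a b c d a' b' c' d'
    by (simp_all add: T_def riem_linear G_simps y algebra_simps)
  have 12: "T a b c d = - T b a c d" for a b c d
    using riem_antisym[of y a b c] by (simp add: T_def G_simps y algebra_simps)
  have 34: "T a b c d = - T a b d c" for a b c d
    using riem_skew[OF y, of a b c d] by (simp add: T_def algebra_simps)
  have pair: "T a b c d = T c d a b" for a b c d
    using riem_pair_sym[OF y, of a b c d]
    by (simp add: T_def sym[OF y, of c a] sym[OF y, of d b] sym[OF y, of d a] sym[OF y, of c b] mult.commute)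
  have bianchi: "T a b c d + T b c a d + T c a b d = 0" for a b c d
    using arg_cong[OF riem_bianchi[OF y, of a b c], of "\<lambda>v. G y v d"]
    by (simp add: T_def G_simps y sym[OF y, of b a] sym[OF y, of c a] sym[OF y, of c b] algebra_simps)
  have zero: "T a b b a = 0" for a b
    using K[of a b] sym[OF y, of b a] by (simp add: T_def power2_eq_square algebra_simps)
  \<comment> \<open>Pair symmetry makes T(a,b,c,a) symmetric in b and c, so polarising the middle
    pair determines it. Polarising the outer pair next gives antisymmetry in positions 1 and
    4.\<close>
  have zero': "T a b c a = 0" for a b c
    using zero[of a "b + c", unfolded add] zero[of a b] zero[of a c] pair[of a c b a] 12[of b a a c] 34[of a b a c]
    by linarith
  have swap14: "T a b c d = - T d b c a" for a b c d
    using zero'[of "a + d" b c, unfolded add] zero'[of a b c] zero'[of d b c] by linarith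
  \<comment> \<open>T now changes sign under enough transpositions to be alternating. A cyclic shift
    of three arguments is even and fixes T, so the Bianchi identity reads 3 T = 0.\<close>
  have cyc: "T b c a d = T a b c d" for a b c d
    using swap14[of a b c d] 34[of d b c a] swap14[of d b a c] 12[of b c a d] by linarith
  have "T a b c d = 0" for a b c d
    using bianchi[of a b c d] cyc[of a b c d] cyc[of c a b d] cyc[of b c a d] by linarith
  then show ?thesis
    by (intro nondeg[OF y]) (simp add: T_def G_simps y algebra_simps)
qed

end

section \<open>Pullback along local diffeomorphisms\<close>

lemma fd_compose:
  assumes "smooth_on S f" "h differentiable (at x)" "h x \<in> S"
  shows "fd (\<lambda>y. f (h y)) x v = fd f (h x) (fd h x v)"
  using fd_unique[OF smooth_on_chain[OF assms(1) has_derivative_fd[OF assms(2)] assms(3)]] by simp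

definition pullback_form :: "('e \<Rightarrow> 'e \<Rightarrow> 'e \<Rightarrow> real) \<Rightarrow> ('e::euclidean_space \<Rightarrow> 'e) \<Rightarrow> 'e \<Rightarrow> 'e \<Rightarrow> 'e \<Rightarrow> real"
  where "pullback_form G F z a b = G (F z) (fd F z a) (fd F z b)"

text \<open>Injectivity of the derivative makes F a local diffeomorphism, as both dimensions agree.
  The instances are transition maps, the quadratic coordinates at a point, and the maps they induce
  on frames.\<close>

locale metric_pullback = local_metric S G for S :: "'e::euclidean_space set" and G +
  fixes T :: "'e set" and F :: "'e \<Rightarrow> 'e"
  assumes open_T: "open T" and smooth_F: "smooth_on T F" and F_into: "z \<in> T \<Longrightarrow> F z \<in> S"
    and inj_dF: "z \<in> T \<Longrightarrow> inj (fd F z)"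
begin

abbreviation "dF \<equiv> fd F"
definition d2F :: "'e \<Rightarrow> 'e \<Rightarrow> 'e \<Rightarrow> 'e" where "d2F z a b = fd (\<lambda>z. fd F z b) z a"

lemma linear_dF: "z \<in> T \<Longrightarrow> linear (dF z)"
  by (rule smooth_on_linear_fd[OF smooth_F])

lemma smooth_dF: "smooth_on T (\<lambda>z. dF z a)"
  by (rule smooth_on_fd[OF smooth_F])

lemma smooth_d2F: "smooth_on T (\<lambda>z. d2F z a b)"
  unfolding d2F_def by (rule smooth_on_fd[OF smooth_dF])

lemma d2F_sym: "z \<in> T \<Longrightarrow> d2F z a b = d2F z b a"
  unfolding d2F_def by (rule smooth_on_fd_fd_commute[OF open_T smooth_F])

lemma linear_d2F: "z \<in> T \<Longrightarrow> linear (\<lambda>a. d2F z a b)"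
  unfolding d2F_def by (rule smooth_on_linear_fd[OF smooth_dF])

lemma linear_d2F_right: "z \<in> T \<Longrightarrow> linear (d2F z a)"
  using linear_d2F[of z a] d2F_sym[of z] by (simp add: linear_iff)

lemmas F_lin = linear_add[OF linear_dF] linear_cmul[OF linear_dF] linear_diff[OF linear_dF]
  linear_add[OF linear_d2F] linear_cmul[OF linear_d2F]
  linear_add[OF linear_d2F_right] linear_cmul[OF linear_d2F_right]

lemma smooth_comp_F: "smooth_on S f \<Longrightarrow> smooth_on T (\<lambda>z. f (F z))"
  by (rule smooth_on_compose[OF open_T open_S smooth_F]) (use F_into in auto)

lemma fd_comp_F:
  assumes "z \<in> T" "smooth_on S f"
  shows "fd (\<lambda>z. f (F z)) z v = fd f (F z) (dF z v)"
  by (rule fd_compose[OF assms(2) smooth_on_differentiable[OF smooth_F assms(1)] F_into[OF assms(1)]])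

lemma fd_bilinear_comp_F:
  fixes B :: "'e \<Rightarrow> 'e \<Rightarrow> 'e \<Rightarrow> 'd::real_normed_vector"
  assumes z: "z \<in> T" and B: "\<And>y. y \<in> S \<Longrightarrow> bilinear (B y)" "\<And>a b. smooth_on S (\<lambda>y. B y a b)"
  shows "((\<lambda>z. B (F z) (dF z a) (dF z b)) has_derivative (\<lambda>w. fd (\<lambda>y. B y (dF z a) (dF z b)) (F z) (dF z w)
      + B (F z) (d2F z w a) (dF z b) + B (F z) (dF z a) (d2F z w b))) (at z)"
proof -
  have "((\<lambda>z. B (F z) (dF z a) (dF z b)) has_derivative (\<lambda>w. fd (\<lambda>y. B (F y) (dF z a) (dF z b)) z w
      + B (F z) (fd (\<lambda>z. dF z a) z w) (dF z b) + B (F z) (dF z a) (fd (\<lambda>z. dF z b) z w))) (at z)"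
    by (rule has_derivative_bilinear_family[where B = "\<lambda>z. B (F z)" and S = T, OF open_T z B(1)[OF F_into]
        smooth_comp_F[OF B(2)] smooth_dF smooth_on_has_derivative[OF smooth_dF z]])
  then show ?thesis by (simp add: d2F_def fd_comp_F[OF z B(2)])
qed

lemma pull_metric: "local_metric T (pullback_form G F)"
proof
  show "open T" by (rule open_T)
  show "bilinear (pullback_form G F z)" if "z \<in> T" for z
    by (rule bilinearI) (simp_all add: pullback_form_def F_lin that G_simps F_into)
  show "pullback_form G F z a b = pullback_form G F z b a" if "z \<in> T" for z a b
    unfolding pullback_form_def by (rule sym[OF F_into[OF that]])
  show "pullback_form G F z a a > 0" if "z \<in> T" "a \<noteq> 0" for z a
  proof -
    have "dF z a \<noteq> 0"
      using inj_dF[OF that(1)] that(2) linear_0[OF linear_dF[OF that(1)]] by (metis injD)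
    then show ?thesis unfolding pullback_form_def by (rule pos[OF F_into[OF that(1)]])
  qed
  show "smooth_on T (\<lambda>z. pullback_form G F z a b)" for a b
    unfolding pullback_form_def
    by (rule smooth_on_bilinear_family[where B = "\<lambda>z. G (F z)", OF open_T bil[OF F_into] smooth_comp_F[OF smooth]
        smooth_dF smooth_dF])
qed

text \<open>The inhomogeneous transformation law. Solving it for the symbol of the pullback gives a
  candidate that is symmetric because second derivatives commute, and metric by the chain rule;
  uniqueness of the symbols does the rest.\<close>

lemma lc_pull:
  assumes z: "z \<in> T"
  shows "dF z (local_christoffel (pullback_form G F) z a b) = d2F z a b + local_christoffel G (F z) (dF z a) (dF z b)"
proof -
  obtain M where M: "linear M" "\<And>w. M (dF z w) = w" "\<And>w. dF z (M w) = w"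
    using linear_injective_isomorphism[OF linear_dF[OF z] inj_dF[OF z]] by auto
  note Fz = F_into[OF z]
  define C where "C a b = M (d2F z a b + local_christoffel G (F z) (dF z a) (dF z b))" for a b
  have FC: "dF z (C a b) = d2F z a b + local_christoffel G (F z) (dF z a) (dF z b)" for a b
    by (simp add: C_def M)
  have "local_christoffel (pullback_form G F) z = C"
  proof (rule local_metric.lc_eqI[OF pull_metric z])
    show "bilinear C"
      by (rule bilinearI) (simp_all add: C_def linear_add[OF M(1)] linear_cmul[OF M(1)]
          lc_simps Fz F_lin z scaleR_add_right)
    show "C a b = C b a" for a b
      unfolding C_def by (simp add: d2F_sym[OF z, of a b] lc_sym[OF Fz, of "dF z a" "dF z b"])
    show "fd (\<lambda>z. pullback_form G F z a b) z w = pullback_form G F z (C w a) b + pullback_form G F z a (C w b)" for w a b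
      using fd_unique[OF fd_bilinear_comp_F[OF z bil smooth, of a b]]
      unfolding pullback_form_def by (simp add: FC lc_metric[OF Fz] G_simps Fz)
  qed
  then show ?thesis by (simp add: FC)
qed

text \<open>Differentiating the transformation law produces third derivatives of F, which are
  symmetric in a and b and drop out on antisymmetrising; the second derivatives cancel against those
  coming from the quadratic Christoffel terms.\<close>

lemma riem_pull:
  assumes z: "z \<in> T"
  shows "dF z (local_curvature (pullback_form G F) z a b c) = local_curvature G (F z) (dF z a) (dF z b) (dF z c)"
proof -
  interpret P: local_metric T "pullback_form G F" by (rule pull_metric)
  note Fz = F_into[OF z]
  let ?L = "local_christoffel (pullback_form G F)"
  have D: "dF z (fd (\<lambda>z. ?L z b c) z a) = fd (\<lambda>z. d2F z b c) z a + (fd (\<lambda>y. local_christoffel G y (dF z b) (dF z c)) (F z) (dF z a)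
      + local_christoffel G (F z) (d2F z a b) (dF z c) + local_christoffel G (F z) (dF z b) (d2F z a c)) - d2F z a (?L z b c)" for a b c
  proof -
    have "((\<lambda>z. dF z (?L z b c)) has_derivative
        (\<lambda>h. fd (\<lambda>y. dF y (?L z b c)) z h + dF z (fd (\<lambda>z. ?L z b c) z h))) (at z)"
      by (rule has_derivative_linear_family[where L = dF, OF open_T z linear_dF smooth_dF
          smooth_on_has_derivative[OF P.smooth_lc z]])
    then have 1: "fd (\<lambda>z. dF z (?L z b c)) z a = d2F z a (?L z b c) + dF z (fd (\<lambda>z. ?L z b c) z a)"
      unfolding d2F_def by (rule fun_cong[OF fd_unique])
    have 2: "fd (\<lambda>z. dF z (?L z b c)) z = fd (\<lambda>z. d2F z b c + local_christoffel G (F z) (dF z b) (dF z c)) z"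
      by (rule fd_cong[OF open_T z lc_pull])
    have 3: "fd (\<lambda>z. d2F z b c + local_christoffel G (F z) (dF z b) (dF z c)) z a = fd (\<lambda>z. d2F z b c) z a + (fd (\<lambda>y. local_christoffel G y (dF z b) (dF z c)) (F z) (dF z a)
      + local_christoffel G (F z) (d2F z a b) (dF z c) + local_christoffel G (F z) (dF z b) (d2F z a c))"
      by (rule fun_cong[OF fd_unique[OF has_derivative_add[OF smooth_on_has_derivative[OF smooth_d2F z]
          fd_bilinear_comp_F[OF z bilinear_lc smooth_lc]]]])
    have "d2F z a (?L z b c) + dF z (fd (\<lambda>z. ?L z b c) z a) = fd (\<lambda>z. d2F z b c) z a +
      (fd (\<lambda>y. local_christoffel G y (dF z b) (dF z c)) (F z) (dF z a)
      + local_christoffel G (F z) (d2F z a b) (dF z c) + local_christoffel G (F z) (dF z b) (d2F z a c))"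
      using 1 unfolding 2 3 by (rule HOL.sym)
    from arg_cong[OF this, of "\<lambda>v. v - d2F z a (?L z b c)"] show ?thesis
      by (simp only: add_diff_cancel_left')
  qed
  have L: "dF z (?L z a (?L z b c)) = d2F z a (?L z b c) + local_christoffel G (F z) (dF z a) (d2F z b c)
      + local_christoffel G (F z) (dF z a) (local_christoffel G (F z) (dF z b) (dF z c))" for a b c
    by (simp add: lc_pull[OF z] lc_simps Fz)
  have S: "fd (\<lambda>z. d2F z b c) z a = fd (\<lambda>z. d2F z a c) z b"
    unfolding d2F_def by (rule smooth_on_fd_fd_commute[OF open_T smooth_dF z])
  have "dF z (local_curvature (pullback_form G F) z a b c) = dF z (fd (\<lambda>z. ?L z b c) z a) - dF z (fd (\<lambda>z. ?L z a c) z b)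
      + dF z (?L z a (?L z b c)) - dF z (?L z b (?L z a c))"
    unfolding local_curvature_def by (simp only: F_lin z)
  also have "\<dots> = local_curvature G (F z) (dF z a) (dF z b) (dF z c)"
    unfolding D L S d2F_sym[OF z, of b a] local_curvature_def by simp
  finally show ?thesis .
qed

end

section \<open>The frame metric in coordinates\<close>

definition fibre_form :: "(real^'n \<Rightarrow> real^'n \<Rightarrow> real^'n \<Rightarrow> real) \<Rightarrow> (real \<Rightarrow> real) \<Rightarrow> (real \<Rightarrow> real) \<Rightarrow>
    real^'n \<Rightarrow> real^'n \<Rightarrow> real^'n \<Rightarrow> real^'n \<Rightarrow> real"
  where "fibre_form g \<alpha> \<beta> y m p q = \<alpha> (g y m m) * g y p q + \<beta> (g y m m) * g y p m * g y q m"

text \<open>A tangent vector \<open>V = (a, b)\<close> at \<open>r = (y, m)\<close> has the vertical components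
  \<open>b\<^sub>i + \<Gamma>(a, m\<^sub>i)\<close>; they vanish exactly on horizontal lifts.\<close>

definition vertical_part :: "(real^'n \<Rightarrow> real^'n \<Rightarrow> real^'n \<Rightarrow> real) \<Rightarrow> (real^'n) \<times> (real^'n^'n) \<Rightarrow>
    (real^'n) \<times> (real^'n^'n) \<Rightarrow> 'n::finite \<Rightarrow> real^'n"
  where "vertical_part g r V i = snd V $ i + local_christoffel g (fst r) (fst V) (snd r $ i)"

text \<open>The prescription on lifts read in coordinates: base velocities are orthogonal to fibre
  components, and so are fibre components of different index.\<close>

definition frame_form :: "(real^'n \<Rightarrow> real^'n \<Rightarrow> real^'n \<Rightarrow> real) \<Rightarrow> (real \<Rightarrow> real) \<Rightarrow> (real \<Rightarrow> real) \<Rightarrow>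
    (real^'n) \<times> (real^'n^'n::finite) \<Rightarrow> (real^'n) \<times> (real^'n^'n) \<Rightarrow> (real^'n) \<times> (real^'n^'n) \<Rightarrow> real"
  where "frame_form g \<alpha> \<beta> r V W = g (fst r) (fst V) (fst W) +
     (\<Sum>i\<in>UNIV. fibre_form g \<alpha> \<beta> (fst r) (snd r $ i) (vertical_part g r V i) (vertical_part g r W i))"

text \<open>The derivative of \<open>fibre_form\<close> when its base vector moves with velocity \<open>t\<close>, and the second such
  derivative.\<close>

definition fibre_form_deriv :: "(real^'n \<Rightarrow> real^'n \<Rightarrow> real^'n \<Rightarrow> real) \<Rightarrow> (real \<Rightarrow> real) \<Rightarrow> (real \<Rightarrow> real) \<Rightarrow>
    real^'n \<Rightarrow> real^'n \<Rightarrow> real^'n \<Rightarrow> real^'n \<Rightarrow> real^'n \<Rightarrow> real"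
  where "fibre_form_deriv g \<alpha> \<beta> y m t p q =
    2 * deriv \<alpha> (g y m m) * g y t m * g y p q + 2 * deriv \<beta> (g y m m) * g y t m * g y p m * g y q m
    + \<beta> (g y m m) * (g y p t * g y q m + g y p m * g y q t)"

definition fibre_form_deriv2 :: "(real^'n \<Rightarrow> real^'n \<Rightarrow> real^'n \<Rightarrow> real) \<Rightarrow> (real \<Rightarrow> real) \<Rightarrow> (real \<Rightarrow> real) \<Rightarrow>
    real^'n \<Rightarrow> real^'n \<Rightarrow> real^'n \<Rightarrow> real^'n \<Rightarrow> real^'n \<Rightarrow> real^'n \<Rightarrow> real"
  where "fibre_form_deriv2 g \<alpha> \<beta> y m k t p q =
    4 * deriv (deriv \<alpha>) (g y m m) * g y k m * g y t m * g y p q + 2 * deriv \<alpha> (g y m m) * g y t k * g y p q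
    + 4 * deriv (deriv \<beta>) (g y m m) * g y k m * g y t m * g y p m * g y q m
    + 2 * deriv \<beta> (g y m m) * (g y t k * g y p m * g y q m + g y t m * g y p k * g y q m + g y t m * g y p m * g y q k)
    + 2 * deriv \<beta> (g y m m) * g y k m * (g y p t * g y q m + g y p m * g y q t)
    + \<beta> (g y m m) * (g y p t * g y q k + g y p k * g y q t)"

lemma smooth_on_deriv:
  assumes "open T" "smooth_on T (\<phi> :: real \<Rightarrow> real)"
  shows "smooth_on T (deriv \<phi>)"
    and "t \<in> T \<Longrightarrow> (\<phi> has_real_derivative deriv \<phi> t) (at t)"
proof -
  show D: "(\<phi> has_real_derivative deriv \<phi> t) (at t)" if "t \<in> T" for t
    using smooth_on_differentiable[OF assms(2) that] by (simp add: DERIV_deriv_iff_real_differentiable)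
  show "smooth_on T (deriv \<phi>)"
  proof (rule smooth_on_transform[OF smooth_on_fd[OF assms(2), of 1] assms(1)])
    show "deriv \<phi> t = fd \<phi> t 1" if "t \<in> T" for t
      using fd_unique[OF D[OF that, unfolded has_field_derivative_def]] by simp
  qed
qed

lemma sum_single:
  fixes f :: "'n::finite \<Rightarrow> 'a::comm_monoid_add"
  assumes "\<And>j. j \<noteq> i \<Longrightarrow> f j = 0"
  shows "(\<Sum>j\<in>UNIV. f j) = f i"
  using sum.mono_neutral_right[of UNIV "{i}" f] assms by simp

section \<open>The frame metric over an open set\<close>

locale frame_local = local_metric S g for S :: "(real^'n::finite) set" and g +
  fixes \<alpha> \<beta> :: "real \<Rightarrow> real"
  assumes smooth_\<alpha>: "smooth_on {0<..} \<alpha>" and smooth_\<beta>: "smooth_on {0<..} \<beta>"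
    and \<alpha>_pos: "t > 0 \<Longrightarrow> \<alpha> t > 0" and \<alpha>\<beta>_pos: "t > 0 \<Longrightarrow> \<alpha> t + t * \<beta> t > 0"
begin

text \<open>Rows need only be nonzero, not a basis: this keeps |m_i|^2 positive and the frame metric
  definite, and the image of every frame chart lies inside.\<close>

definition "Q = S \<times> {m :: real^'n^'n. \<forall>i. m $ i \<noteq> 0}"

abbreviation "H \<equiv> fibre_form g \<alpha> \<beta>"
abbreviation "H1 \<equiv> fibre_form_deriv g \<alpha> \<beta>"
abbreviation "H2 \<equiv> fibre_form_deriv2 g \<alpha> \<beta>"
abbreviation "K \<equiv> vertical_part g"
abbreviation "B \<equiv> frame_form g \<alpha> \<beta>"

text \<open>The covariant derivative of a section of the tangent bundle pulled back to the frame
  coordinates along the projection \<open>fst\<close>.\<close>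

definition cov :: "((real^'n) \<times> (real^'n^'n) \<Rightarrow> real^'n) \<Rightarrow> (real^'n) \<times> (real^'n^'n) \<Rightarrow> (real^'n) \<times> (real^'n^'n) \<Rightarrow> real^'n"
  where "cov P r U = fd P r U + \<Gamma> (fst r) (fst U) (P r)"

lemma open_Q: "open Q"
proof -
  have "{m :: real^'n^'n. \<forall>i. m $ i \<noteq> 0} = (\<Inter>i\<in>UNIV. {m. m $ i \<noteq> 0})" by auto
  moreover have "open (\<Inter>i\<in>UNIV. {m :: real^'n^'n. m $ i \<noteq> 0})"
    by (intro open_INT finite_UNIV ballI open_Collect_neq continuous_intros) simp
  ultimately show ?thesis unfolding Q_def using open_S by (simp add: open_Times)
qed

lemma Q_D: "r \<in> Q \<Longrightarrow> fst r \<in> S" "r \<in> Q \<Longrightarrow> snd r $ i \<noteq> 0"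
  by (auto simp: Q_def)

lemma norm_pos: "r \<in> Q \<Longrightarrow> g (fst r) (snd r $ i) (snd r $ i) > 0"
  by (intro pos Q_D)

lemma smooth_base: "smooth_on S f \<Longrightarrow> smooth_on Q (\<lambda>r. f (fst r))"
  by (rule smooth_on_compose[OF open_Q open_S smooth_on_fst]) (auto simp: Q_def)

lemma fd_base:
  assumes "smooth_on S f" "r \<in> Q"
  shows "fd (\<lambda>r. f (fst r)) r U = fd f (fst r) (fst U)"
proof -
  have "fd fst r = (fst :: (real^'n) \<times> (real^'n^'n) \<Rightarrow> _)"
    by (intro fd_unique bounded_linear_imp_has_derivative bounded_linear_fst)
  moreover have "(fst :: (real^'n) \<times> (real^'n^'n) \<Rightarrow> _) differentiable (at r)"
    by (intro bounded_linear_imp_differentiable bounded_linear_fst)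
  ultimately show ?thesis using fd_compose[where h = fst and x = r, OF assms(1) _ Q_D(1)[OF assms(2)]] by simp
qed

lemma smooth_frame_vector: "smooth_on Q (\<lambda>r. snd r $ i)"
  by (intro smooth_on_vec_nth open_Q smooth_on_snd)

lemma smooth_lc_Q: "smooth_on Q P \<Longrightarrow> smooth_on Q (\<lambda>r. \<Gamma> (fst r) c (P r))"
  by (rule smooth_on_bilinear_family[where B = "\<lambda>r. \<Gamma> (fst r)", OF open_Q bilinear_lc[OF Q_D(1)]
        smooth_base[OF smooth_lc] smooth_on_const])

lemma smooth_g_Q: "smooth_on Q P \<Longrightarrow> smooth_on Q P' \<Longrightarrow> smooth_on Q (\<lambda>r. g (fst r) (P r) (P' r))"
  by (rule smooth_on_bilinear_family[where B = "\<lambda>r. g (fst r)", OF open_Q bil[OF Q_D(1)]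
        smooth_base[OF smooth]])

lemma smooth_norm_Q:
  assumes "smooth_on {0<..} \<phi>"
  shows "smooth_on Q (\<lambda>r. \<phi> (g (fst r) (snd r $ i) (snd r $ i)))"
  by (rule smooth_on_compose[OF open_Q open_greaterThan smooth_g_Q[OF smooth_frame_vector smooth_frame_vector] assms])
    (use norm_pos in auto)

lemma smooth_cov: "smooth_on Q P \<Longrightarrow> smooth_on Q (\<lambda>r. cov P r U)"
  unfolding cov_def by (intro smooth_on_add open_Q smooth_on_fd smooth_lc_Q)

lemma smooth_K: "smooth_on Q (\<lambda>r. K r V i)"
  unfolding vertical_part_def by (intro smooth_on_add open_Q smooth_on_const smooth_lc_Q smooth_frame_vector)

lemma smooth_H: "smooth_on Q P \<Longrightarrow> smooth_on Q P' \<Longrightarrow> smooth_on Q (\<lambda>r. H (fst r) (snd r $ i) (P r) (P' r))"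
  unfolding fibre_form_def
  by (intro smooth_on_add smooth_on_mult open_Q smooth_g_Q smooth_norm_Q smooth_frame_vector smooth_\<alpha> smooth_\<beta>)

lemma smooth_B: "smooth_on Q (\<lambda>r. B r V W)"
  unfolding frame_form_def by (intro smooth_on_add smooth_on_sum open_Q smooth_base smooth smooth_H smooth_K)

lemma bilinear_H: "y \<in> S \<Longrightarrow> bilinear (H y m)"
  by (rule bilinearI) (simp_all add: fibre_form_def G_simps algebra_simps)

lemmas H_simps = bilinear_ladd[OF bilinear_H] bilinear_radd[OF bilinear_H] bilinear_lmul[OF bilinear_H]
  bilinear_rmul[OF bilinear_H] bilinear_lzero[OF bilinear_H] bilinear_rzero[OF bilinear_H]
  bilinear_lsub[OF bilinear_H] bilinear_rsub[OF bilinear_H]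

lemma H_sym: "y \<in> S \<Longrightarrow> H y m p q = H y m q p"
  by (simp add: fibre_form_def sym[of y p q])

lemma Cauchy_Schwarz: "y \<in> S \<Longrightarrow> (g y p m)\<^sup>2 \<le> g y p p * g y m m"
proof (cases "m = 0")
  case True
  then show "y \<in> S \<Longrightarrow> ?thesis" by (simp add: G_simps)
next
  case False
  assume y: "y \<in> S"
  then have m: "g y m m > 0" using pos False by blast
  \<comment> \<open>This vector is the component of p orthogonal to m, scaled by g(m,m) to avoid a
    division.\<close>
  have "0 \<le> g y (g y m m *\<^sub>R p - g y p m *\<^sub>R m) (g y m m *\<^sub>R p - g y p m *\<^sub>R m)"
    using pos[OF y] by (metis G_simps(9) order.strict_iff_not y order_le_less)
  also have "\<dots> = g y m m * (g y p p * g y m m - (g y p m)\<^sup>2)"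
    by (simp add: G_simps y sym[OF y, of m p] power2_eq_square algebra_simps)
  finally show ?thesis using m by (simp add: zero_le_mult_iff)
qed

text \<open>Only a negative \<beta> needs an argument: Cauchy-Schwarz then bounds the form below by
  (\<alpha> + t \<beta>) g(p,p), with t = g(m,m).\<close>

lemma H_pos:
  assumes y: "y \<in> S" and m: "m \<noteq> 0" and p: "p \<noteq> 0"
  shows "H y m p p > 0"
proof -
  let ?t = "g y m m"
  have t: "?t > 0" and pp: "g y p p > 0" using pos y m p by auto
  have CS: "(g y p m)\<^sup>2 \<le> g y p p * ?t" by (rule Cauchy_Schwarz[OF y])
  have "H y m p p = \<alpha> ?t * g y p p + \<beta> ?t * (g y p m)\<^sup>2"
    by (simp add: fibre_form_def power2_eq_square)
  also have "\<dots> > 0"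
  proof (cases "\<beta> ?t \<ge> 0")
    case True
    then show ?thesis using \<alpha>_pos[OF t] pp by (simp add: add_pos_nonneg)
  next
    case False
    then have "\<beta> ?t * (g y p m)\<^sup>2 \<ge> \<beta> ?t * (g y p p * ?t)"
      using CS by (intro mult_left_mono_neg) auto
    moreover have "(\<alpha> ?t + ?t * \<beta> ?t) * g y p p > 0" using \<alpha>\<beta>_pos[OF t] pp by simp
    ultimately show ?thesis by (simp add: algebra_simps)
  qed
  finally show ?thesis .
qed

lemma K_add: "r \<in> Q \<Longrightarrow> K r (V + W) i = K r V i + K r W i"
  by (simp add: vertical_part_def lc_simps Q_D)

lemma K_scale: "r \<in> Q \<Longrightarrow> K r (s *\<^sub>R V) i = s *\<^sub>R K r V i"
  by (simp add: vertical_part_def lc_simps Q_D scaleR_add_right)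

lemma frame_metric_local: "local_metric Q B"
proof
  show "open Q" by (rule open_Q)
  show "bilinear (B r)" if "r \<in> Q" for r
    by (rule bilinearI)
      (simp_all add: frame_form_def K_add K_scale that G_simps H_simps Q_D sum.distrib sum_distrib_left distrib_left)
  show "B r V W = B r W V" if "r \<in> Q" for r V W
    unfolding frame_form_def sym[OF Q_D(1)[OF that], of "fst V"] H_sym[OF Q_D(1)[OF that], of _ "K r V _"] ..
  show "B r V V > 0" if r: "r \<in> Q" and V: "V \<noteq> 0" for r V
  proof -
    have nn: "H (fst r) (snd r $ i) p p \<ge> 0" for i p
      using H_pos[OF Q_D(1)[OF r] Q_D(2)[OF r], of p i] by (cases "p = 0") (auto simp: H_simps Q_D(1)[OF r])
    show ?thesis
    proof (cases "fst V = 0")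
      case False
      then show ?thesis
        unfolding frame_form_def by (intro add_pos_nonneg sum_nonneg nn pos Q_D(1)[OF r])
    next
      case True
      then have "snd V \<noteq> 0" using V by (simp add: prod_eq_iff)
      then obtain i where i: "snd V $ i \<noteq> 0" by (auto simp: vec_eq_iff)
      have "H (fst r) (snd r $ i) (K r V i) (K r V i) > 0"
        by (rule H_pos[OF Q_D(1)[OF r] Q_D(2)[OF r]]) (simp add: vertical_part_def True lc_simps Q_D(1)[OF r] i)
      then have "(\<Sum>i\<in>UNIV. H (fst r) (snd r $ i) (K r V i) (K r V i)) > 0"
        by (intro sum_pos2[of _ i] nn) auto
      then show ?thesis by (simp add: frame_form_def True G_simps Q_D(1)[OF r])
    qed
  qed
  show "smooth_on Q (\<lambda>r. B r V W)" for V W by (rule smooth_B)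
qed

text \<open>Metric compatibility along the projection: derivatives of the coefficients of g
  disappear into \<open>cov\<close>, so later computations never display them.\<close>

lemma has_derivative_g:
  assumes r: "r \<in> Q" and P: "smooth_on Q P" "smooth_on Q P'"
  shows "((\<lambda>r. g (fst r) (P r) (P' r)) has_derivative
    (\<lambda>U. g (fst r) (cov P r U) (P' r) + g (fst r) (P r) (cov P' r U))) (at r)"
proof -
  have "((\<lambda>r. g (fst r) (P r) (P' r)) has_derivative
    (\<lambda>U. fd (\<lambda>s. g (fst s) (P r) (P' r)) r U + g (fst r) (fd P r U) (P' r) + g (fst r) (P r) (fd P' r U))) (at r)"
    by (rule has_derivative_bilinear_family[where B = "\<lambda>r. g (fst r)" and S = Q, OF open_Q r bil[OF Q_D(1)]
        smooth_base[OF smooth] P(1) smooth_on_has_derivative[OF P(2) r]])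
  then show ?thesis
    by (simp add: fd_base[OF smooth r] lc_metric Q_D(1)[OF r] cov_def G_simps ac_simps)
qed

lemma cov_frame_vector: "r \<in> Q \<Longrightarrow> cov (\<lambda>r. snd r $ i) r U = K r U i"
proof -
  have "((\<lambda>r. snd r $ i) has_derivative (\<lambda>U. snd U $ i)) (at r)"
    by (intro bounded_linear.has_derivative[OF bounded_linear_vec_nth] bounded_linear_imp_has_derivative bounded_linear_snd)
  then show ?thesis by (simp add: cov_def vertical_part_def fd_unique)
qed

lemma has_derivative_norm:
  assumes r: "r \<in> Q" and \<phi>: "smooth_on {0<..} \<phi>"
  shows "((\<lambda>r. \<phi> (g (fst r) (snd r $ i) (snd r $ i))) has_derivative
    (\<lambda>U. deriv \<phi> (g (fst r) (snd r $ i) (snd r $ i)) * (2 * g (fst r) (K r U i) (snd r $ i)))) (at r)"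
proof -
  let ?N = "\<lambda>r. g (fst r) (snd r $ i) (snd r $ i)"
  have "(\<phi> has_derivative (*) (deriv \<phi> (?N r))) (at (?N r))"
    using smooth_on_deriv(2)[OF open_greaterThan \<phi>, of "?N r"] norm_pos[OF r]
    by (simp add: has_field_derivative_def)
  from has_derivative_compose[OF has_derivative_g[OF r smooth_frame_vector smooth_frame_vector, of i i] this]
  show ?thesis
    by (simp add: cov_frame_vector[OF r] sym[OF Q_D(1)[OF r], of "snd r $ i" "K r _ i"])
qed

text \<open>The fibre form involves the base point only through g, which is parallel. Apart from the
  covariant derivatives of its arguments, the only contribution is that of the moving frame vector,
  whose covariant velocity is \<open>K r U i\<close>.\<close>

lemma fd_H:
  assumes r: "r \<in> Q" and P: "smooth_on Q P" "smooth_on Q P'"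
  shows "fd (\<lambda>r. H (fst r) (snd r $ i) (P r) (P' r)) r U =
    H (fst r) (snd r $ i) (cov P r U) (P' r) + H (fst r) (snd r $ i) (P r) (cov P' r U)
    + H1 (fst r) (snd r $ i) (K r U i) (P r) (P' r)"
proof -
  note y = Q_D(1)[OF r]
  note D = has_derivative_g[OF r]
  note D1 = D[OF P] and D2 = D[OF P(1) smooth_frame_vector[of i]] and D3 = D[OF P(2) smooth_frame_vector[of i]]
  note A = has_derivative_norm[OF r smooth_\<alpha>, of i] and Bt = has_derivative_norm[OF r smooth_\<beta>, of i]
  show ?thesis
    unfolding fibre_form_def
    by (subst fd_unique[OF has_derivative_add[OF has_derivative_mult[OF A D1]
        has_derivative_mult[OF has_derivative_mult[OF Bt D2] D3]]])
      (simp add: fibre_form_deriv_def cov_frame_vector[OF r] G_simps y algebra_simps)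
qed

lemma fd_H1:
  assumes r: "r \<in> Q" and P: "smooth_on Q T" "smooth_on Q P" "smooth_on Q P'"
  shows "fd (\<lambda>r. H1 (fst r) (snd r $ i) (T r) (P r) (P' r)) r U =
    H1 (fst r) (snd r $ i) (cov T r U) (P r) (P' r) + H1 (fst r) (snd r $ i) (T r) (cov P r U) (P' r)
    + H1 (fst r) (snd r $ i) (T r) (P r) (cov P' r U)
    + H2 (fst r) (snd r $ i) (K r U i) (T r) (P r) (P' r)"
proof -
  note y = Q_D(1)[OF r]
  note D = has_derivative_g[OF r]
  let ?N = "\<lambda>r. g (fst r) (snd r $ i) (snd r $ i)"
  note A = has_derivative_norm[OF r smooth_on_deriv(1)[OF open_greaterThan smooth_\<alpha>], of i]
    and B' = has_derivative_norm[OF r smooth_on_deriv(1)[OF open_greaterThan smooth_\<beta>], of i]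
    and Bt = has_derivative_norm[OF r smooth_\<beta>, of i]
  note Tm = D[OF P(1) smooth_frame_vector[of i]] and Pm = D[OF P(2) smooth_frame_vector[of i]]
    and Qm = D[OF P(3) smooth_frame_vector[of i]]
  show ?thesis
    unfolding fibre_form_deriv_def
    by (subst fd_unique[OF has_derivative_add[OF has_derivative_add[OF
      has_derivative_mult[OF has_derivative_mult[OF has_derivative_mult_right[OF A] Tm] D[OF P(2,3)]]
      has_derivative_mult[OF has_derivative_mult[OF has_derivative_mult[OF has_derivative_mult_right[OF B'] Tm] Pm] Qm]]
      has_derivative_mult[OF Bt has_derivative_add[OF has_derivative_mult[OF D[OF P(2,1)] Qm]
        has_derivative_mult[OF Pm D[OF P(3,1)]]]]]])
      (simp add: fibre_form_deriv2_def cov_frame_vector[OF r] G_simps y algebra_simps)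
qed

end

section \<open>First and second derivatives of the frame metric\<close>

context frame_local
begin

lemma has_derivative_K:
  assumes r: "r \<in> Q"
  shows "((\<lambda>r. K r V i) has_derivative (\<lambda>U. fd (\<lambda>y. \<Gamma> y (fst V) (snd r $ i)) (fst r) (fst U)
      + \<Gamma> (fst r) (fst V) (snd U $ i))) (at r)"
proof -
  have *: "((\<lambda>r. snd r $ i) has_derivative (\<lambda>U. snd U $ i)) (at r)"
    by (intro bounded_linear.has_derivative[OF bounded_linear_vec_nth] bounded_linear_imp_has_derivative bounded_linear_snd)
  have l: "linear (\<Gamma> (fst r) (fst V))" if "r \<in> Q" for r
    using bilinear_lc[OF Q_D(1)[OF that]] by (simp add: bilinear_def)
  have "((\<lambda>r. \<Gamma> (fst r) (fst V) (snd r $ i)) has_derivative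
     (\<lambda>U. fd (\<lambda>s. \<Gamma> (fst s) (fst V) (snd r $ i)) r U + \<Gamma> (fst r) (fst V) (snd U $ i))) (at r)"
    by (rule has_derivative_linear_family[where L = "\<lambda>r. \<Gamma> (fst r) (fst V)" and p = "\<lambda>r. snd r $ i" and S = Q,
        OF open_Q r l smooth_base[OF smooth_lc] *])
  from has_derivative_add[OF has_derivative_const[of "snd V $ i"] this] show ?thesis
    unfolding vertical_part_def by (simp add: fd_base[OF smooth_lc r])
qed

lemma cov_K:
  "r \<in> Q \<Longrightarrow> cov (\<lambda>r. K r V i) r U = fd (\<lambda>y. \<Gamma> y (fst V) (snd r $ i)) (fst r) (fst U)
      + \<Gamma> (fst r) (fst V) (snd U $ i) + \<Gamma> (fst r) (fst U) (K r V i)"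
  by (simp add: cov_def fd_unique[OF has_derivative_K])

lemma fd_B:
  assumes r: "r \<in> Q"
  shows "fd (\<lambda>r. B r V W) r U = fd (\<lambda>y. g y (fst V) (fst W)) (fst r) (fst U) +
    (\<Sum>i\<in>UNIV. H (fst r) (snd r $ i) (cov (\<lambda>r. K r V i) r U) (K r W i)
        + H (fst r) (snd r $ i) (K r V i) (cov (\<lambda>r. K r W i) r U)
        + H1 (fst r) (snd r $ i) (K r U i) (K r V i) (K r W i))"
proof -
  show ?thesis unfolding frame_form_def
    by (subst fd_unique[OF has_derivative_add[OF smooth_on_has_derivative[OF smooth_base[OF smooth] r]
      has_derivative_sum[OF smooth_on_has_derivative[OF smooth_H[OF smooth_K smooth_K] r]]]])
     (simp add: fd_base[OF smooth r] fd_H[OF r smooth_K smooth_K])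
qed

lemma smooth_H1:
  "smooth_on Q T \<Longrightarrow> smooth_on Q P \<Longrightarrow> smooth_on Q P' \<Longrightarrow> smooth_on Q (\<lambda>r. H1 (fst r) (snd r $ i) (T r) (P r) (P' r))"
  unfolding fibre_form_deriv_def
  by (intro smooth_on_add smooth_on_mult open_Q smooth_g_Q smooth_norm_Q smooth_frame_vector smooth_\<beta>
      smooth_on_const smooth_on_deriv(1)[OF open_greaterThan] smooth_\<alpha>)

text \<open>Two applications of the product rule. The factors \<open>D2\<close> are the only ones
  that can contain second derivatives of Christoffel symbols, and each is paired with an
  undifferentiated vertical component.\<close>

lemma fd_fd_B:
  assumes r: "r \<in> Q"
  shows "fd (\<lambda>r. fd (\<lambda>r. B r V W) r U) r U' =
    fd (\<lambda>y. fd (\<lambda>y. g y (fst V) (fst W)) y (fst U)) (fst r) (fst U') +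
    (\<Sum>i\<in>UNIV. let D = \<lambda>V U. cov (\<lambda>r. K r V i) r U;
        D2 = \<lambda>V. cov (\<lambda>r. cov (\<lambda>r. K r V i) r U) r U';
        h = H (fst r) (snd r $ i); h1 = H1 (fst r) (snd r $ i); h2 = H2 (fst r) (snd r $ i); k = \<lambda>V. K r V i
      in h (D2 V) (k W) + h (D V U) (D W U') + h1 (k U') (D V U) (k W)
       + (h (D V U') (D W U) + h (k V) (D2 W) + h1 (k U') (k V) (D W U))
       + (h1 (D U U') (k V) (k W) + h1 (k U) (D V U') (k W) + h1 (k U) (k V) (D W U') + h2 (k U') (k U) (k V) (k W)))"
proof -
  note cK = smooth_cov[OF smooth_K] and sH = smooth_on_has_derivative[OF smooth_H r]
  have "fd (\<lambda>r. fd (\<lambda>r. B r V W) r U) r =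
    fd (\<lambda>r. fd (\<lambda>y. g y (fst V) (fst W)) (fst r) (fst U) +
    (\<Sum>i\<in>UNIV. H (fst r) (snd r $ i) (cov (\<lambda>r. K r V i) r U) (K r W i)
        + H (fst r) (snd r $ i) (K r V i) (cov (\<lambda>r. K r W i) r U)
        + H1 (fst r) (snd r $ i) (K r U i) (K r V i) (K r W i))) r"
    by (rule fd_cong[OF open_Q r fd_B])
  also have "\<dots> = (\<lambda>U'. fd (\<lambda>r. fd (\<lambda>y. g y (fst V) (fst W)) (fst r) (fst U)) r U' +
    (\<Sum>i\<in>UNIV. fd (\<lambda>r. H (fst r) (snd r $ i) (cov (\<lambda>r. K r V i) r U) (K r W i)) r U'
        + fd (\<lambda>r. H (fst r) (snd r $ i) (K r V i) (cov (\<lambda>r. K r W i) r U)) r U'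
        + fd (\<lambda>r. H1 (fst r) (snd r $ i) (K r U i) (K r V i) (K r W i)) r U'))"
    by (rule fd_unique)
      (intro has_derivative_add has_derivative_sum smooth_on_has_derivative[OF _ r] smooth_base smooth_on_fd smooth
        smooth_H smooth_H1 smooth_cov smooth_K)
  finally have 1: "fd (\<lambda>r. fd (\<lambda>r. B r V W) r U) r = (\<lambda>U'. fd (\<lambda>r. fd (\<lambda>y. g y (fst V) (fst W)) (fst r) (fst U)) r U' +
    (\<Sum>i\<in>UNIV. fd (\<lambda>r. H (fst r) (snd r $ i) (cov (\<lambda>r. K r V i) r U) (K r W i)) r U'
        + fd (\<lambda>r. H (fst r) (snd r $ i) (K r V i) (cov (\<lambda>r. K r W i) r U)) r U'
        + fd (\<lambda>r. H1 (fst r) (snd r $ i) (K r U i) (K r V i) (K r W i)) r U'))" .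
  show ?thesis
    unfolding 1 Let_def fd_base[OF smooth_on_fd[OF smooth] r] fd_H[OF r cK smooth_K] fd_H[OF r smooth_K cK]
      fd_H1[OF r smooth_K smooth_K smooth_K] ..
qed

end

text \<open>The algebra of the vertical case in plain reals. \<open>A\<close>, \<open>A1\<close>,
  \<open>A2\<close> and \<open>Be\<close>, \<open>B1\<close>, \<open>B2\<close> stand for \<alpha>,
  \<beta> and their derivatives at N = |u_i|^2, and x, y for the products of the orthonormal pair
  with u_i. \<mu> and \<nu> are the coefficients of u_i in \<open>V2\<close> for the pairs (X,X) and
  (X,Y). The second derivative of \<beta> cancels; the outer factor \<open>A\<close> is cancelled
  later by the area of the plane.\<close>

lemma vertical_curvature_identity:
  fixes A A1 A2 Be B1 B2 N x y D :: real
  assumes "A \<noteq> 0" "A + N * Be \<noteq> 0" "D = A + N * Be"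
  defines "\<mu> \<equiv> ((B1 - 2 * A1 * Be / A) * x * x + (Be - A1)) / D" and "\<nu> \<equiv> (B1 - 2 * A1 * Be / A) * x * y / D"
  shows "4 * B2 * x * y * x * y + 2 * B1 * (x * x + y * y) + Be
     - (4 * A2 * x * x + 2 * A1 + 4 * B2 * x * x * y * y + 2 * B1 * y * y) / 2
     - (4 * A2 * y * y + 2 * A1 + 4 * B2 * x * x * y * y + 2 * B1 * x * x) / 2
     - (2 * A1 * y * (\<mu> * y) + (B1 * y * y + Be - A1) * (2 * A1 / A * x * x + \<mu> * N))
     + (A1 * (x * (A1 / A * x + \<nu> * y) + y * (A1 / A * y + \<nu> * x)) + B1 * x * y * (2 * A1 / A * x * y + \<nu> * N))
   = A * (((3 * A1\<^sup>2 - 2 * A * A2) / A\<^sup>2 + (A * B1 - 2 * A1 * Be) * (A + N * A1) / (A\<^sup>2 * D)) * (x\<^sup>2 + y\<^sup>2)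
        + (A * Be - 2 * A * A1 - A1\<^sup>2 * N) / (A * D))"
  using assms(1,2) unfolding \<mu>_def \<nu>_def assms(3) power2_eq_square
  by (simp add: divide_simps) (simp add: algebra_simps)

section \<open>Curvature at a frame over a point with vanishing Christoffel symbols\<close>

locale frame_normal = frame_local S g \<alpha> \<beta> for S :: "(real^'n::finite) set" and g \<alpha> \<beta> +
  fixes y0 :: "real^'n" and m :: "real^'n^'n"
  assumes y0: "y0 \<in> S" and m_nz: "m $ i \<noteq> 0" and normal: "\<Gamma> y0 a b = 0"
begin

abbreviation "p \<equiv> (y0, m)"

lemma p_in: "p \<in> Q"
  using y0 m_nz by (simp add: Q_def)

definition d\<Gamma> :: "real^'n \<Rightarrow> real^'n \<Rightarrow> real^'n \<Rightarrow> real^'n"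
  where "d\<Gamma> c a x = fd (\<lambda>y. \<Gamma> y a x) y0 c"

lemma d\<Gamma>_zero [simp]: "d\<Gamma> 0 a x = 0" "d\<Gamma> c 0 x = 0" "d\<Gamma> c a 0 = 0"
  using linear_0[OF linear_dlc[OF y0]] bilinear_lzero[OF bilinear_dlc[OF y0]] bilinear_rzero[OF bilinear_dlc[OF y0]]
  by (auto simp: d\<Gamma>_def)

lemma riem_normal: "R y0 a b c = d\<Gamma> a b c - d\<Gamma> b a c"
  by (simp add: local_curvature_def normal d\<Gamma>_def)

lemma K_p: "K p V i = snd V $ i"
  by (simp add: vertical_part_def normal)

lemma cov_p: "cov P p U = fd P p U"
  by (simp add: cov_def normal)

lemma cov_K_p: "cov (\<lambda>r. K r V i) p U = d\<Gamma> (fst U) (fst V) (m $ i)"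
  by (simp add: cov_K[OF p_in] normal d\<Gamma>_def)

text \<open>If V and U both had a base component, a second derivative of \<Gamma> would occur. With
  one of them vertical, the derivative of \<Gamma> inside the first covariant derivative is taken in
  direction 0 or of a zero argument, and what is left is linear in \<Gamma>.\<close>

lemma cov_cov_K_p:
  assumes "fst V = 0 \<or> fst U = 0"
  shows "cov (\<lambda>r. cov (\<lambda>r. K r V i) r U) p U' =
    d\<Gamma> (fst U') (fst U) (snd V $ i) + d\<Gamma> (fst U') (fst V) (snd U $ i)"
proof -
  have "cov (\<lambda>r. K r V i) r U = \<Gamma> (fst r) (fst U) (snd V $ i) + \<Gamma> (fst r) (fst V) (snd U $ i)" if r: "r \<in> Q" for r
    using assms
  proof
    assume "fst V = 0"
    then show ?thesis using r linear_0[OF linear_dlc] bilinear_lzero[OF bilinear_dlc, of "fst r"]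
      unfolding cov_K[OF r] by (simp add: vertical_part_def lc_simps Q_D)
  next
    assume "fst U = 0"
    then show ?thesis using r linear_0[OF linear_dlc, of "fst r"]
      unfolding cov_K[OF r] by (simp add: lc_simps Q_D)
  qed
  from fd_cong[OF open_Q p_in this]
  have "fd (\<lambda>r. cov (\<lambda>r. K r V i) r U) p = fd (\<lambda>r. \<Gamma> (fst r) (fst U) (snd V $ i) + \<Gamma> (fst r) (fst V) (snd U $ i)) p" .
  also have "\<dots> = (\<lambda>U'. fd (\<lambda>r. \<Gamma> (fst r) (fst U) (snd V $ i)) p U' + fd (\<lambda>r. \<Gamma> (fst r) (fst V) (snd U $ i)) p U')"
    by (rule fd_unique) (intro has_derivative_add smooth_on_has_derivative[OF _ p_in] smooth_base smooth_lc)
  finally show ?thesis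
    by (simp add: cov_p fd_base[OF smooth_lc p_in] d\<Gamma>_def)
qed

abbreviation "h \<equiv> \<lambda>i. H y0 (m $ i)"
abbreviation "h1 \<equiv> \<lambda>i. H1 y0 (m $ i)"
abbreviation "h2 \<equiv> \<lambda>i. H2 y0 (m $ i)"

lemmas h_simps = H_simps[OF y0]
lemmas g_simps = G_simps[OF y0]

lemma h1_zero [simp]: "h1 i 0 a b = 0" "h1 i t 0 b = 0" "h1 i t a 0 = 0"
  by (simp_all add: fibre_form_deriv_def g_simps)

lemma h2_zero [simp]: "h2 i 0 t a b = 0" "h2 i k 0 a b = 0" "h2 i k t 0 b = 0" "h2 i k t a 0 = 0"
  by (simp_all add: fibre_form_deriv2_def g_simps)

lemma h_zero [simp]: "h i 0 b = 0" "h i a 0 = 0"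
  by (simp_all add: h_simps)

lemma B_p: "B p V W = g y0 (fst V) (fst W) + (\<Sum>i\<in>UNIV. h i (snd V $ i) (snd W $ i))"
  by (simp add: frame_form_def K_p)

lemma fd_B_p: "fd (\<lambda>r. B r V W) p U =
    (\<Sum>i\<in>UNIV. h i (d\<Gamma> (fst U) (fst V) (m $ i)) (snd W $ i) + h i (snd V $ i) (d\<Gamma> (fst U) (fst W) (m $ i))
      + h1 i (snd U $ i) (snd V $ i) (snd W $ i))"
  by (simp add: fd_B[OF p_in] cov_K_p K_p lc_metric[OF y0] normal g_simps)

lemma fd_fd_B_p: "fd (\<lambda>r. fd (\<lambda>r. B r V W) r U) p U' =
    fd (\<lambda>y. fd (\<lambda>y. g y (fst V) (fst W)) y (fst U)) y0 (fst U') +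
    (\<Sum>i\<in>UNIV. let D2 = \<lambda>V. cov (\<lambda>r. cov (\<lambda>r. K r V i) r U) p U'; D = \<lambda>V U. d\<Gamma> (fst U) (fst V) (m $ i);
        k = \<lambda>V. snd V $ i
      in h i (D2 V) (k W) + h i (D V U) (D W U') + h1 i (k U') (D V U) (k W)
       + (h i (D V U') (D W U) + h i (k V) (D2 W) + h1 i (k U') (k V) (D W U))
       + (h1 i (D U U') (k V) (k W) + h1 i (k U) (D V U') (k W) + h1 i (k U) (k V) (D W U') + h2 i (k U') (k U) (k V) (k W)))"
  unfolding fd_fd_B[OF p_in] by (simp only: Let_def cov_K_p K_p fst_conv snd_conv)

lemma h_sym: "h i a b = h i b a"
  by (rule H_sym[OF y0])

sublocale FB: local_metric Q B
  by (rule frame_metric_local)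

abbreviation "\<Gamma>' \<equiv> local_christoffel B p"

text \<open>Testing Koszul's formula against every U lets each symbol of the frame metric be
  verified instead of solved for.\<close>

lemma lc_frame_eqI:
  assumes "\<And>U. (fd (\<lambda>r. B r W U) p V + fd (\<lambda>r. B r V U) p W - fd (\<lambda>r. B r V W) p U) / 2 = B p X U"
  shows "\<Gamma>' V W = X"
  by (rule FB.nondeg[OF p_in]) (simp add: FB.lc_koszul[OF p_in] assms)

lemma fd_zero_dir [simp]: "fd f x 0 = 0" if "f differentiable (at x)"
  using linear_0[OF linear_frechet_derivative[OF that]] .

lemma half_double: "(1/2) *\<^sub>R (x + x) = x" for x :: "real^'n"
  by (simp add: scaleR_2[symmetric])

subsection \<open>Horizontal planes\<close>

lemma lc_hh: "\<Gamma>' (a, 0) (c, 0) = (0, \<chi> i. (1/2) *\<^sub>R (d\<Gamma> a c (m $ i) + d\<Gamma> c a (m $ i)))"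
  by (rule lc_frame_eqI)
    (simp add: fd_B_p B_p g_simps h_simps sum.distrib[symmetric] sum_divide_distrib add_divide_distrib)

lemma fd_fd_B_hh: "fd (\<lambda>r. fd (\<lambda>r. B r (a, 0) (b, 0)) r (c, 0)) p (e, 0) = fd (\<lambda>y. fd (\<lambda>y. g y a b) y c) y0 e
    + (\<Sum>i\<in>UNIV. h i (d\<Gamma> c a (m $ i)) (d\<Gamma> e b (m $ i)) + h i (d\<Gamma> e a (m $ i)) (d\<Gamma> c b (m $ i)))"
  unfolding fd_fd_B_p by (simp add: Let_def)

text \<open>In each fibre the terms with \<open>d\<Gamma> c c\<close> and
  \<open>d\<Gamma> a a\<close> cancel. With p = \<open>d\<Gamma> a c x\<close> and q =
  \<open>d\<Gamma> c a x\<close> the rest is h(p,q) - h(p,p) - h(q,q) + h(p+q,p+q)/4 = -3/4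
  h(p-q,p-q), and p - q is R(a,c)x. This is the origin of the factor 3/4.\<close>

lemma riem_hh:
  "B p (local_curvature B p (a, 0) (c, 0) (c, 0)) (a, 0) = g y0 (R y0 a c c) a
     - 3/4 * (\<Sum>i\<in>UNIV. h i (R y0 a c (m $ i)) (R y0 a c (m $ i)))"
proof -
  have base: "g y0 (R y0 a c c) a = fd (\<lambda>z. fd (\<lambda>x. g x c a) z c) y0 a - fd (\<lambda>z. fd (\<lambda>x. g x c c) z a) y0 a / 2
    - fd (\<lambda>z. fd (\<lambda>x. g x a a) z c) y0 c / 2"
    using riem_second_derivatives[OF y0, of a c] by (simp add: normal g_simps)
  have summand: "h i (d\<Gamma> c c x) (d\<Gamma> a a x) + h i (d\<Gamma> a c x) (d\<Gamma> c a x)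
      - (h i (d\<Gamma> a c x) (d\<Gamma> a c x) + h i (d\<Gamma> a c x) (d\<Gamma> a c x)) / 2
      - (h i (d\<Gamma> c a x) (d\<Gamma> c a x) + h i (d\<Gamma> c a x) (d\<Gamma> c a x)) / 2
      - h i (d\<Gamma> c c x) (d\<Gamma> a a x)
      + h i ((1/2) *\<^sub>R (d\<Gamma> a c x + d\<Gamma> c a x)) ((1/2) *\<^sub>R (d\<Gamma> a c x + d\<Gamma> c a x))
    = - 3/4 * h i (R y0 a c x) (R y0 a c x)" for i x
    by (simp add: riem_normal h_simps h_sym[of i "d\<Gamma> c a x" "d\<Gamma> a c x"] field_simps)
  have "B p (local_curvature B p (a, 0) (c, 0) (c, 0)) (a, 0) = g y0 (R y0 a c c) a
     + (\<Sum>i\<in>UNIV. h i (d\<Gamma> c c (m $ i)) (d\<Gamma> a a (m $ i)) + h i (d\<Gamma> a c (m $ i)) (d\<Gamma> c a (m $ i))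
      - (h i (d\<Gamma> a c (m $ i)) (d\<Gamma> a c (m $ i)) + h i (d\<Gamma> a c (m $ i)) (d\<Gamma> a c (m $ i))) / 2
      - (h i (d\<Gamma> c a (m $ i)) (d\<Gamma> c a (m $ i)) + h i (d\<Gamma> c a (m $ i)) (d\<Gamma> c a (m $ i))) / 2
      - h i (d\<Gamma> c c (m $ i)) (d\<Gamma> a a (m $ i))
      + h i ((1/2) *\<^sub>R (d\<Gamma> a c (m $ i) + d\<Gamma> c a (m $ i))) ((1/2) *\<^sub>R (d\<Gamma> a c (m $ i) + d\<Gamma> c a (m $ i))))"
    unfolding FB.riem_second_derivatives[OF p_in] fd_fd_B_hh lc_hh base
    unfolding B_p
    by (simp only: sum.distrib sum_subtractf sum_divide_distrib fst_conv snd_conv g_simps vec_lambda_beta half_double)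
      (simp add: sum.distrib add_divide_distrib)
  then show ?thesis
    unfolding summand by (simp add: sum_distrib_left sum_negf)
qed

subsection \<open>Mixed planes\<close>

abbreviation "v i b \<equiv> (0, axis i b)"

lemma axis_other: "j \<noteq> i \<Longrightarrow> axis i b $ j = 0"
  by (simp add: axis_def)

text \<open>R(a,c)m_i is orthogonal to m_i, so the \<beta> part of the fibre form vanishes on
  it.\<close>

lemma h_R: "h i b (R y0 a c (m $ i)) = \<alpha> (g y0 (m $ i) (m $ i)) * g y0 b (R y0 a c (m $ i))"
  by (simp add: fibre_form_def riem_skew_self[OF y0])

text \<open>Koszul leaves the difference of two values of \<open>d\<Gamma>\<close>, that is
  R(a,c)m_i paired with b, where c is the base part of the test vector. Pair symmetry turns this
  into g(R(m_i,b)a, c), from which the representing vector is read off.\<close>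

lemma lc_hv: "\<Gamma>' (a, 0) (v i b) = ((\<alpha> (g y0 (m $ i) (m $ i)) / 2) *\<^sub>R R y0 (m $ i) b a, 0)"
proof (rule lc_frame_eqI)
  fix U :: "(real^'n) \<times> (real^'n^'n)"
  let ?c = "fst U"
  have 1: "fd (\<lambda>r. B r (v i b) U) p (a, 0) = h i b (d\<Gamma> a ?c (m $ i))"
    unfolding fd_B_p by (subst sum_single[of i]) (simp_all add: axis_other)
  have 2: "fd (\<lambda>r. B r (a, 0) U) p (v i b) = 0"
    unfolding fd_B_p by simp
  have 3: "fd (\<lambda>r. B r (a, 0) (v i b)) p U = h i b (d\<Gamma> ?c a (m $ i))"
    unfolding fd_B_p by (subst sum_single[of i]) (simp_all add: axis_other h_sym[of i b])
  have "h i b (d\<Gamma> a ?c (m $ i)) - h i b (d\<Gamma> ?c a (m $ i)) = \<alpha> (g y0 (m $ i) (m $ i)) * g y0 (R y0 (m $ i) b a) ?c"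
    using h_R[of i b a ?c] riem_pair_sym[OF y0, of a ?c "m $ i" b] sym[OF y0, of b]
    by (simp add: riem_normal h_simps)
  then show "(fd (\<lambda>r. B r (v i b) U) p (a, 0) + fd (\<lambda>r. B r (a, 0) U) p (v i b) - fd (\<lambda>r. B r (a, 0) (v i b)) p U) / 2
      = B p ((\<alpha> (g y0 (m $ i) (m $ i)) / 2) *\<^sub>R R y0 (m $ i) b a, 0) U"
    unfolding 1 2 3 by (simp add: B_p g_simps)
qed

lemma fd_fd_zero_dir: "fd (\<lambda>z. fd (\<lambda>y. g y c c') z e) y0 0 = 0"
  by (rule fd_zero_dir[OF smooth_on_differentiable[OF smooth_on_fd[OF smooth] y0]])

text \<open>All occurrences of \<open>d\<Gamma> a a\<close> cancel between the second derivatives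
  and the product of the two diagonal Christoffel symbols. What remains is the squared length of the
  mixed symbol from \<open>lc_hv\<close>.\<close>

lemma riem_hv:
  "B p (local_curvature B p (a, 0) (v i b) (v i b)) (a, 0) =
    (\<alpha> (g y0 (m $ i) (m $ i)))\<^sup>2 / 4 * g y0 (R y0 (m $ i) b a) (R y0 (m $ i) b a)"
proof -
  let ?S = "\<lambda>x. d\<Gamma> a a x"
  have z: "fd (\<lambda>y. g y 0 c) z = (\<lambda>_. 0)" if "z \<in> S" for z c
    using fd_cong[OF open_S that, of "\<lambda>y. g y 0 c" "\<lambda>_. 0"] by (simp add: G_simps)
  have zz: "fd (\<lambda>z. fd (\<lambda>y. g y 0 c) z e) y0 e' = 0" for c e e'
    using fd_cong[OF open_S y0, of "\<lambda>z. fd (\<lambda>y. g y 0 c) z e" "\<lambda>_. 0"] by (simp add: z)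
  have 1: "fd (\<lambda>r. fd (\<lambda>r. B r (v i b) (a, 0)) r (v i b)) p (a, 0) = h i b (?S b) + h1 i b b (?S (m $ i))"
    unfolding fd_fd_B_p Let_def by (subst sum_single[of i]) (simp_all add: axis_other zz cov_cov_K_p)
  have 2: "fd (\<lambda>r. fd (\<lambda>r. B r (v i b) (v i b)) r (a, 0)) p (a, 0) = 2 * h i b (?S b) + h1 i (?S (m $ i)) b b"
    unfolding fd_fd_B_p Let_def
    by (subst sum_single[of i]) (simp_all add: axis_other zz cov_cov_K_p h_sym[of i "?S b" b])
  have 3: "fd (\<lambda>r. fd (\<lambda>r. B r (a, 0) (a, 0)) r (v i b)) p (v i b) = 0"
    unfolding fd_fd_B_p Let_def by (simp add: fd_fd_zero_dir)
  have vv: "\<Gamma>' (a, 0) (a, 0) = (0, \<chi> i. ?S (m $ i))"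
    unfolding lc_hh half_double ..
  have 4: "B p (\<Gamma>' (v i b) (v i b)) (0, \<chi> i. ?S (m $ i)) = h1 i b b (?S (m $ i)) - h1 i (?S (m $ i)) b b / 2"
  proof -
    have 5: "fd (\<lambda>r. B r (v i b) (0, \<chi> i. ?S (m $ i))) p (v i b) = h1 i b b (?S (m $ i))"
      unfolding fd_B_p by (subst sum_single[of i]) (simp_all add: axis_other)
    have 6: "fd (\<lambda>r. B r (v i b) (v i b)) p (0, \<chi> i. ?S (m $ i)) = h1 i (?S (m $ i)) b b"
      unfolding fd_B_p by (subst sum_single[of i]) (simp_all add: axis_other)
    show ?thesis unfolding FB.lc_koszul[OF p_in] 5 6 by simp
  qed
  show ?thesis
    unfolding FB.riem_second_derivatives[OF p_in] 1 2 3 vv 4 lc_hv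
    by (simp add: B_p g_simps power2_eq_square add_divide_distrib)
qed

subsection \<open>Vertical planes\<close>

lemma lc_vv_other:
  assumes "i \<noteq> j"
  shows "\<Gamma>' (v i b) (v j c) = 0"
proof (rule lc_frame_eqI)
  fix U :: "(real^'n) \<times> (real^'n^'n)"
  have "axis i b $ k = 0 \<or> axis j c $ k = 0" for k
    using assms by (auto simp: axis_def)
  then have "h1 k (axis i b $ k) (axis j c $ k) z = 0" "h1 k (axis j c $ k) (axis i b $ k) z = 0"
    "h1 k z (axis i b $ k) (axis j c $ k) = 0" for k z
    by (metis h1_zero)+
  then show "(fd (\<lambda>r. B r (v j c) U) p (v i b) + fd (\<lambda>r. B r (v i b) U) p (v j c) - fd (\<lambda>r. B r (v i b) (v j c)) p U) / 2 = B p 0 U"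
    unfolding fd_B_p by (simp add: B_p g_simps)
qed

text \<open>The fibre component of \<open>\<nabla>\<close> between two vertical lifts with the same index.\<close>

definition V2 :: "'n \<Rightarrow> real^'n \<Rightarrow> real^'n \<Rightarrow> real^'n"
  where "V2 i b c = (let N = g y0 (m $ i) (m $ i); x = g y0 b (m $ i); y = g y0 c (m $ i); z = g y0 b c in
    (deriv \<alpha> N / \<alpha> N) *\<^sub>R (x *\<^sub>R c + y *\<^sub>R b)
    + (((deriv \<beta> N - 2 * deriv \<alpha> N * \<beta> N / \<alpha> N) * x * y + (\<beta> N - deriv \<alpha> N) * z) / (\<alpha> N + N * \<beta> N)) *\<^sub>R (m $ i))"

text \<open>Since h(m_i, d) = (\<alpha> + N \<beta>) g(m_i, d), the component along m_i can be
  adjusted by one division. The first summand of \<open>V2\<close> supplies the wanted \<alpha>'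
  terms but also 2 \<alpha>' \<beta> x y / \<alpha> along m_i, which the second summand
  subtracts.\<close>

lemma h_V2: "h i (V2 i b c) d = (h1 i b c d + h1 i c b d - h1 i d b c) / 2"
proof -
  define N where "N = g y0 (m $ i) (m $ i)"
  have N: "N > 0" unfolding N_def by (rule pos[OF y0 m_nz])
  define A A1 Be B1 where "A = \<alpha> N" and "A1 = deriv \<alpha> N" and "Be = \<beta> N" and "B1 = deriv \<beta> N"
  define D where "D = A + N * Be"
  have nz: "A \<noteq> 0" "D \<noteq> 0" using \<alpha>_pos[OF N] \<alpha>\<beta>_pos[OF N] by (auto simp: A_def D_def Be_def)
  define x y z where "x = g y0 b (m $ i)" and "y = g y0 c (m $ i)" and "z = g y0 b c"
  define xd yd md where "xd = g y0 b d" and "yd = g y0 c d" and "md = g y0 d (m $ i)"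
  define \<mu> where "\<mu> = ((B1 - 2 * A1 * Be / A) * x * y + (Be - A1) * z) / D"
  have \<mu>: "\<mu> * (A + N * Be) = (B1 - 2 * A1 * Be / A) * x * y + (Be - A1) * z"
    using nz by (simp add: \<mu>_def D_def)
  have V2: "V2 i b c = (A1 / A) *\<^sub>R (x *\<^sub>R c + y *\<^sub>R b) + \<mu> *\<^sub>R (m $ i)"
    by (simp add: V2_def Let_def N_def A_def A1_def Be_def B1_def x_def y_def z_def \<mu>_def D_def)
  have "h i (V2 i b c) d = A * (A1 / A * (x * yd + y * xd) + \<mu> * md) + Be * (A1 / A * (x * y + y * x) + \<mu> * N) * md"
    unfolding V2 fibre_form_def by (simp add: g_simps N_def[symmetric] A_def[symmetric] Be_def[symmetric] xd_def[symmetric]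
      yd_def[symmetric] x_def[symmetric] y_def[symmetric] md_def[symmetric] sym[OF y0, of "m $ i" d])
  also have "\<dots> = A1 * (x * yd + y * xd) + md * (\<mu> * (A + N * Be) + 2 * A1 * Be / A * x * y)"
    using nz by (simp add: field_simps)
  also have "\<dots> = A1 * (x * yd + y * xd) + md * (B1 * x * y + (Be - A1) * z)"
    unfolding \<mu> by (simp add: algebra_simps)
  also have "\<dots> = (h1 i b c d + h1 i c b d - h1 i d b c) / 2"
    unfolding fibre_form_deriv_def
    by (simp add: N_def[symmetric] A1_def[symmetric] Be_def[symmetric] B1_def[symmetric] xd_def[symmetric]
      yd_def[symmetric] x_def[symmetric] y_def[symmetric] md_def[symmetric] z_def[symmetric]
      sym[OF y0, of c b] sym[OF y0, of d b] sym[OF y0, of d c] field_simps)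
  finally show ?thesis .
qed

lemma lc_vv: "\<Gamma>' (v i b) (v i c) = v i (V2 i b c)"
proof (rule lc_frame_eqI)
  fix U :: "(real^'n) \<times> (real^'n^'n)"
  have 1: "fd (\<lambda>r. B r (v i c) U) p (v i b) = h1 i b c (snd U $ i)" for b c
    unfolding fd_B_p by (subst sum_single[of i]) (simp_all add: axis_other)
  have 2: "fd (\<lambda>r. B r (v i b) (v i c)) p U = h1 i (snd U $ i) b c"
    unfolding fd_B_p by (subst sum_single[of i]) (simp_all add: axis_other)
  have 3: "B p (v i x) U = h i x (snd U $ i)" for x
    unfolding B_p by (subst sum_single[of i]) (simp_all add: axis_other g_simps)
  show "(fd (\<lambda>r. B r (v i c) U) p (v i b) + fd (\<lambda>r. B r (v i b) U) p (v i c) - fd (\<lambda>r. B r (v i b) (v i c)) p U) / 2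
     = B p (v i (V2 i b c)) U"
    unfolding 1 2 3 h_V2 ..
qed

text \<open>On vertical vectors the metric is a sum over the index, and at each index at most one of
  the two vectors has a component. Across different factors all mixed terms vanish, as in a
  Riemannian product.\<close>

lemma riem_vv_other:
  assumes "i \<noteq> j"
  shows "B p (local_curvature B p (v i b) (v j c) (v j c)) (v i b) = 0"
proof -
  have "axis i b $ k = 0 \<or> axis j c $ k = 0" for k
    using assms by (auto simp: axis_def)
  then have z: "h2 k (axis i b $ k) (axis j c $ k) x y = 0" "h2 k (axis i b $ k) x (axis j c $ k) y = 0"
    "h2 k (axis j c $ k) (axis i b $ k) x y = 0" "h2 k (axis j c $ k) x (axis i b $ k) y = 0"
    "h k (axis j x $ k) (axis i y $ k) = 0" for k x y
    using assms by (metis h2_zero, metis h2_zero, metis h2_zero, metis h2_zero, metis h_zero axis_other)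
  have D: "fd (\<lambda>r. fd (\<lambda>r. B r (v k b) (v l c)) r (v k' b')) p (v l' c') =
     (\<Sum>q\<in>UNIV. h2 q (axis l' c' $ q) (axis k' b' $ q) (axis k b $ q) (axis l c $ q))" for k l k' l' b b' c c'
    unfolding fd_fd_B_p Let_def by (simp add: fd_fd_zero_dir cov_cov_K_p)
  show ?thesis
    unfolding FB.riem_second_derivatives[OF p_in] D lc_vv lc_vv_other[OF assms]
    by (simp add: z B_p g_simps)
qed

lemma riem_vv:
  fixes i :: 'n
  assumes "g y0 b b = 1" "g y0 c c = 1" "g y0 b c = 0"
  defines "N \<equiv> g y0 (m $ i) (m $ i)"
  shows "B p (local_curvature B p (v i b) (v i c) (v i c)) (v i b) =
    \<alpha> N * (coeff_A \<alpha> \<beta> N * ((g y0 b (m $ i))\<^sup>2 + (g y0 c (m $ i))\<^sup>2) + coeff_B \<alpha> \<beta> N)"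
proof -
  have cb: "g y0 c b = 0" using assms(3) sym[OF y0, of c b] by simp
  define x y where "x = g y0 b (m $ i)" and "y = g y0 c (m $ i)"
  have x': "g y0 (m $ i) b = x" and y': "g y0 (m $ i) c = y"
    unfolding x_def y_def by (rule sym[OF y0])+
  have N: "N > 0" unfolding N_def by (rule pos[OF y0 m_nz])
  define A A1 A2 Be B1 B2 where "A = \<alpha> N" and "A1 = deriv \<alpha> N" and "A2 = deriv (deriv \<alpha>) N"
    and "Be = \<beta> N" and "B1 = deriv \<beta> N" and "B2 = deriv (deriv \<beta>) N"
  define D where "D = A + N * Be"
  have nz: "A \<noteq> 0" "D \<noteq> 0" using \<alpha>_pos[OF N] \<alpha>\<beta>_pos[OF N] by (auto simp: A_def D_def Be_def)
  have D: "fd (\<lambda>r. fd (\<lambda>r. B r (v i b1) (v i b2)) r (v i b3)) p (v i b4) = h2 i b4 b3 b1 b2" for b1 b2 b3 b4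
    unfolding fd_fd_B_p Let_def by (subst sum_single[of i]) (simp_all add: axis_other fd_fd_zero_dir cov_cov_K_p)
  have Bv: "B p (v i b1) (v i b2) = h i b1 b2" for b1 b2
    unfolding B_p by (subst sum_single[of i]) (simp_all add: axis_other g_simps)
  note folds = N_def[symmetric] A_def[symmetric] A1_def[symmetric] A2_def[symmetric] Be_def[symmetric]
    B1_def[symmetric] B2_def[symmetric] x_def[symmetric] y_def[symmetric] D_def[symmetric]
  have V: "V2 i b c = (A1 / A) *\<^sub>R (x *\<^sub>R c + y *\<^sub>R b) + ((B1 - 2 * A1 * Be / A) * x * y / D) *\<^sub>R (m $ i)"
    "V2 i b b = (2 * A1 / A * x) *\<^sub>R b + (((B1 - 2 * A1 * Be / A) * x * x + (Be - A1)) / D) *\<^sub>R (m $ i)"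
    "V2 i c c = (2 * A1 / A * y) *\<^sub>R c + (((B1 - 2 * A1 * Be / A) * y * y + (Be - A1)) / D) *\<^sub>R (m $ i)"
    by (simp_all add: V2_def Let_def assms(1-3) folds scaleR_add_left[symmetric])
  have h2s: "h2 i b c c b = 4 * B2 * x * y * x * y + 2 * B1 * (x * x + y * y) + Be"
    "h2 i b b c c = 4 * A2 * x * x + 2 * A1 + 4 * B2 * x * x * y * y + 2 * B1 * y * y"
    "h2 i c c b b = 4 * A2 * y * y + 2 * A1 + 4 * B2 * x * x * y * y + 2 * B1 * x * x"
    unfolding fibre_form_deriv2_def by (simp_all add: assms(1-3) cb folds algebra_simps)
  \<comment> \<open>One factor of each quadratic term is eliminated through \<open>h_V2\<close>. The
    other factor then enters only through its products with b, c and m_i, which are listed in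
    \<open>prods\<close>.\<close>
  have hV: "h i (V2 i c c) (V2 i b b) = (2 * h1 i c c (V2 i b b) - h1 i (V2 i b b) c c) / 2"
    "h i (V2 i b c) (V2 i b c) = (h1 i b c (V2 i b c) + h1 i c b (V2 i b c) - h1 i (V2 i b c) b c) / 2"
    by (simp_all add: h_V2)
  let ?d = "V2 i b b" and ?e = "V2 i b c"
  define \<mu> \<nu> where \<mu>: "\<mu> = ((B1 - 2 * A1 * Be / A) * x * x + (Be - A1)) / D"
    and \<nu>: "\<nu> = (B1 - 2 * A1 * Be / A) * x * y / D"
  have prods: "g y0 c ?d = \<mu> * y" "g y0 ?d (m $ i) = 2 * A1 / A * x * x + \<mu> * N"
    "g y0 c ?e = A1 / A * x + \<nu> * y" "g y0 b ?e = A1 / A * y + \<nu> * x" "g y0 ?e (m $ i) = 2 * A1 / A * x * y + \<nu> * N"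
    unfolding V \<mu>[symmetric] \<nu>[symmetric] by (simp_all add: g_simps assms(1-3) cb folds x' y' distrib_left)
  have h1s: "h1 i c c d = 2 * A1 * y * g y0 c d + 2 * B1 * y * y * g y0 d (m $ i) + Be * (g y0 d (m $ i) + y * g y0 c d)"
     "h1 i d c c = 2 * A1 * g y0 d (m $ i) + 2 * B1 * g y0 d (m $ i) * y * y + 2 * Be * y * g y0 c d"
     "h1 i b c d = 2 * A1 * x * g y0 c d + 2 * B1 * x * y * g y0 d (m $ i) + Be * y * g y0 b d"
     "h1 i c b d = 2 * A1 * y * g y0 b d + 2 * B1 * x * y * g y0 d (m $ i) + Be * x * g y0 c d"
     "h1 i d b c = 2 * B1 * x * y * g y0 d (m $ i) + Be * (y * g y0 b d + x * g y0 c d)" for d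
    unfolding fibre_form_deriv_def by (simp_all add: assms(1-3) cb folds sym[OF y0, of d c] sym[OF y0, of d b])
  have "B p (local_curvature B p (v i b) (v i c) (v i c)) (v i b) = h2 i b c c b - h2 i b b c c / 2 - h2 i c c b b / 2
     - h i (V2 i c c) (V2 i b b) + h i (V2 i b c) (V2 i b c)"
    unfolding FB.riem_second_derivatives[OF p_in] D lc_vv Bv ..
  also have "\<dots> = 4 * B2 * x * y * x * y + 2 * B1 * (x * x + y * y) + Be
     - (4 * A2 * x * x + 2 * A1 + 4 * B2 * x * x * y * y + 2 * B1 * y * y) / 2
     - (4 * A2 * y * y + 2 * A1 + 4 * B2 * x * x * y * y + 2 * B1 * x * x) / 2
     - (2 * A1 * y * (\<mu> * y) + (B1 * y * y + Be - A1) * (2 * A1 / A * x * x + \<mu> * N))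
     + (A1 * (x * (A1 / A * x + \<nu> * y) + y * (A1 / A * y + \<nu> * x)) + B1 * x * y * (2 * A1 / A * x * y + \<nu> * N))"
    unfolding hV h1s h2s prods by (simp add: algebra_simps add_divide_distrib diff_divide_distrib)
  also have "\<dots> = A * (coeff_A \<alpha> \<beta> N * (x\<^sup>2 + y\<^sup>2) + coeff_B \<alpha> \<beta> N)"
    unfolding coeff_A_def coeff_B_def folds \<mu> \<nu>
    by (rule vertical_curvature_identity[OF nz(1) _ D_def]) (use nz(2) in \<open>simp add: D_def\<close>)
  finally show ?thesis by (simp add: folds)
qed

end

section \<open>Reduction to normal coordinates\<close>

definition frame_map :: "(real^'n \<Rightarrow> real^'n) \<Rightarrow> (real^'n) \<times> (real^'n^'n::finite) \<Rightarrow> (real^'n) \<times> (real^'n^'n)"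
  where "frame_map F r = (F (fst r), \<chi> i. fd F (fst r) (snd r $ i))"

lemma has_derivative_vec_lambda:
  fixes f :: "'n::finite \<Rightarrow> 'a::real_normed_vector \<Rightarrow> 'b::euclidean_space"
  assumes "\<And>i. (f i has_derivative f' i) (at x)"
  shows "((\<lambda>x. \<chi> i. f i x) has_derivative (\<lambda>h. \<chi> i. f' i h)) (at x)"
proof (subst has_derivative_componentwise_within, rule ballI)
  fix b :: "'b^'n" assume "b \<in> Basis"
  then obtain i c where "b = axis i c" by (auto simp: Basis_vec_def)
  then show "((\<lambda>x. (\<chi> i. f i x) \<bullet> b) has_derivative (\<lambda>h. (\<chi> i. f' i h) \<bullet> b)) (at x)"
    using has_derivative_inner_left[OF assms, of i c] by (simp add: inner_axis)
qed

lemma smooth_frame_map: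
  fixes F :: "real^'n::finite \<Rightarrow> real^'n"
  assumes T: "open T" and F: "smooth_on T F"
  shows "smooth_on (T \<times> UNIV) (frame_map F)"
proof -
  have oT: "open (T \<times> (UNIV :: (real^'n^'n) set))" using T by (simp add: open_Times)
  have sub: "fst ` (T \<times> (UNIV :: (real^'n^'n) set)) \<subseteq> T" by auto
  have s: "smooth_on (T \<times> (UNIV :: (real^'n^'n) set)) (\<lambda>r. f (fst r))" if "smooth_on T f" for f :: "real^'n \<Rightarrow> real^'n"
    by (rule smooth_on_compose[OF oT T smooth_on_fst that sub])
  have "smooth_on (T \<times> (UNIV :: (real^'n^'n) set)) (\<lambda>r. fd F (fst r) (snd r $ i))" for i
  proof (rule smooth_on_linear_family[where L = "\<lambda>r :: (real^'n) \<times> (real^'n^'n). fd F (fst r)" and p = "\<lambda>r. snd r $ i", OF oT])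
    show "linear (fd F (fst r))" if "r \<in> T \<times> UNIV" for r :: "(real^'n) \<times> (real^'n^'n)"
      by (rule smooth_on_linear_fd[OF F]) (use that in auto)
  qed (intro s smooth_on_fd F smooth_on_vec_nth oT smooth_on_snd)+
  then show ?thesis
    unfolding frame_map_def[abs_def] by (intro smooth_on_Pair oT s F smooth_on_vec)
qed

lemma fd_frame_map:
  fixes F :: "real^'n::finite \<Rightarrow> real^'n"
  assumes T: "open T" and F: "smooth_on T F" and r: "fst r \<in> T"
  shows "fd (frame_map F) r V = (fd F (fst r) (fst V),
     \<chi> i. fd (\<lambda>z. fd F z (snd r $ i)) (fst r) (fst V) + fd F (fst r) (snd V $ i))"
proof -
  have oT: "open (T \<times> (UNIV :: (real^'n^'n) set))" using T by (simp add: open_Times)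
  have r': "r \<in> T \<times> UNIV" using r by (auto simp: mem_Times_iff)
  have sub: "fst ` (T \<times> (UNIV :: (real^'n^'n) set)) \<subseteq> T" by auto
  have s: "smooth_on (T \<times> (UNIV :: (real^'n^'n) set)) (\<lambda>r. f (fst r))" if "smooth_on T f" for f :: "real^'n \<Rightarrow> real^'n"
    by (rule smooth_on_compose[OF oT T smooth_on_fst that sub])
  have fstD: "((fst :: (real^'n) \<times> (real^'n^'n) \<Rightarrow> _) has_derivative fst) (at r)"
    by (intro bounded_linear_imp_has_derivative bounded_linear_fst)
  have base: "((\<lambda>r. f (fst r)) has_derivative (\<lambda>V. fd f (fst r) (fst V))) (at r)" if "smooth_on T f" for f :: "real^'n \<Rightarrow> real^'n"
    by (rule smooth_on_chain[OF that fstD r])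
  have "((\<lambda>r. fd F (fst r) (snd r $ i)) has_derivative
      (\<lambda>V. fd (\<lambda>z. fd F z (snd r $ i)) (fst r) (fst V) + fd F (fst r) (snd V $ i))) (at r)" for i
  proof -
    have l: "linear (fd F (fst r))" if "r \<in> T \<times> UNIV" for r :: "(real^'n) \<times> (real^'n^'n)"
      by (rule smooth_on_linear_fd[OF F]) (use that in auto)
    have d: "((\<lambda>r. snd r $ i) has_derivative (\<lambda>V. snd V $ i)) (at r)"
      by (intro bounded_linear.has_derivative[OF bounded_linear_vec_nth] bounded_linear_imp_has_derivative bounded_linear_snd)
    have "((\<lambda>r. fd F (fst r) (snd r $ i)) has_derivative
      (\<lambda>V. fd (\<lambda>z. fd F (fst z) (snd r $ i)) r V + fd F (fst r) (snd V $ i))) (at r)"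
      by (rule has_derivative_linear_family[where L = "\<lambda>r :: (real^'n) \<times> (real^'n^'n). fd F (fst r)" and p = "\<lambda>r. snd r $ i", OF oT r' l
          s[OF smooth_on_fd[OF F]] d])
    then show ?thesis by (simp add: fd_unique[OF base[OF smooth_on_fd[OF F]]])
  qed
  then have "((\<lambda>r. \<chi> i. fd F (fst r) (snd r $ i)) has_derivative
     (\<lambda>V. \<chi> i. fd (\<lambda>z. fd F z (snd r $ i)) (fst r) (fst V) + fd F (fst r) (snd V $ i))) (at r)"
    by (rule has_derivative_vec_lambda)
  from has_derivative_Pair[OF base[OF F] this] show ?thesis
    unfolding frame_map_def[abs_def] by (simp add: fd_unique)
qed

section \<open>Naturality of the frame metric\<close>

locale frame_pullback = frame_local S g \<alpha> \<beta> + metric_pullback S g T F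
  for S :: "(real^'n::finite) set" and g \<alpha> \<beta> T F
begin

abbreviation "g' \<equiv> pullback_form g F"

sublocale P: frame_local T g' \<alpha> \<beta>
  by (intro frame_local.intro pull_metric frame_local_axioms.intro smooth_\<alpha> smooth_\<beta> \<alpha>_pos \<alpha>\<beta>_pos)

lemma frame_map_into: "r \<in> P.Q \<Longrightarrow> frame_map F r \<in> Q"
proof -
  assume r: "r \<in> P.Q"
  have "dF (fst r) (snd r $ i) \<noteq> 0" for i
    using injD[OF inj_dF[OF P.Q_D(1)[OF r]], of "snd r $ i" 0] P.Q_D(2)[OF r, of i]
      linear_0[OF linear_dF[OF P.Q_D(1)[OF r]]] by auto
  then show ?thesis using F_into[OF P.Q_D(1)[OF r]] by (simp add: Q_def frame_map_def)
qed

lemma fd_frame_map_Q: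
  "r \<in> P.Q \<Longrightarrow> fd (frame_map F) r V =
    (dF (fst r) (fst V), \<chi> i. d2F (fst r) (fst V) (snd r $ i) + dF (fst r) (snd V $ i))"
  unfolding d2F_def by (rule fd_frame_map[OF open_T smooth_F P.Q_D(1)])

text \<open>The second derivatives of F in the derivative of the frame map are exactly the
  inhomogeneous term of \<open>lc_pull\<close>. Vertical components therefore transform as tangent
  vectors, and this makes the frame map an isometry.\<close>

lemma vpart_frame_map:
  assumes "r \<in> P.Q"
  shows "vertical_part g (frame_map F r) (fd (frame_map F) r V) i = dF (fst r) (vertical_part g' r V i)"
  using P.Q_D(1)[OF assms]
  by (simp add: vertical_part_def fd_frame_map_Q[OF assms] frame_map_def F_lin lc_pull)

lemma pull_frame_metric:
  assumes "r \<in> P.Q"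
  shows "pullback_form B (frame_map F) r = frame_form g' \<alpha> \<beta> r"
proof (intro ext)
  fix V W
  have "fst (fd (frame_map F) r V) = dF (fst r) (fst V)" for V
    by (simp add: fd_frame_map_Q[OF assms])
  then show "pullback_form B (frame_map F) r V W = frame_form g' \<alpha> \<beta> r V W"
    unfolding pullback_form_def[of B] frame_form_def vpart_frame_map[OF assms] by (simp add: frame_map_def fibre_form_def pullback_form_def)
qed

sublocale FP: metric_pullback Q B P.Q "frame_map F"
proof (rule metric_pullback.intro[OF frame_metric_local])
  show "metric_pullback_axioms Q P.Q (frame_map F)"
  proof
    show "open P.Q" by (rule P.open_Q)
    show "smooth_on P.Q (frame_map F)"
      by (rule smooth_on_subset[OF smooth_frame_map[OF open_T smooth_F]]) (auto simp: P.Q_def)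
    show "frame_map F r \<in> Q" if "r \<in> P.Q" for r by (rule frame_map_into[OF that])
    \<comment> \<open>The derivative is block triangular: once the base parts agree, the terms with
      second derivatives of F agree too and can be removed from the fibre parts.\<close>
    show "inj (fd (frame_map F) r)" if r: "r \<in> P.Q" for r
    proof (rule injI)
      fix V W assume eq: "fd (frame_map F) r V = fd (frame_map F) r W"
      note inj = injD[OF inj_dF[OF P.Q_D(1)[OF r]]]
      have "dF (fst r) (fst V) = dF (fst r) (fst W)"
        using arg_cong[OF eq, of fst] unfolding fd_frame_map_Q[OF r] fst_conv .
      then have 1: "fst V = fst W" by (rule inj)
      have "dF (fst r) (snd V $ i) = dF (fst r) (snd W $ i)" for i
        using arg_cong[OF eq, of "\<lambda>x. snd x $ i"] unfolding fd_frame_map_Q[OF r] snd_conv 1 by simp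
      then have "snd V $ i = snd W $ i" for i by (rule inj)
      with 1 show "V = W" by (simp add: prod_eq_iff vec_eq_iff)
    qed
  qed
qed

lemma frame_curvature_pull:
  assumes r: "r \<in> P.Q"
  shows "B (frame_map F r) (local_curvature B (frame_map F r) (fd (frame_map F) r V) (fd (frame_map F) r W) (fd (frame_map F) r X))
      (fd (frame_map F) r Y) = frame_form g' \<alpha> \<beta> r (local_curvature (frame_form g' \<alpha> \<beta>) r V W X) Y"
proof -
  have "local_curvature (pullback_form B (frame_map F)) r = local_curvature (frame_form g' \<alpha> \<beta>) r"
    by (rule riem_cong[OF P.open_Q r pull_frame_metric])
  then show ?thesis
    unfolding FP.riem_pull[OF r, symmetric] pull_frame_metric[OF r, symmetric] by (simp add: pullback_form_def)
qed

end

section \<open>Quadratic coordinates at the base point of a frame\<close>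

locale frame_point = frame_local S g \<alpha> \<beta> for S :: "(real^'n::finite) set" and g \<alpha> \<beta> +
  fixes y0 :: "real^'n" and m :: "real^'n^'n"
  assumes y0: "y0 \<in> S" and m_nz: "m $ i \<noteq> 0"
begin

text \<open>The second order Taylor polynomial of the exponential map at \<open>y0\<close>: enough to make the
  Christoffel symbols of the pulled back metric vanish at \<open>0\<close>.\<close>

definition \<psi> :: "real^'n \<Rightarrow> real^'n" where "\<psi> z = y0 + z - (1/2) *\<^sub>R \<Gamma> y0 z z"

lemma \<psi>_derivative: "(\<psi> has_derivative (\<lambda>v. v - \<Gamma> y0 z v)) (at z)"
proof -
  interpret b: bounded_bilinear "\<Gamma> y0"
    using bilinear_lc[OF y0] by (simp add: bilinear_conv_bounded_bilinear)
  have "(\<psi> has_derivative (\<lambda>v. 0 + v - (1/2) *\<^sub>R (\<Gamma> y0 z v + \<Gamma> y0 v z))) (at z)"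
    unfolding \<psi>_def[abs_def]
    by (intro has_derivative_diff has_derivative_add has_derivative_const has_derivative_ident
        has_derivative_scaleR_right b.FDERIV)
  moreover have "0 + v - (1/2) *\<^sub>R (\<Gamma> y0 z v + \<Gamma> y0 v z) = v - \<Gamma> y0 z v" for v
    using lc_sym[OF y0, of v z] by (simp add: scaleR_2[symmetric])
  ultimately show ?thesis by simp
qed

lemma fd_\<psi>: "fd \<psi> z v = v - \<Gamma> y0 z v"
  by (simp add: fd_unique[OF \<psi>_derivative])

lemma smooth_\<psi>: "open T \<Longrightarrow> smooth_on T \<psi>"
  unfolding \<psi>_def[abs_def]
  by (intro smooth_on_diff smooth_on_add smooth_on_const smooth_on_ident smooth_on_scaleR
      smooth_on_bilinear_family[where B = "\<lambda>_. \<Gamma> y0"] bilinear_lc[OF y0])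

lemma fd_fd_\<psi>: "fd (\<lambda>z. fd \<psi> z b) z a = - \<Gamma> y0 a b"
proof -
  have "bounded_linear (\<lambda>z. \<Gamma> y0 z b)"
    using bilinear_lc[OF y0] by (intro bounded_linear_euclidean) (simp add: bilinear_def)
  then have "((\<lambda>z. b - \<Gamma> y0 z b) has_derivative (\<lambda>a. 0 - \<Gamma> y0 a b)) (at z)"
    by (intro has_derivative_diff has_derivative_const bounded_linear_imp_has_derivative)
  then show ?thesis by (simp add: fd_\<psi> fd_unique)
qed

text \<open>The derivative at (0, m) of the frame map induced by \<psi>: there the derivative of
  \<psi> is the identity and its second derivative is -\<Gamma>. It sends (a, 0) to the horizontal
  lift of a and fixes vertical vectors.\<close>

definition adapted_lift :: "(real^'n) \<times> (real^'n^'n) \<Rightarrow> (real^'n) \<times> (real^'n^'n)"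
  where "adapted_lift V = (fst V, \<chi> i. snd V $ i - \<Gamma> y0 (fst V) (m $ i))"

lemma normal_coordinates:
  obtains T where "frame_pullback S g \<alpha> \<beta> T \<psi>" "0 \<in> T"
proof -
  obtain C where C: "C > 0" "\<And>a b. norm (\<Gamma> y0 a b) \<le> C * norm a * norm b"
    using bilinear_bounded_pos[OF bilinear_lc[OF y0]] by blast
  \<comment> \<open>On this ball \<Gamma>(z, .) has norm below 1, so the derivative id - \<Gamma>(z,
    .) of \<psi> is injective.\<close>
  define T where "T = ball 0 (1 / C) \<inter> \<psi> -` S"
  have "continuous_on UNIV \<psi>"
    by (rule smooth_on_continuous[OF smooth_\<psi>[OF open_UNIV]])
  then have oT: "open T"
    unfolding T_def by (intro open_Int open_ball open_vimage open_S)
  have inj: "inj (fd \<psi> z)" if "z \<in> T" for z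
  proof (rule injI)
    fix v w assume "fd \<psi> z v = fd \<psi> z w"
    then have eq: "v - w = \<Gamma> y0 z (v - w)" by (simp add: fd_\<psi> lc_simps y0 algebra_simps)
    show "v = w"
    proof (rule ccontr)
      assume "v \<noteq> w"
      then have "C * norm z * norm (v - w) < 1 * norm (v - w)"
        using that C(1) by (intro mult_strict_right_mono) (auto simp: T_def field_simps)
      then show False using C(2)[of z "v - w"] eq by simp
    qed
  qed
  have "frame_pullback S g \<alpha> \<beta> T \<psi>"
    by unfold_locales (use oT inj smooth_\<psi>[OF oT] in \<open>auto simp: T_def\<close>)
  moreover have "0 \<in> T" using C(1) y0 by (simp add: T_def \<psi>_def lc_simps)
  ultimately show thesis by (rule that)
qed

lemma frame_curvature_normal:
  obtains T g' where "frame_normal T g' \<alpha> \<beta> 0 m" "g' 0 = g y0" "local_curvature g' 0 = R y0"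
    "\<And>V W X Y. B (y0, m) (local_curvature B (y0, m) (adapted_lift V) (adapted_lift W) (adapted_lift X)) (adapted_lift Y)
      = frame_form g' \<alpha> \<beta> (0, m) (local_curvature (frame_form g' \<alpha> \<beta>) (0, m) V W X) Y"
proof -
  obtain T where T: "frame_pullback S g \<alpha> \<beta> T \<psi>" "0 \<in> T" by (rule normal_coordinates)
  interpret F: frame_pullback S g \<alpha> \<beta> T \<psi> by (rule T(1))
  have \<psi>0: "\<psi> 0 = y0" by (simp add: \<psi>_def lc_simps y0)
  have d0: "fd \<psi> 0 v = v" for v by (simp add: fd_\<psi> lc_simps y0)
  have p: "(0, m) \<in> F.P.Q" using T(2) m_nz by (simp add: F.P.Q_def)
  show thesis
  proof
    show "frame_normal T (pullback_form g \<psi>) \<alpha> \<beta> 0 m"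
    proof
      show "local_christoffel (pullback_form g \<psi>) 0 a b = 0" for a b
        using F.lc_pull[OF T(2), of a b] by (simp add: d0 F.d2F_def fd_fd_\<psi> \<psi>0)
    qed (use T(2) m_nz in auto)
    show "pullback_form g \<psi> 0 = g y0" by (intro ext) (simp add: pullback_form_def d0 \<psi>0)
    show "local_curvature (pullback_form g \<psi>) 0 = R y0"
      using F.riem_pull[OF T(2)] by (intro ext) (simp add: d0 \<psi>0)
    fix V W X Y
    have "fd (frame_map \<psi>) (0, m) V = adapted_lift V" for V
      using F.fd_frame_map_Q[OF p, of V] by (simp add: adapted_lift_def d0 F.d2F_def fd_fd_\<psi>)
    moreover have "frame_map \<psi> (0, m) = (y0, m)"
      by (simp add: frame_map_def \<psi>0 d0)
    ultimately show "B (y0, m) (local_curvature B (y0, m) (adapted_lift V) (adapted_lift W) (adapted_lift X)) (adapted_lift Y)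
      = frame_form (pullback_form g \<psi>) \<alpha> \<beta> (0, m) (local_curvature (frame_form (pullback_form g \<psi>) \<alpha> \<beta>) (0, m) V W X) Y"
      using F.frame_curvature_pull[OF p, of V W X Y] by simp
  qed
qed

definition hlift :: "real^'n \<Rightarrow> (real^'n) \<times> (real^'n^'n)"
  where "hlift a = (a, \<chi> i. - \<Gamma> y0 a (m $ i))"

lemma adapted_lift: "adapted_lift (a, 0) = hlift a" "adapted_lift (0, c) = (0, c)"
  by (simp_all add: adapted_lift_def hlift_def lc_simps y0)

lemma frame_curvatures:
  defines "N \<equiv> \<lambda>i. g y0 (m $ i) (m $ i)" and "v \<equiv> \<lambda>i b. (0, axis i b)" and "p \<equiv> (y0, m)"
  shows "B p (local_curvature B p (hlift a) (hlift c) (hlift c)) (hlift a) = g y0 (R y0 a c c) a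
     - 3/4 * (\<Sum>i\<in>UNIV. \<alpha> (N i) * g y0 (R y0 a c (m $ i)) (R y0 a c (m $ i)))" (is ?hh)
    and "B p (local_curvature B p (hlift a) (v i b) (v i b)) (hlift a) =
       (\<alpha> (N i))\<^sup>2 / 4 * g y0 (R y0 (m $ i) b a) (R y0 (m $ i) b a)" (is ?hv)
    and "i \<noteq> j \<Longrightarrow> B p (local_curvature B p (v i b) (v j c) (v j c)) (v i b) = 0"
    and "g y0 b b = 1 \<Longrightarrow> g y0 c c = 1 \<Longrightarrow> g y0 b c = 0 \<Longrightarrow>
       B p (local_curvature B p (v i b) (v i c) (v i c)) (v i b) =
       \<alpha> (N i) * (coeff_A \<alpha> \<beta> (N i) * ((g y0 b (m $ i))\<^sup>2 + (g y0 c (m $ i))\<^sup>2) + coeff_B \<alpha> \<beta> (N i))"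
proof -
  obtain T g' where F: "frame_normal T g' \<alpha> \<beta> 0 m" and eqs: "g' 0 = g y0" "local_curvature g' 0 = R y0"
    and pullback_form: "\<And>V W X Y. B (y0, m) (local_curvature B (y0, m) (adapted_lift V) (adapted_lift W) (adapted_lift X)) (adapted_lift Y)
      = frame_form g' \<alpha> \<beta> (0, m) (local_curvature (frame_form g' \<alpha> \<beta>) (0, m) V W X) Y"
    by (rule frame_curvature_normal) blast
  interpret F: frame_normal T g' \<alpha> \<beta> 0 m by (rule F)
  have fib_R: "fibre_form g' \<alpha> \<beta> 0 (m $ i) (R y0 a c (m $ i)) (R y0 a c (m $ i)) = \<alpha> (N i) * g y0 (R y0 a c (m $ i)) (R y0 a c (m $ i))" for i
    by (simp add: fibre_form_def eqs N_def riem_skew_self[OF y0])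
  show ?hh
    using F.riem_hh[of a c] pullback_form[of "(a, 0)" "(c, 0)" "(c, 0)" "(a, 0)"] unfolding adapted_lift eqs fib_R p_def by simp
  show ?hv
    using F.riem_hv[of a i b] pullback_form[of "(a, 0)" "v i b" "v i b" "(a, 0)"]
    unfolding v_def adapted_lift eqs p_def N_def by simp
  show "B p (local_curvature B p (v i b) (v j c) (v j c)) (v i b) = 0" if "i \<noteq> j"
    using F.riem_vv_other[OF that, of b c] pullback_form[of "v i b" "v j c" "v j c" "v i b"]
    unfolding v_def adapted_lift eqs p_def N_def by simp
  show "B p (local_curvature B p (v i b) (v i c) (v i c)) (v i b) =
       \<alpha> (N i) * (coeff_A \<alpha> \<beta> (N i) * ((g y0 b (m $ i))\<^sup>2 + (g y0 c (m $ i))\<^sup>2) + coeff_B \<alpha> \<beta> (N i))"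
    if "g y0 b b = 1" "g y0 c c = 1" "g y0 b c = 0"
    using F.riem_vv[of b c i] that pullback_form[of "v i b" "v i c" "v i c" "v i b"]
    unfolding v_def adapted_lift eqs p_def N_def by simp
qed

end

section \<open>Curvature of manifolds in charts\<close>

lemma charts_atD: "c \<in> charts_at A p \<Longrightarrow> c \<in> A" "c \<in> charts_at A p \<Longrightarrow> p \<in> fst c"
  by (simp_all add: charts_at_def)

section \<open>Tangent spaces and vector fields of a smooth atlas\<close>

locale atlas =
  fixes A :: "('a, 'e::euclidean_space) chart set"
  assumes atlas: "smooth_atlas A"
begin

abbreviation "im c \<equiv> snd c ` fst c"
abbreviation "ov c d \<equiv> snd c ` (fst c \<inter> fst d)"
abbreviation tr :: "('a, 'e) chart \<Rightarrow> ('a, 'e) chart \<Rightarrow> 'e \<Rightarrow> 'e" where "tr c d \<equiv> snd d \<circ> chart_inv c"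
abbreviation "J c d p \<equiv> fd (tr c d) (snd c p)"

lemma
  assumes "c \<in> A"
  shows inj_chart: "inj_on (snd c) (fst c)" and open_im: "open (im c)"
  using atlas assms by (auto simp: smooth_atlas_def)

lemma
  assumes "c \<in> A" "d \<in> A"
  shows open_ov: "open (ov c d)" and smooth_tr: "smooth_on (ov c d) (tr c d)"
  using atlas assms by (auto simp: smooth_atlas_def)

lemma chart_inv_snd: "c \<in> A \<Longrightarrow> p \<in> fst c \<Longrightarrow> chart_inv c (snd c p) = p"
  by (simp add: inj_chart)

lemma snd_chart_inv: "y \<in> im c \<Longrightarrow> snd c (chart_inv c y) = y"
  by (rule f_inv_into_f)

lemma chart_inv_in: "y \<in> im c \<Longrightarrow> chart_inv c y \<in> fst c"
  by (rule inv_into_into)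

lemma tr_snd: "c \<in> A \<Longrightarrow> p \<in> fst c \<Longrightarrow> tr c d (snd c p) = snd d p"
  by (simp add: chart_inv_snd)

lemma J_linear: "c \<in> charts_at A p \<Longrightarrow> d \<in> charts_at A p \<Longrightarrow> linear (J c d p)"
  by (rule smooth_on_linear_fd[OF smooth_tr]) (auto simp: charts_at_def)

lemma J_comp:
  assumes c: "c \<in> charts_at A p" and d: "d \<in> charts_at A p" and e: "e \<in> charts_at A p"
  shows "J d e p (J c d p a) = J c e p a"
proof -
  note cA = charts_atD(1)[OF c] and dA = charts_atD(1)[OF d] and eA = charts_atD(1)[OF e]
  note pc = charts_atD(2)[OF c] and pd = charts_atD(2)[OF d] and pe = charts_atD(2)[OF e]
  have eq: "fd (tr c e) (snd c p) = fd (\<lambda>y. tr d e (tr c d y)) (snd c p)"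
  proof (rule fd_cong)
    show "open (ov c d \<inter> ov c e)" using open_ov cA dA eA by blast
    show "snd c p \<in> ov c d \<inter> ov c e" using pc pd pe by blast
    show "tr c e y = tr d e (tr c d y)" if y: "y \<in> ov c d \<inter> ov c e" for y
    proof -
      obtain q where "q \<in> fst c" "q \<in> fst d" "y = snd c q" using y by blast
      then show ?thesis using cA dA by (simp add: chart_inv_snd)
    qed
  qed
  have "fd (\<lambda>y. tr d e (tr c d y)) (snd c p) a = fd (tr d e) (tr c d (snd c p)) (J c d p a)"
    by (rule fd_compose[OF smooth_tr[OF dA eA] smooth_on_differentiable[OF smooth_tr[OF cA dA]]])
      (use cA dA pc pd pe in \<open>auto simp: tr_snd simp del: o_apply\<close>)
  then show ?thesis unfolding eq tr_snd[OF cA pc] by (rule HOL.sym)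
qed

lemma J_id:
  assumes c: "c \<in> charts_at A p"
  shows "J c c p a = a"
proof -
  have "fd (tr c c) (snd c p) = fd (\<lambda>y. y) (snd c p)"
    by (rule fd_cong[OF open_im[OF charts_atD(1)[OF c]]])
      (use charts_atD[OF c] in \<open>auto simp: chart_inv_snd\<close>)
  then show ?thesis by simp
qed

lemma inj_J: "c \<in> charts_at A p \<Longrightarrow> d \<in> charts_at A p \<Longrightarrow> inj (J c d p)"
  by (rule inj_on_inverseI[where g = "J d c p"]) (simp add: J_comp J_id)

lemma coord_vec_apply: "d \<in> charts_at A p \<Longrightarrow> coord_vec A c p a d = J c d p a"
  by (simp add: coord_vec_def)

lemma coord_vec_self: "c \<in> charts_at A p \<Longrightarrow> coord_vec A c p a c = a"
  by (simp add: coord_vec_def J_id)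

lemma coord_vec_tangent: "c \<in> charts_at A p \<Longrightarrow> coord_vec A c p a \<in> tangent_space A p"
  unfolding tangent_space_def by (simp add: coord_vec_def J_comp)

lemma tangent_apply: "v \<in> tangent_space A p \<Longrightarrow> c \<in> charts_at A p \<Longrightarrow> d \<in> charts_at A p \<Longrightarrow> v d = J c d p (v c)"
  unfolding tangent_space_def by blast

lemma tangent_outside: "v \<in> tangent_space A p \<Longrightarrow> c \<notin> charts_at A p \<Longrightarrow> v c = 0"
  unfolding tangent_space_def by blast

lemma tangentI:
  assumes "\<And>c. c \<notin> charts_at A p \<Longrightarrow> v c = 0"
    "\<And>c d. c \<in> charts_at A p \<Longrightarrow> d \<in> charts_at A p \<Longrightarrow> v d = J c d p (v c)"
  shows "v \<in> tangent_space A p"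
  unfolding tangent_space_def using assms by blast

lemma tangent_coord_vec:
  assumes v: "v \<in> tangent_space A p" and c: "c \<in> charts_at A p"
  shows "coord_vec A c p (v c) = v"
proof
  show "coord_vec A c p (v c) d = v d" for d
    using tangent_apply[OF v c, of d] tangent_outside[OF v, of d] by (simp add: coord_vec_def)
qed

lemma tangent_eqI:
  "v \<in> tangent_space A p \<Longrightarrow> w \<in> tangent_space A p \<Longrightarrow> c \<in> charts_at A p \<Longrightarrow> v c = w c \<Longrightarrow> v = w"
  by (metis tangent_coord_vec)

lemma coord_vec_linear:
  assumes c: "c \<in> charts_at A p"
  shows "coord_vec A c p (a + b) = coord_vec A c p a + coord_vec A c p b"
    "coord_vec A c p (r *\<^sub>R a) = r *\<^sub>R coord_vec A c p a"
  using J_linear[OF c] by (auto simp: coord_vec_def fun_eq_iff scaleR_fun_def linear_add linear_cmul)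

lemma subspace_tangent: "subspace (tangent_space A p)"
proof (rule subspaceI)
  show "0 \<in> tangent_space A p"
    by (rule tangentI) (simp_all add: linear_0[OF J_linear])
  show "v + w \<in> tangent_space A p" if v: "v \<in> tangent_space A p" and w: "w \<in> tangent_space A p" for v w
  proof (rule tangentI)
    show "(v + w) c = 0" if "c \<notin> charts_at A p" for c
      by (simp add: tangent_outside[OF v that] tangent_outside[OF w that])
    show "(v + w) d = J c d p ((v + w) c)" if "c \<in> charts_at A p" "d \<in> charts_at A p" for c d
      using tangent_apply[OF v that] tangent_apply[OF w that] by (simp add: linear_add[OF J_linear[OF that]])
  qed
  show "r *\<^sub>R v \<in> tangent_space A p" if v: "v \<in> tangent_space A p" for r v
  proof (rule tangentI)
    show "(r *\<^sub>R v) c = 0" if "c \<notin> charts_at A p" for c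
      by (simp add: scaleR_fun_def tangent_outside[OF v that])
    show "(r *\<^sub>R v) d = J c d p ((r *\<^sub>R v) c)" if "c \<in> charts_at A p" "d \<in> charts_at A p" for c d
      using tangent_apply[OF v that] by (simp add: scaleR_fun_def linear_cmul[OF J_linear[OF that]])
  qed
qed

text \<open>The description of open sets passes through the abstraction function for topologies, so
  the axioms of a topology have to be checked; charts commute with intersections because they are
  injective.\<close>

lemma openin_iff:
  "openin (atlas_topology A) W \<longleftrightarrow> W \<subseteq> points A \<and> (\<forall>c\<in>A. open (snd c ` (W \<inter> fst c)))"
proof -
  have "istopology (\<lambda>W. W \<subseteq> points A \<and> (\<forall>c\<in>A. open (snd c ` (W \<inter> fst c))))"
    unfolding istopology_def
  proof (intro conjI allI impI ballI)
    fix V W c assume V: "V \<subseteq> points A \<and> (\<forall>c\<in>A. open (snd c ` (V \<inter> fst c)))"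
      and W: "W \<subseteq> points A \<and> (\<forall>c\<in>A. open (snd c ` (W \<inter> fst c)))"
    then show "V \<inter> W \<subseteq> points A" by blast
    assume c: "c \<in> A"
    have "snd c ` ((V \<inter> W) \<inter> fst c) = snd c ` (V \<inter> fst c) \<inter> snd c ` (W \<inter> fst c)"
      using inj_on_image_Int[OF inj_chart[OF c], of "V \<inter> fst c" "W \<inter> fst c"]
      by (simp add: Int_ac)
    then show "open (snd c ` ((V \<inter> W) \<inter> fst c))" using V W c by auto
  next
    fix \<W> assume W: "\<forall>W\<in>\<W>. W \<subseteq> points A \<and> (\<forall>c\<in>A. open (snd c ` (W \<inter> fst c)))"
    then show "\<Union>\<W> \<subseteq> points A" by blast
    fix c assume c: "c \<in> A"
    have "snd c ` (\<Union>\<W> \<inter> fst c) = (\<Union>W\<in>\<W>. snd c ` (W \<inter> fst c))" by blast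
    then show "open (snd c ` (\<Union>\<W> \<inter> fst c))" using W c by auto
  qed
  then show ?thesis by (simp add: atlas_topology_def topology_inverse')
qed

text \<open>These fields extend any prescribed tangent vector to a neighbourhood, which gives the
  definite description of \<open>curvature\<close> something to range over.\<close>

lemma coordinate_field:
  assumes c: "c \<in> A"
  shows "openin (atlas_topology A) (fst c)"
    and "smooth_vector_field A (fst c) (\<lambda>q. coord_vec A c q a)"
proof -
  show "openin (atlas_topology A) (fst c)"
    using c open_ov[OF _ c] unfolding openin_iff by (auto simp: points_def Int_commute)
  show "smooth_vector_field A (fst c) (\<lambda>q. coord_vec A c q a)"
    unfolding smooth_vector_field_def
  proof (intro conjI ballI)
    show "coord_vec A c q a \<in> tangent_space A q" if "q \<in> fst c" for q
      using that c by (intro coord_vec_tangent) (simp add: charts_at_def)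
    fix d assume d: "d \<in> A"
    have "smooth_on (ov d c) (\<lambda>y. fd (tr c d) (tr d c y) a)"
    proof (rule smooth_on_compose[OF open_ov[OF d c] open_ov[OF c d] smooth_tr[OF d c] smooth_on_fd[OF smooth_tr[OF c d]]])
      show "tr d c ` ov d c \<subseteq> ov c d" using d by (auto simp: chart_inv_snd)
    qed
    then show "smooth_on (snd d ` (fst c \<inter> fst d)) (\<lambda>y. coord_vec A c (chart_inv d y) a d)"
      unfolding Int_commute[of "fst c"]
      by (rule smooth_on_transform[OF _ open_ov[OF d c]])
        (use c d in \<open>auto simp: chart_inv_snd coord_vec_def charts_at_def\<close>)
  qed
qed

end

section \<open>Connection and curvature of a Riemannian manifold in a chart\<close>

locale riem_manifold = atlas A for A :: "('a, 'e::euclidean_space) chart set" +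
  fixes g :: "('a, 'e) metric"
  assumes metric: "riemannian_metric A g"
begin

abbreviation "mc \<equiv> metric_coeff A g"

lemma charts_at_points: "c \<in> charts_at A p \<Longrightarrow> p \<in> points A"
  by (auto simp: charts_at_def points_def)

lemma points_chart: "p \<in> points A \<Longrightarrow> \<exists>c. c \<in> charts_at A p"
  by (auto simp: charts_at_def points_def)

lemma g_sym: "p \<in> points A \<Longrightarrow> v \<in> tangent_space A p \<Longrightarrow> w \<in> tangent_space A p \<Longrightarrow> g p v w = g p w v"
  using metric by (simp add: riemannian_metric_def sym_bilinear_on_def)

lemma g_linear: "p \<in> points A \<Longrightarrow> v \<in> tangent_space A p \<Longrightarrow> w \<in> tangent_space A p \<Longrightarrow> z \<in> tangent_space A p \<Longrightarrow>
   g p (r *\<^sub>R v + s *\<^sub>R w) z = r * g p v z + s * g p w z"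
  using metric by (simp add: riemannian_metric_def sym_bilinear_on_def)

lemma g_coord:
  assumes "c \<in> charts_at A p" "v \<in> tangent_space A p" "w \<in> tangent_space A p"
  shows "g p v w = mc c (snd c p) (v c) (w c)"
  unfolding metric_coeff_def using assms charts_atD[OF assms(1)]
  by (simp add: chart_inv_snd tangent_coord_vec)

lemma local_metric: "c \<in> A \<Longrightarrow> local_metric (im c) (mc c)"
proof
  assume c: "c \<in> A"
  show "open (im c)" by (rule open_im[OF c])
  have cq: "c \<in> charts_at A (chart_inv c y)" if "y \<in> im c" for y
    using c chart_inv_in[OF that] by (simp add: charts_at_def)
  note T = coord_vec_tangent[OF cq] and P = charts_at_points[OF cq]
  show sym: "mc c y a b = mc c y b a" if "y \<in> im c" for y a b
    unfolding metric_coeff_def by (intro g_sym P T that)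
  have lin: "mc c y (r *\<^sub>R a + s *\<^sub>R a') b = r * mc c y a b + s * mc c y a' b" if "y \<in> im c" for y a a' b r s
    unfolding metric_coeff_def coord_vec_linear[OF cq[OF that]] by (intro g_linear P T that)
  show "bilinear (mc c y)" if y: "y \<in> im c" for y
  proof -
    have l: "mc c y (a + a') b = mc c y a b + mc c y a' b" "mc c y (r *\<^sub>R a) b = r *\<^sub>R mc c y a b" for a a' b r
      using lin[OF y, of 1 a 1 a' b] lin[OF y, of r a 0 0 b] by simp_all
    have "mc c y b (a + a') = mc c y b a + mc c y b a'" "mc c y b (r *\<^sub>R a) = r *\<^sub>R mc c y b a" for a a' b r
      unfolding sym[OF y, of b] by (rule l)+
    with l show ?thesis by (intro bilinearI)
  qed
  show "mc c y a a > 0" if "y \<in> im c" "a \<noteq> 0" for y a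
  proof -
    have "coord_vec A c (chart_inv c y) a \<noteq> 0"
      using coord_vec_self[OF cq[OF that(1)], of a] that(2) by (metis zero_fun_apply)
    then show ?thesis
      using metric T[OF that(1)] P[OF that(1)] by (simp add: riemannian_metric_def metric_coeff_def)
  qed
  show "smooth_on (im c) (\<lambda>y. mc c y a b)" for a b
    using metric c by (simp add: riemannian_metric_def)
qed

text \<open>Transition maps are isometries of the coordinate metrics; the local pullback lemmas
  thereby become transformation laws between charts.\<close>

lemma metric_coeff_pull:
  assumes c: "c \<in> A" and d: "d \<in> A" and y: "y \<in> ov c d"
  shows "mc c y = pullback_form (mc d) (tr c d) y"
proof (intro ext)
  fix a b
  obtain p where p: "p \<in> fst c" "p \<in> fst d" "y = snd c p" using y by blast
  have cd: "c \<in> charts_at A p" "d \<in> charts_at A p" using p c d by (auto simp: charts_at_def)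
  have "coord_vec A d p (J c d p a) = coord_vec A c p a" for a
    by (rule tangent_eqI[OF coord_vec_tangent coord_vec_tangent, of d _ c d])
      (simp_all add: cd coord_vec_apply J_id)
  then show "mc c y a b = pullback_form (mc d) (tr c d) y a b"
    using p c d by (simp add: pullback_form_def metric_coeff_def chart_inv_snd)
qed

lemma metric_pullback:
  assumes c: "c \<in> A" and d: "d \<in> A"
  shows "metric_pullback (im d) (mc d) (ov c d) (tr c d)"
proof (rule metric_pullback.intro[OF local_metric[OF d]], unfold_locales)
  show "open (ov c d)" "smooth_on (ov c d) (tr c d)" using open_ov smooth_tr c d by auto
  show "tr c d z \<in> im d" if "z \<in> ov c d" for z using that c by (auto simp: chart_inv_snd)
  show "inj (fd (tr c d) z)" if "z \<in> ov c d" for z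
    using that c d inj_J[of c _ d] by (auto simp: charts_at_def)
qed

lemma lc_transition:
  assumes c: "c \<in> charts_at A p" and d: "d \<in> charts_at A p"
  shows "J c d p (local_christoffel (mc c) (snd c p) a b) =
    fd (\<lambda>z. fd (tr c d) z b) (snd c p) a + local_christoffel (mc d) (snd d p) (J c d p a) (J c d p b)"
proof -
  note cA = charts_atD(1)[OF c] and dA = charts_atD(1)[OF d] and pc = charts_atD(2)[OF c] and pd = charts_atD(2)[OF d]
  interpret metric_pullback "im d" "mc d" "ov c d" "tr c d" by (rule metric_pullback[OF cA dA])
  have y: "snd c p \<in> ov c d" using pc pd by blast
  have "local_christoffel (mc c) (snd c p) = local_christoffel (pullback_form (mc d) (tr c d)) (snd c p)"
    by (rule lc_cong[OF open_ov[OF cA dA] y metric_coeff_pull[OF cA dA]])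
  then show ?thesis using lc_pull[OF y, of a b] tr_snd[OF cA pc, of d] by (simp add: d2F_def)
qed

lemma riem_transition:
  assumes c: "c \<in> charts_at A p" and d: "d \<in> charts_at A p"
  shows "J c d p (local_curvature (mc c) (snd c p) a b z) = local_curvature (mc d) (snd d p) (J c d p a) (J c d p b) (J c d p z)"
proof -
  note cA = charts_atD(1)[OF c] and dA = charts_atD(1)[OF d] and pc = charts_atD(2)[OF c] and pd = charts_atD(2)[OF d]
  interpret metric_pullback "im d" "mc d" "ov c d" "tr c d" by (rule metric_pullback[OF cA dA])
  have y: "snd c p \<in> ov c d" using pc pd by blast
  have "local_curvature (mc c) (snd c p) = local_curvature (pullback_form (mc d) (tr c d)) (snd c p)"
    by (rule riem_cong[OF open_ov[OF cA dA] y metric_coeff_pull[OF cA dA]])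
  then show ?thesis using riem_pull[OF y, of a b z] tr_snd[OF cA pc, of d] by simp
qed

text \<open>Tensoriality of R. Second derivatives of Z commute, and the terms with first derivatives
  of X and Y are those that the bracket removes, so only values at p remain. The fields are
  controlled on W only, hence the passage to the open set \<open>Om\<close>.\<close>

lemma field_curvature_coord:
  assumes W: "openin (atlas_topology A) W" "p \<in> W" and c: "c \<in> charts_at A p"
    and X: "smooth_vector_field A W X" and Y: "smooth_vector_field A W Y" and Z: "smooth_vector_field A W Z"
  shows "field_curvature A g X Y Z p c = local_curvature (mc c) (snd c p) (X p c) (Y p c) (Z p c)"
proof -
  note cA = charts_atD(1)[OF c] and pc = charts_atD(2)[OF c]
  interpret local_metric "im c" "mc c" by (rule local_metric[OF cA])
  define Om where "Om = snd c ` (W \<inter> fst c)"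
  define y where "y = snd c p"
  have oOm: "open Om" using W(1) cA by (simp add: Om_def openin_iff)
  have yOm: "y \<in> Om" using W(2) pc by (auto simp: Om_def y_def)
  have yS: "y \<in> im c" using pc by (simp add: y_def)
  have OmS: "Om \<subseteq> im c" by (auto simp: Om_def)
  have cq: "c \<in> charts_at A (chart_inv c z)" "snd c (chart_inv c z) = z" if "z \<in> Om" for z
    using that cA chart_inv_in[of z c] OmS snd_chart_inv[of z c] by (auto simp: charts_at_def)
  define loc where "loc V z = V (chart_inv c z) c" for V :: "'a \<Rightarrow> ('a, 'e) tvec" and z
  have loc_p: "V p c = loc V y" for V using pc cA by (simp add: loc_def y_def chart_inv_snd)
  have sm: "smooth_on Om (loc V)" if "smooth_vector_field A W V" for V
    using that cA unfolding smooth_vector_field_def Om_def loc_def[abs_def] by blast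
  have cov: "loc (covariant_derivative A g V U) z = fd (loc U) z (loc V z) + \<Gamma> z (loc V z) (loc U z)" if "z \<in> Om" for U V z
    using cq[OF that] by (simp add: covariant_derivative_def loc_def[abs_def] christoffel_def local_christoffel_def)
  have brk: "loc (lie_bracket A V U) y = fd (loc U) y (loc V y) - fd (loc V) y (loc U y)" for U V
    using cq[OF yOm] by (simp add: lie_bracket_def loc_def[abs_def])
  have D: "fd (loc (covariant_derivative A g V U)) y v =
      (fd (\<lambda>z. fd (loc U) z (loc V y)) y v + fd (loc U) y (fd (loc V) y v))
      + (fd (\<lambda>z. \<Gamma> z (loc V y) (loc U y)) y v + \<Gamma> y (fd (loc V) y v) (loc U y) + \<Gamma> y (loc V y) (fd (loc U) y v))"
    if U: "smooth_vector_field A W U" and V: "smooth_vector_field A W V" for U V v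
  proof -
    note sU = sm[OF U] and sV = sm[OF V]
    have 1: "((\<lambda>z. fd (loc U) z (loc V z)) has_derivative
        (\<lambda>v. fd (\<lambda>z. fd (loc U) z (loc V y)) y v + fd (loc U) y (fd (loc V) y v))) (at y)"
      by (rule has_derivative_linear_family[where L = "fd (loc U)", OF oOm yOm smooth_on_linear_fd[OF sU]
          smooth_on_fd[OF sU] smooth_on_has_derivative[OF sV yOm]])
    have 2: "((\<lambda>z. \<Gamma> z (loc V z) (loc U z)) has_derivative (\<lambda>v. fd (\<lambda>z. \<Gamma> z (loc V y) (loc U y)) y v
        + \<Gamma> y (fd (loc V) y v) (loc U y) + \<Gamma> y (loc V y) (fd (loc U) y v))) (at y)"
      by (rule has_derivative_bilinear_family[where B = \<Gamma>, OF oOm yOm bilinear_lc smooth_on_subset[OF smooth_lc OmS]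
          sV smooth_on_has_derivative[OF sU yOm]]) (use OmS in auto)
    have "fd (loc (covariant_derivative A g V U)) y = fd (\<lambda>z. fd (loc U) z (loc V z) + \<Gamma> z (loc V z) (loc U z)) y"
      by (rule fd_cong[OF oOm yOm cov])
    then show ?thesis using fun_cong[OF fd_unique[OF has_derivative_add[OF 1 2]]] by simp
  qed
  define \<xi> \<eta> \<zeta> where "\<xi> = loc X" and "\<eta> = loc Y" and "\<zeta> = loc Z"
  have S: "fd (\<lambda>z. fd \<zeta> z (\<eta> y)) y (\<xi> y) = fd (\<lambda>z. fd \<zeta> z (\<xi> y)) y (\<eta> y)"
    unfolding \<zeta>_def by (rule smooth_on_fd_fd_commute[OF oOm sm[OF Z] yOm])
  have lin: "linear (fd \<zeta> y)" unfolding \<zeta>_def by (rule smooth_on_linear_fd[OF sm[OF Z] yOm])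
  have "field_curvature A g X Y Z p c = loc (covariant_derivative A g X (covariant_derivative A g Y Z)) y
      - loc (covariant_derivative A g Y (covariant_derivative A g X Z)) y
      - loc (covariant_derivative A g (lie_bracket A X Y) Z) y"
    unfolding field_curvature_def by (simp add: loc_p)
  also have "\<dots> = local_curvature (mc c) y (\<xi> y) (\<eta> y) (\<zeta> y)"
    unfolding cov[OF yOm] brk D[OF Z Y] D[OF Z X] local_curvature_def \<xi>_def[symmetric] \<eta>_def[symmetric] \<zeta>_def[symmetric] S
    by (simp add: lc_simps yS linear_diff[OF lin] lc_sym[OF yS, of "\<xi> y" "fd \<zeta> y (\<eta> y)"])
  finally show ?thesis by (simp add: \<xi>_def \<eta>_def \<zeta>_def loc_p y_def)
qed

text \<open>Tensoriality shows that all extensions give the same value; coordinate fields show that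
  the universally quantified condition is not vacuous, so that it singles out one vector.\<close>

lemma curvature_coord:
  assumes p: "p \<in> points A" and T: "x \<in> tangent_space A p" "y \<in> tangent_space A p" "z \<in> tangent_space A p"
  shows "curvature A g p x y z =
    (\<lambda>c. if c \<in> charts_at A p then local_curvature (mc c) (snd c p) (x c) (y c) (z c) else 0)" (is "_ = ?r")
  unfolding curvature_def
proof (rule the_equality)
  show *: "\<forall>W X Y Z. openin (atlas_topology A) W \<and> p \<in> W \<and>
       smooth_vector_field A W X \<and> smooth_vector_field A W Y \<and> smooth_vector_field A W Z \<and>
       X p = x \<and> Y p = y \<and> Z p = z \<longrightarrow> field_curvature A g X Y Z p = ?r"
  proof (intro allI impI ext)
    fix W X Y Z c
    assume H: "openin (atlas_topology A) W \<and> p \<in> W \<and>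
       smooth_vector_field A W X \<and> smooth_vector_field A W Y \<and> smooth_vector_field A W Z \<and>
       X p = x \<and> Y p = y \<and> Z p = z"
    show "field_curvature A g X Y Z p c = ?r c"
    proof (cases "c \<in> charts_at A p")
      case True
      then show ?thesis using field_curvature_coord[of W p c X Y Z] H by auto
    next
      case False
      then show ?thesis by (simp add: field_curvature_def covariant_derivative_def)
    qed
  qed
  fix r
  assume r: "\<forall>W X Y Z. openin (atlas_topology A) W \<and> p \<in> W \<and>
       smooth_vector_field A W X \<and> smooth_vector_field A W Y \<and> smooth_vector_field A W Z \<and>
       X p = x \<and> Y p = y \<and> Z p = z \<longrightarrow> field_curvature A g X Y Z p = r"
  obtain c where c: "c \<in> charts_at A p" using points_chart[OF p] by blast
  let ?X = "\<lambda>v q. coord_vec A c q (v c)"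
  have H: "openin (atlas_topology A) (fst c) \<and> p \<in> fst c \<and> smooth_vector_field A (fst c) (?X x) \<and>
    smooth_vector_field A (fst c) (?X y) \<and> smooth_vector_field A (fst c) (?X z) \<and> ?X x p = x \<and> ?X y p = y \<and> ?X z p = z"
    using coordinate_field[OF charts_atD(1)[OF c]] charts_atD(2)[OF c] T c by (simp add: tangent_coord_vec)
  show "r = ?r" using r[rule_format, OF H] *[rule_format, OF H] by simp
qed

lemma curvature_apply:
  assumes "c \<in> charts_at A p" "x \<in> tangent_space A p" "y \<in> tangent_space A p" "z \<in> tangent_space A p"
  shows "curvature A g p x y z c = local_curvature (mc c) (snd c p) (x c) (y c) (z c)"
  using assms by (simp add: curvature_coord charts_at_points)

lemma curvature_tangent:
  assumes p: "p \<in> points A" and T: "x \<in> tangent_space A p" "y \<in> tangent_space A p" "z \<in> tangent_space A p"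
  shows "curvature A g p x y z \<in> tangent_space A p"
proof (rule tangentI)
  show "curvature A g p x y z c = 0" if "c \<notin> charts_at A p" for c
    using that by (simp add: curvature_coord[OF assms])
  show "curvature A g p x y z d = J c d p (curvature A g p x y z c)"
    if c: "c \<in> charts_at A p" and d: "d \<in> charts_at A p" for c d
    unfolding curvature_apply[OF c T] curvature_apply[OF d T] riem_transition[OF c d]
    unfolding tangent_apply[OF T(1) c d, symmetric] tangent_apply[OF T(2) c d, symmetric]
      tangent_apply[OF T(3) c d, symmetric] ..
qed

lemma sectional_curvature_coord:
  assumes c: "c \<in> charts_at A p" and T: "x \<in> tangent_space A p" "y \<in> tangent_space A p"
  shows "sectional_curvature A g p x y =
    mc c (snd c p) (local_curvature (mc c) (snd c p) (x c) (y c) (y c)) (x c) /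
     (mc c (snd c p) (x c) (x c) * mc c (snd c p) (y c) (y c) - (mc c (snd c p) (x c) (y c))\<^sup>2)"
  unfolding sectional_curvature_def
  by (simp add: g_coord[OF c] T curvature_tangent[OF charts_at_points[OF c]] curvature_apply[OF c])

end

section \<open>The frame bundle\<close>

lemma open_det_nonzero: "open {m :: real^'n^'n::finite. det m \<noteq> 0}"
  unfolding det_def by (intro open_Collect_neq continuous_intros)

lemma det_nonzero_iff_span:
  fixes m :: "real^'n^'n::finite"
  shows "det m \<noteq> 0 \<longleftrightarrow> span (range (($) m)) = UNIV"
proof -
  have "rows m = range (($) m)" by (auto simp: rows_def row_def)
  then show ?thesis
    using matrix_left_invertible_span_rows[of m] invertible_left_inverse[of m] invertible_det_nz[of m] by simp
qed

lemma det_nonzero_rows: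
  fixes m :: "real^'n^'n::finite"
  assumes "det m \<noteq> 0"
  shows "inj (($) m)" "independent (range (($) m))" "m $ i \<noteq> 0"
proof -
  show "inj (($) m)"
  proof (rule injI, rule ccontr)
    fix i j assume "m $ i = m $ j" "i \<noteq> j"
    then show False using det_identical_rows[of i j m] assms by (simp add: row_def)
  qed
  show ind: "independent (range (($) m))"
  proof (rule card_le_dim_spanning[of _ UNIV])
    show "UNIV \<subseteq> span (range (($) m))" using assms det_nonzero_iff_span by blast
    show "card (range (($) m)) \<le> dim (UNIV :: (real^'n) set)"
      using card_image_le[of UNIV "($) m"] by simp
  qed auto
  show "m $ i \<noteq> 0" using ind dependent_zero[of "range (($) m)"] by (metis rangeI)
qed

lemma sum_fun_apply: "(\<Sum>i\<in>I. f i) x = (\<Sum>i\<in>I. f i x)"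
  by (induction I rule: infinite_finite_induct) auto

lemma linear_apply: "linear (\<lambda>v :: 'a \<Rightarrow> 'b::real_vector. v c)"
  by (rule linearI) (simp_all add: scaleR_fun_def)

section \<open>Curves and their velocities\<close>

context atlas
begin

lemma curve_in_chart:
  assumes c: "c \<in> A" and e: "e > 0" and z: "smooth_on {-e<..<e} z" "z ` {-e<..<e} \<subseteq> im c"
    and \<gamma>: "\<And>t. t \<in> {-e<..<e} \<Longrightarrow> \<gamma> t = chart_inv c (z t)" and d: "d \<in> charts_at A (\<gamma> 0)"
  shows "((\<lambda>t. snd d (\<gamma> t)) has_vector_derivative J c d (\<gamma> 0) (vector_derivative z (at 0))) (at 0)"
proof -
  let ?I = "{-e<..<e}"
  have z0: "z 0 \<in> im c" using z(2) e by auto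
  have g0: "\<gamma> 0 = chart_inv c (z 0)" using \<gamma>[of 0] e by simp
  have c0: "c \<in> charts_at A (\<gamma> 0)" using c chart_inv_in[OF z0] by (simp add: charts_at_def g0)
  have s0: "snd c (\<gamma> 0) = z 0" unfolding g0 by (rule snd_chart_inv[OF z0])
  have zov: "z 0 \<in> ov c d" using charts_atD(2)[OF c0] charts_atD(2)[OF d] s0 by (metis IntI imageI)
  have Dz: "(z has_derivative fd z 0) (at 0)"
    by (rule smooth_on_has_derivative[OF z(1)]) (use e in simp)
  have "((\<lambda>t. tr c d (z t)) has_derivative (\<lambda>h. fd (tr c d) (z 0) (fd z 0 h))) (at 0)"
    by (rule smooth_on_chain[OF smooth_tr[OF c charts_atD(1)[OF d]] Dz zov])
  then have "((\<lambda>t. snd d (\<gamma> t)) has_derivative (\<lambda>h. fd (tr c d) (z 0) (fd z 0 h))) (at 0)"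
    by (rule has_derivative_transform_within_open[of _ _ _ _ ?I]) (use e \<gamma> in auto)
  moreover have "fd (tr c d) (z 0) (fd z 0 h) = h *\<^sub>R J c d (\<gamma> 0) (vector_derivative z (at 0))" for h
  proof -
    have "fd z 0 h = h *\<^sub>R vector_derivative z (at 0)"
      using frechet_derivative_eq_vector_derivative[OF differentiableI[OF Dz]] by (metis (no_types))
    then show ?thesis
      using linear_cmul[OF J_linear[OF c0 d]] s0 by simp
  qed
  ultimately show ?thesis by (simp add: has_vector_derivative_def)
qed

lemma velocity_in_chart:
  assumes "c \<in> A" "e > 0" "smooth_on {-e<..<e} z" "z ` {-e<..<e} \<subseteq> im c"
    "\<And>t. t \<in> {-e<..<e} \<Longrightarrow> \<gamma> t = chart_inv c (z t)"
  shows "velocity A \<gamma> = coord_vec A c (\<gamma> 0) (vector_derivative z (at 0))"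
  unfolding velocity_def coord_vec_def
  using vector_derivative_at[OF curve_in_chart[OF assms]] by auto

lemma smooth_curve_in_chart:
  assumes c: "c \<in> A" and e: "e > 0" and z: "smooth_on {-e<..<e} z" "z ` {-e<..<e} \<subseteq> im c"
    and \<gamma>: "\<And>t. t \<in> {-e<..<e} \<Longrightarrow> \<gamma> t = chart_inv c (z t)"
  shows "smooth_curve A \<gamma>"
  unfolding smooth_curve_def
proof (intro exI[of _ e] conjI ballI e)
  let ?I = "{-e<..<e}"
  have in_c: "\<gamma> t \<in> fst c" "snd c (\<gamma> t) = z t" if "t \<in> ?I" for t
  proof -
    have "z t \<in> im c" using that z(2) by blast
    then show "\<gamma> t \<in> fst c" "snd c (\<gamma> t) = z t"
      unfolding \<gamma>[OF that] by (rule chart_inv_in, rule snd_chart_inv)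
  qed
  show "\<gamma> ` ?I \<subseteq> points A"
  proof (rule image_subsetI)
    show "\<gamma> t \<in> points A" if "t \<in> ?I" for t
      unfolding points_def using c in_c(1)[OF that] by blast
  qed
  fix d assume d: "d \<in> A"
  have iff: "z t \<in> ov c d \<longleftrightarrow> \<gamma> t \<in> fst d" if t: "t \<in> ?I" for t
  proof
    assume "\<gamma> t \<in> fst d"
    then show "z t \<in> ov c d" unfolding in_c(2)[OF t, symmetric] by (intro imageI IntI in_c(1)[OF t])
  next
    assume "z t \<in> ov c d"
    then obtain q where q: "q \<in> fst c" "q \<in> fst d" "snd c q = snd c (\<gamma> t)" unfolding in_c(2)[OF t] by auto
    show "\<gamma> t \<in> fst d" using inj_onD[OF inj_chart[OF c] q(3) q(1) in_c(1)[OF t]] q(2) by simp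
  qed
  have eq: "{t \<in> ?I. \<gamma> t \<in> fst d} = ?I \<inter> z -` ov c d"
    by (rule set_eqI) (use iff in \<open>simp del: greaterThanLessThan_iff image_iff cong: conj_cong\<close>)
  have "continuous_on ?I z" by (rule smooth_on_continuous[OF z(1)])
  then show op: "open {t \<in> ?I. \<gamma> t \<in> fst d}"
    unfolding eq by (rule continuous_open_preimage) (use open_ov[OF c d] in auto)
  have "smooth_on {t \<in> ?I. \<gamma> t \<in> fst d} (\<lambda>t. tr c d (z t))"
    by (rule smooth_on_compose[OF op open_ov[OF c d] smooth_on_subset[OF z(1)] smooth_tr[OF c d]])
      (unfold eq, auto)
  then show "smooth_on {t \<in> ?I. \<gamma> t \<in> fst d} (\<lambda>t. snd d (\<gamma> t))"
    by (rule smooth_on_transform[OF _ op]) (use \<gamma> in auto)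
qed

lemma smooth_curve_derivative:
  assumes "smooth_curve A \<gamma>" "c \<in> charts_at A (\<gamma> 0)"
  shows "((\<lambda>t. snd c (\<gamma> t)) has_vector_derivative velocity A \<gamma> c) (at 0)"
proof -
  obtain e where e: "e > 0" and *: "\<And>c. c \<in> A \<Longrightarrow> smooth_on {t \<in> {-e<..<e}. \<gamma> t \<in> fst c} (\<lambda>t. snd c (\<gamma> t))"
    using assms(1) unfolding smooth_curve_def by blast
  have "(\<lambda>t. snd c (\<gamma> t)) differentiable (at 0)"
    by (rule smooth_on_differentiable[OF *[OF charts_atD(1)[OF assms(2)]]]) (use e charts_atD(2)[OF assms(2)] in simp)
  then show ?thesis using assms(2) by (simp add: velocity_def vector_derivative_works)
qed

end

lemma has_vector_derivative_line: "((\<lambda>t. w + t *\<^sub>R v) has_vector_derivative v) (at t)"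
proof -
  have "((\<lambda>t. w + t *\<^sub>R v) has_derivative (\<lambda>h. 0 + h *\<^sub>R v)) (at t)"
    by (intro has_derivative_add has_derivative_const has_derivative_scaleR_left has_derivative_ident)
  then show ?thesis by (simp add: has_vector_derivative_def)
qed

lemma smooth_on_line: "open T \<Longrightarrow> smooth_on T (\<lambda>t. w + t *\<^sub>R v)"
  by (intro smooth_on_add smooth_on_scaleR smooth_on_const smooth_on_ident)


section \<open>Charts and vertical lifts of the frame bundle\<close>

locale frame_bundle_atlas = atlas A for A :: "('a, real^'n::finite) chart set"
begin

abbreviation "fc \<equiv> frame_chart A"
abbreviation "FA \<equiv> frame_atlas A"
definition coords :: "('a, real^'n) chart \<Rightarrow> ('n \<Rightarrow> ('a, real^'n) tvec) \<Rightarrow> real^'n^'n"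
  where "coords c u = (\<chi> i. u i c)"

lemma frame_chart_simps: "fst (fc c) = {(x, u) \<in> frames A. x \<in> fst c}" "snd (fc c) (x, u) = (snd c x, coords c u)"
  by (simp_all add: frame_chart_def coords_def)

lemma coords_nth [simp]: "coords c u $ i = u i c"
  by (simp add: coords_def)

text \<open>Evaluation in a chart is linear and maps the tangent space onto the model space, so a
  spanning family becomes the rows of an invertible matrix.\<close>

lemma frames_coords:
  assumes u: "(x, u) \<in> frames A" and c: "c \<in> charts_at A x"
  shows "det (coords c u) \<noteq> 0" "u i \<in> tangent_space A x"
proof -
  have sp: "span (range u) = tangent_space A x" using u by (simp add: frames_def)
  show "u i \<in> tangent_space A x" unfolding sp[symmetric] by (rule span_base) simp
  have "span (range (($) (coords c u))) = span ((\<lambda>v. v c) ` range u)"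
    by (simp add: image_image)
  also have "\<dots> = (\<lambda>v. v c) ` tangent_space A x"
    unfolding linear_span_image[OF linear_apply] sp ..
  also have "\<dots> = UNIV"
    using coord_vec_tangent[OF c] coord_vec_self[OF c] by (metis UNIV_eq_I image_eqI)
  finally show "det (coords c u) \<noteq> 0" by (simp add: det_nonzero_iff_span)
qed

lemma coords_frames:
  assumes c: "c \<in> charts_at A x" and m: "det m \<noteq> 0"
  shows "(x, \<lambda>i. coord_vec A c x (m $ i)) \<in> frames A"
proof -
  let ?f = "coord_vec A c x"
  have lin: "linear ?f" by (rule linearI) (rule coord_vec_linear[OF c])+
  have inj: "inj ?f" using coord_vec_self[OF c] by (metis injI)
  have eq: "range (\<lambda>i. ?f (m $ i)) = ?f ` range (($) m)" by auto
  have "span (range (\<lambda>i. ?f (m $ i))) = ?f ` UNIV"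
    unfolding eq linear_span_image[OF lin] using m det_nonzero_iff_span by metis
  also have "\<dots> = tangent_space A x"
    using coord_vec_tangent[OF c] tangent_coord_vec[OF _ c] by (auto simp: image_iff) metis
  finally have "span (range (\<lambda>i. ?f (m $ i))) = tangent_space A x" .
  moreover have "independent (range (\<lambda>i. ?f (m $ i)))"
    unfolding eq
    by (rule linear_independent_injective_image[OF lin det_nonzero_rows(2)[OF m]]) (rule inj_on_subset[OF inj], simp)
  moreover have "inj (\<lambda>i. ?f (m $ i))"
    using inj_compose[OF inj det_nonzero_rows(1)[OF m]] by (simp add: comp_def)
  moreover have "x \<in> points A" using c by (auto simp: charts_at_def points_def)
  ultimately show ?thesis by (simp add: frames_def)
qed

lemma frame_image:
  assumes c: "c \<in> A"
  shows "snd (fc c) ` (fst (fc c) \<inter> fst (fc d)) = ov c d \<times> {m. det m \<noteq> 0}"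
proof (intro equalityI subsetI)
  fix r assume "r \<in> snd (fc c) ` (fst (fc c) \<inter> fst (fc d))"
  then obtain x u where "(x, u) \<in> frames A" "x \<in> fst c" "x \<in> fst d" "r = (snd c x, coords c u)"
    by (auto simp: frame_chart_simps)
  then show "r \<in> ov c d \<times> {m. det m \<noteq> 0}"
    using frames_coords(1)[of x u c] c by (auto simp: charts_at_def)
next
  fix r assume "r \<in> ov c d \<times> {m :: real^'n^'n. det m \<noteq> 0}"
  then obtain x m where x: "x \<in> fst c" "x \<in> fst d" and m: "det m \<noteq> 0" and r: "r = (snd c x, m)" by auto
  have cx: "c \<in> charts_at A x" using c x by (simp add: charts_at_def)
  have "(x, \<lambda>i. coord_vec A c x (m $ i)) \<in> fst (fc c) \<inter> fst (fc d)"
    using coords_frames[OF cx m] x by (simp add: frame_chart_simps)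
  moreover have "snd (fc c) (x, \<lambda>i. coord_vec A c x (m $ i)) = r"
    by (simp add: frame_chart_simps r vec_eq_iff coord_vec_self[OF cx])
  ultimately show "r \<in> snd (fc c) ` (fst (fc c) \<inter> fst (fc d))" by blast
qed

lemma inj_frame_chart: "c \<in> A \<Longrightarrow> inj_on (snd (fc c)) (fst (fc c))"
proof (rule inj_onI)
  fix p q assume c: "c \<in> A" and p: "p \<in> fst (fc c)" and q: "q \<in> fst (fc c)" and eq: "snd (fc c) p = snd (fc c) q"
  obtain x u y w where pq: "p = (x, u)" "q = (y, w)" by fastforce
  have xy: "(x, u) \<in> frames A" "x \<in> fst c" "(y, w) \<in> frames A" "y \<in> fst c"
    using p q pq by (auto simp: frame_chart_simps)
  have "x = y" using eq xy inj_onD[OF inj_chart[OF c], of x y] by (simp add: pq frame_chart_simps)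
  moreover have "u i = w i" for i
  proof (rule tangent_eqI)
    show cx: "c \<in> charts_at A x" using c xy by (simp add: charts_at_def)
    show "u i \<in> tangent_space A x" by (rule frames_coords(2)[OF xy(1) cx])
    show "w i \<in> tangent_space A x" using frames_coords(2)[OF xy(3)] cx \<open>x = y\<close> by simp
    show "u i c = w i c" using eq by (simp add: pq frame_chart_simps vec_eq_iff)
  qed
  ultimately show "p = q" by (simp add: pq fun_eq_iff)
qed

lemma frame_chart_inv:
  assumes c: "c \<in> A" and y: "y \<in> im c" and m: "det m \<noteq> 0"
  shows "chart_inv (fc c) (y, m) = (chart_inv c y, \<lambda>i. coord_vec A c (chart_inv c y) (m $ i))"
proof -
  have cx: "c \<in> charts_at A (chart_inv c y)" using c chart_inv_in[OF y] by (simp add: charts_at_def)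
  show ?thesis
  proof (rule inv_into_f_eq[OF inj_frame_chart[OF c]])
    show "(chart_inv c y, \<lambda>i. coord_vec A c (chart_inv c y) (m $ i)) \<in> fst (fc c)"
      using coords_frames[OF cx m] charts_atD(2)[OF cx] by (simp add: frame_chart_simps)
    show "snd (fc c) (chart_inv c y, \<lambda>i. coord_vec A c (chart_inv c y) (m $ i)) = (y, m)"
      by (simp add: frame_chart_simps snd_chart_inv[OF y] vec_eq_iff coord_vec_self[OF cx])
  qed
qed

text \<open>This reduces the frame bundle to the calculus of \<open>frame_map\<close>: both the
  smoothness of its atlas and the Jacobians of its charts are read off from base
  transitions.\<close>

lemma frame_transition:
  assumes c: "c \<in> A" and d: "d \<in> A" and r: "r \<in> ov c d \<times> {m. det m \<noteq> 0}"
  shows "(snd (fc d) \<circ> chart_inv (fc c)) r = frame_map (tr c d) r"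
proof -
  obtain x m where x: "x \<in> fst c" "x \<in> fst d" and m: "det m \<noteq> 0" and r: "r = (snd c x, m)" using r by auto
  have xd: "d \<in> charts_at A x" using d x by (simp add: charts_at_def)
  have "chart_inv (fc c) r = (x, \<lambda>i. coord_vec A c x (m $ i))"
    unfolding r using frame_chart_inv[OF c _ m, of "snd c x"] x c by (simp add: chart_inv_snd)
  then show ?thesis
    using x c by (simp add: frame_chart_simps frame_map_def r chart_inv_snd vec_eq_iff coord_vec_apply[OF xd])
qed

sublocale FA: atlas FA
proof
  have o: "open (ov c d \<times> {m :: real^'n^'n. det m \<noteq> 0})" if "c \<in> A" "d \<in> A" for c d
    using open_ov[OF that] open_det_nonzero by (rule open_Times)
  have "smooth_on (ov c d \<times> {m. det m \<noteq> 0}) (snd (fc d) \<circ> chart_inv (fc c))" if cd: "c \<in> A" "d \<in> A" for c d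
  proof (rule smooth_on_transform[OF _ o[OF cd] frame_transition[OF cd]])
    show "smooth_on (ov c d \<times> {m. det m \<noteq> 0}) (frame_map (tr c d))"
      by (rule smooth_on_subset[OF smooth_frame_map[OF open_ov[OF cd] smooth_tr[OF cd]]]) auto
  qed
  moreover have "snd (fc c) ` fst (fc c) = ov c c \<times> {m. det m \<noteq> 0}" if "c \<in> A" for c
    using frame_image[OF that, of c] by simp
  ultimately show "smooth_atlas FA"
    unfolding smooth_atlas_def frame_atlas_def
    using o[of c c for c] by (simp add: inj_frame_chart frame_image o)
qed

lemma fc_in: "c \<in> A \<Longrightarrow> fc c \<in> FA"
  by (simp add: frame_atlas_def)

lemma frame_im: "c \<in> A \<Longrightarrow> snd (fc c) ` fst (fc c) = im c \<times> {m. det m \<noteq> 0}"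
  using frame_image[of c c] by simp

lemma charts_at_frame: "(x, u) \<in> frames A \<Longrightarrow> charts_at FA (x, u) = fc ` charts_at A x"
  by (auto simp: charts_at_def frame_atlas_def frame_chart_simps)

lemma fc_charts_at: "(x, u) \<in> frames A \<Longrightarrow> c \<in> charts_at A x \<Longrightarrow> fc c \<in> charts_at FA (x, u)"
  by (simp add: charts_at_frame)

lemma points_frame: "points FA = frames A"
  by (fastforce simp: points_def frame_atlas_def frame_chart_simps frames_def)

lemma frame_J:
  assumes u: "(x, u) \<in> frames A" and c: "c \<in> charts_at A x" and d: "d \<in> charts_at A x"
  shows "FA.J (fc c) (fc d) (x, u) V = (J c d x (fst V),
     \<chi> i. fd (\<lambda>z. fd (tr c d) z (u i c)) (snd c x) (fst V) + J c d x (snd V $ i))"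
proof -
  note cA = charts_atD(1)[OF c] and dA = charts_atD(1)[OF d]
  have x: "snd c x \<in> ov c d" using charts_atD(2)[OF c] charts_atD(2)[OF d] by blast
  have "FA.J (fc c) (fc d) (x, u) = fd (frame_map (tr c d)) (snd (fc c) (x, u))"
  proof (rule fd_cong)
    show "open (ov c d \<times> {m :: real^'n^'n. det m \<noteq> 0})"
      by (rule open_Times[OF open_ov[OF cA dA] open_det_nonzero])
    show "snd (fc c) (x, u) \<in> ov c d \<times> {m. det m \<noteq> 0}"
      using x frames_coords(1)[OF u c] by (simp add: frame_chart_simps)
  qed (rule frame_transition[OF cA dA])
  then show ?thesis
    using fd_frame_map[OF open_ov[OF cA dA] smooth_tr[OF cA dA], of "snd (fc c) (x, u)" V] x
    by (simp add: frame_chart_simps)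
qed

lemma vertical_lift_apply:
  assumes u: "(x, u) \<in> frames A" and c: "c \<in> charts_at A x"
  shows "vertical_lift A (x, u) i X (fc c) = (0, axis i (X c))"
proof -
  let ?\<gamma> = "\<lambda>t. (x, u(i := u i + t *\<^sub>R X))"
  have g0: "?\<gamma> 0 = (x, u)" by auto
  have "snd (fc c) (?\<gamma> t) = (snd c x, coords c u) + t *\<^sub>R (0, axis i (X c))" for t
    by (simp add: frame_chart_simps vec_eq_iff axis_def scaleR_fun_def)
  then have "vector_derivative (\<lambda>t. snd (fc c) (?\<gamma> t)) (at 0) = (0, axis i (X c))"
    using vector_derivative_at[OF has_vector_derivative_line[of "(snd c x, coords c u)" "(0, axis i (X c))" 0]] by simp
  then show ?thesis
    unfolding vertical_lift_def velocity_def using fc_charts_at[OF u c] g0 by simp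
qed

lemma vertical_lift_tangent:
  assumes u: "(x, u) \<in> frames A" and X: "X \<in> tangent_space A x"
  shows "vertical_lift A (x, u) i X \<in> tangent_space FA (x, u)"
proof (rule FA.tangentI)
  fix C D
  show "vertical_lift A (x, u) i X C = 0" if "C \<notin> charts_at FA (x, u)"
    using that by (simp add: vertical_lift_def velocity_def)
  assume "C \<in> charts_at FA (x, u)" "D \<in> charts_at FA (x, u)"
  then obtain c d where c: "c \<in> charts_at A x" and d: "d \<in> charts_at A x" and CD: "C = fc c" "D = fc d"
    unfolding charts_at_frame[OF u] by blast
  have "fd (\<lambda>z. fd (tr c d) z b) (snd c x) 0 = 0" for b
    using charts_atD[OF c] charts_atD[OF d]
    by (intro linear_0 smooth_on_linear_fd[OF smooth_on_fd[OF smooth_tr]]) auto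
  then show "vertical_lift A (x, u) i X D = FA.J C D (x, u) (vertical_lift A (x, u) i X C)"
    unfolding CD vertical_lift_apply[OF u c] vertical_lift_apply[OF u d] frame_J[OF u c d]
    using tangent_apply[OF X c d] by (simp add: vec_eq_iff axis_def linear_0[OF J_linear[OF c d]])
qed

end

section \<open>Horizontal lifts in a chart\<close>

locale frame_bundle = riem_manifold A g + frame_bundle_atlas A
  for A :: "('a, real^'n::finite) chart set" and g :: "('a, real^'n) metric" +
  fixes \<alpha> \<beta> :: "real \<Rightarrow> real"
  assumes smooth_\<alpha>: "smooth_on {0<..} \<alpha>" and smooth_\<beta>: "smooth_on {0<..} \<beta>"
    and \<alpha>_pos: "t > 0 \<Longrightarrow> \<alpha> t > 0" and \<alpha>\<beta>_pos: "t > 0 \<Longrightarrow> \<alpha> t + t * \<beta> t > 0"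
begin

definition hl :: "('a, real^'n) chart \<Rightarrow> 'a \<Rightarrow> ('n \<Rightarrow> ('a, real^'n) tvec) \<Rightarrow> real^'n \<Rightarrow> (real^'n) \<times> (real^'n^'n)"
  where "hl c x u a = (a, \<chi> i. - local_christoffel (mc c) (snd c x) a (u i c))"

lemma christoffel_lc: "christoffel A g c x = local_christoffel (mc c) (snd c x)"
  by (simp add: christoffel_def local_christoffel_def)

definition horizontal_curve :: "'a \<Rightarrow> ('n \<Rightarrow> ('a, real^'n) tvec) \<Rightarrow> ('a, real^'n) tvec \<Rightarrow> (real \<Rightarrow> ('a, 'n) frame) \<Rightarrow> bool"
  where "horizontal_curve x u X \<gamma> \<longleftrightarrow> smooth_curve FA \<gamma> \<and> \<gamma> 0 = (x, u) \<and> velocity A (fst \<circ> \<gamma>) = X \<and>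
    (\<forall>i. covariant_derivative_along A g (fst \<circ> \<gamma>) (\<lambda>t. snd (\<gamma> t) i) = 0)"

lemma frame_curve_components:
  assumes "((\<lambda>t. snd (fc c) (\<gamma> t)) has_vector_derivative V) (at 0)"
  shows "((\<lambda>t. snd c ((fst \<circ> \<gamma>) t)) has_vector_derivative fst V) (at 0)"
    "((\<lambda>t. snd (\<gamma> t) i c) has_vector_derivative snd V $ i) (at 0)"
proof -
  have eq: "snd (fc c) p = (snd c (fst p), coords c (snd p))" for p
    using frame_chart_simps(2)[of c "fst p" "snd p"] by simp
  have "((\<lambda>t. fst (snd (fc c) (\<gamma> t))) has_vector_derivative fst V) (at 0)"
    using bounded_linear.has_vector_derivative[OF bounded_linear_fst assms] .
  then show "((\<lambda>t. snd c ((fst \<circ> \<gamma>) t)) has_vector_derivative fst V) (at 0)" by (simp add: eq)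
  have "((\<lambda>t. snd (snd (fc c) (\<gamma> t)) $ i) has_vector_derivative snd V $ i) (at 0)"
    using bounded_linear.has_vector_derivative[OF bounded_linear_vec_nth
        bounded_linear.has_vector_derivative[OF bounded_linear_snd assms]] .
  then show "((\<lambda>t. snd (\<gamma> t) i c) has_vector_derivative snd V $ i) (at 0)" by (simp add: eq)
qed

text \<open>Vanishing of the covariant derivatives at time 0 can be solved for the fibre velocity.
  All horizontal curves over X thus share one velocity, the uniqueness half of
  \<open>horizontal_lift\<close>.\<close>

lemma horizontal_curve_velocity:
  assumes u: "(x, u) \<in> frames A" and \<gamma>: "horizontal_curve x u X \<gamma>" and c: "c \<in> charts_at A x"
  shows "velocity FA \<gamma> (fc c) = hl c x u (X c)"
proof -
  let ?V = "velocity FA \<gamma> (fc c)"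
  have g0: "\<gamma> 0 = (x, u)" and sc: "smooth_curve FA \<gamma>" and vel: "velocity A (fst \<circ> \<gamma>) = X"
    and cov: "covariant_derivative_along A g (fst \<circ> \<gamma>) (\<lambda>t. snd (\<gamma> t) i) = 0" for i
    using \<gamma> by (auto simp: horizontal_curve_def)
  have D: "((\<lambda>t. snd (fc c) (\<gamma> t)) has_vector_derivative ?V) (at 0)"
    by (rule FA.smooth_curve_derivative[OF sc]) (simp add: g0 fc_charts_at[OF u c])
  note D' = frame_curve_components[OF D]
  have 1: "fst ?V = X c"
    using fun_cong[OF vel, of c] vector_derivative_at[OF D'(1)] c by (simp add: velocity_def g0)
  have "snd ?V $ i + local_christoffel (mc c) (snd c x) (X c) (u i c) = 0" for i
    using fun_cong[OF cov[of i], of c] vector_derivative_at[OF D'(2)[of i]] c vel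
    by (simp add: covariant_derivative_along_def g0 christoffel_lc)
  then have "snd ?V $ i = - local_christoffel (mc c) (snd c x) (X c) (u i c)" for i
    by (simp add: eq_neg_iff_add_eq_0)
  with 1 show ?thesis by (simp add: hl_def prod_eq_iff vec_eq_iff)
qed

text \<open>Horizontality constrains only first derivatives at time 0, so a straight line in one
  chart serves as witness and no parallel transport equation has to be solved.\<close>

lemma horizontal_curve_exists:
  assumes u: "(x, u) \<in> frames A" and X: "X \<in> tangent_space A x" and c: "c \<in> charts_at A x"
  shows "\<exists>\<gamma>. horizontal_curve x u X \<gamma> \<and> velocity FA \<gamma> = coord_vec FA (fc c) (x, u) (hl c x u (X c))"
proof -
  note cA = charts_atD(1)[OF c] and xc = charts_atD(2)[OF c]
  let ?v = "hl c x u (X c)"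
  define z where "z t = (snd c x, coords c u) + t *\<^sub>R ?v" for t :: real
  let ?\<Omega> = "im c \<times> {m :: real^'n^'n. det m \<noteq> 0}"
  have o\<Omega>: "open ?\<Omega>" by (rule open_Times[OF open_im[OF cA] open_det_nonzero])
  have z0: "z 0 = (snd c x, coords c u)" by (simp add: z_def)
  have z0\<Omega>: "z 0 \<in> ?\<Omega>" using xc frames_coords(1)[OF u c] by (simp add: z0)
  have Dz: "(z has_vector_derivative ?v) (at t)" for t
    unfolding z_def[abs_def] by (rule has_vector_derivative_line)
  have "isCont z 0" using has_vector_derivative_continuous[OF Dz] .
  then obtain e where e: "e > 0" "\<And>t. t \<in> {-e<..<e} \<Longrightarrow> z t \<in> ?\<Omega>"
  proof -
    have "\<forall>\<^sub>F t in at 0. z t \<in> ?\<Omega>"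
      using topological_tendstoD[OF isContD[OF \<open>isCont z 0\<close>] o\<Omega> z0\<Omega>] .
    then obtain d where d: "d > 0" "\<And>t. t \<noteq> 0 \<Longrightarrow> dist t 0 < d \<Longrightarrow> z t \<in> ?\<Omega>"
      unfolding eventually_at by auto
    have "z t \<in> ?\<Omega>" if "t \<in> {-d<..<d}" for t
      using d(2)[of t] z0\<Omega> that by (cases "t = 0") auto
    then show thesis using d(1) that by blast
  qed
  define \<gamma> where "\<gamma> t = chart_inv (fc c) (z t)" for t
  have g0: "\<gamma> 0 = (x, u)"
    using FA.chart_inv_snd[OF fc_in[OF cA], of "(x, u)"] u xc by (simp add: \<gamma>_def z0 frame_chart_simps)
  have smz: "smooth_on {-e<..<e} z"
    unfolding z_def[abs_def] by (rule smooth_on_line) simp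
  have imz: "z ` {-e<..<e} \<subseteq> snd (fc c) ` fst (fc c)"
    unfolding frame_im[OF cA] using e(2) by blast
  have vz: "vector_derivative z (at 0) = ?v" by (rule vector_derivative_at[OF Dz])
  note curve = fc_in[OF cA] e(1) smz imz \<gamma>_def
  have sc: "smooth_curve FA \<gamma>" by (rule FA.smooth_curve_in_chart[OF curve])
  have vel: "velocity FA \<gamma> = coord_vec FA (fc c) (x, u) ?v"
    using FA.velocity_in_chart[OF curve] by (simp add: g0 vz)
  have base: "(fst \<circ> \<gamma>) t = chart_inv c (fst (z t))" if "t \<in> {-e<..<e}" for t
    using frame_chart_inv[OF cA, of "fst (z t)" "snd (z t)"] e(2)[OF that] by (auto simp: \<gamma>_def mem_Times_iff)
  have Dfz: "vector_derivative (\<lambda>t. fst (z t)) (at 0) = X c"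
    using vector_derivative_at[OF bounded_linear.has_vector_derivative[OF bounded_linear_fst Dz]] by (simp add: hl_def)
  have velb: "velocity A (fst \<circ> \<gamma>) = X"
  proof -
    have "velocity A (fst \<circ> \<gamma>) = coord_vec A c ((fst \<circ> \<gamma>) 0) (vector_derivative (\<lambda>t. fst (z t)) (at 0))"
    proof (rule velocity_in_chart[OF cA e(1) _ _ base])
      show "smooth_on {-e<..<e} (\<lambda>t. fst (z t))" by (rule smooth_on_fst_comp[OF _ smz]) simp
      show "(\<lambda>t. fst (z t)) ` {-e<..<e} \<subseteq> im c"
        using e(2) by (auto simp: mem_Times_iff simp del: greaterThanLessThan_iff)
    qed
    then show ?thesis by (simp add: Dfz g0 tangent_coord_vec[OF X c])
  qed
  have "covariant_derivative_along A g (fst \<circ> \<gamma>) (\<lambda>t. snd (\<gamma> t) i) d = 0" for i d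
  proof (cases "d \<in> charts_at A x")
    case False
    then show ?thesis by (simp add: covariant_derivative_along_def g0)
  next
    case d: True
    \<comment> \<open>The condition must hold in every chart. The second-derivative term of the
      frame Jacobian is the one in \<open>lc_transition\<close>, so the equation in c implies the
      one in d.\<close>
    have "((\<lambda>t. snd (fc d) (\<gamma> t)) has_vector_derivative FA.J (fc c) (fc d) (x, u) ?v) (at 0)"
      using FA.curve_in_chart[OF curve, of "fc d"] fc_charts_at[OF u d] by (simp add: g0 vz)
    from vector_derivative_at[OF frame_curve_components(2)[OF this, of i]]
    have "vector_derivative (\<lambda>t. snd (\<gamma> t) i d) (at 0) =
       fd (\<lambda>z. fd (tr c d) z (u i c)) (snd c x) (X c) + J c d x (- local_christoffel (mc c) (snd c x) (X c) (u i c))"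
      unfolding frame_J[OF u c d] by (simp add: hl_def)
    also have "\<dots> = - local_christoffel (mc d) (snd d x) (X d) (u i d)"
      using lc_transition[OF c d, of "X c" "u i c"] tangent_apply[OF X c d] tangent_apply[OF frames_coords(2)[OF u c, of i] c d]
      by (simp add: linear_neg[OF J_linear[OF c d]])
    finally show ?thesis
      using d by (simp add: covariant_derivative_along_def g0 velb christoffel_lc)
  qed
  then have "covariant_derivative_along A g (fst \<circ> \<gamma>) (\<lambda>t. snd (\<gamma> t) i) = 0" for i
    by (simp add: fun_eq_iff)
  then have "horizontal_curve x u X \<gamma>"
    using sc g0 velb by (simp add: horizontal_curve_def)
  then show ?thesis using vel by blast
qed

lemma
  assumes u: "(x, u) \<in> frames A" and X: "X \<in> tangent_space A x"
  shows horizontal_lift_apply: "c \<in> charts_at A x \<Longrightarrow> horizontal_lift A g (x, u) X (fc c) = hl c x u (X c)"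
    and horizontal_lift_tangent: "horizontal_lift A g (x, u) X \<in> tangent_space FA (x, u)"
proof -
  have "x \<in> points A" using u by (simp add: frames_def)
  then obtain c where c: "c \<in> charts_at A x" using points_chart by blast
  obtain \<gamma> where \<gamma>: "horizontal_curve x u X \<gamma>" "velocity FA \<gamma> = coord_vec FA (fc c) (x, u) (hl c x u (X c))"
    using horizontal_curve_exists[OF u X c] by blast
  have outside: "velocity FA \<delta> C = 0" if "horizontal_curve x u X \<delta>" "C \<notin> charts_at FA (x, u)" for C \<delta>
    using that by (simp add: velocity_def horizontal_curve_def)
  have uniq: "velocity FA \<delta> = velocity FA \<gamma>" if \<delta>: "horizontal_curve x u X \<delta>" for \<delta>
  proof
    fix C show "velocity FA \<delta> C = velocity FA \<gamma> C"
    proof (cases "C \<in> charts_at FA (x, u)")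
      case True
      then obtain d where "d \<in> charts_at A x" "C = fc d" unfolding charts_at_frame[OF u] by blast
      then show ?thesis
        using horizontal_curve_velocity[OF u \<delta>, of d] horizontal_curve_velocity[OF u \<gamma>(1), of d] by simp
    next
      case False
      then show ?thesis using outside[OF \<delta>] outside[OF \<gamma>(1)] by simp
    qed
  qed
  have eq: "horizontal_lift A g (x, u) X = velocity FA \<gamma>"
    unfolding horizontal_lift_def
  proof (rule the_equality)
    show "\<exists>\<delta>. smooth_curve FA \<delta> \<and> \<delta> 0 = (x, u) \<and> velocity FA \<delta> = velocity FA \<gamma> \<and> velocity A (fst \<circ> \<delta>) = X \<and>
       (\<forall>i. covariant_derivative_along A g (fst \<circ> \<delta>) (\<lambda>t. snd (\<delta> t) i) = 0)"
      using \<gamma>(1) unfolding horizontal_curve_def by blast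
    fix V assume "\<exists>\<delta>. smooth_curve FA \<delta> \<and> \<delta> 0 = (x, u) \<and> velocity FA \<delta> = V \<and> velocity A (fst \<circ> \<delta>) = X \<and>
       (\<forall>i. covariant_derivative_along A g (fst \<circ> \<delta>) (\<lambda>t. snd (\<delta> t) i) = 0)"
    then show "V = velocity FA \<gamma>" using uniq unfolding horizontal_curve_def by blast
  qed
  show "horizontal_lift A g (x, u) X (fc d) = hl d x u (X d)" if "d \<in> charts_at A x" for d
    unfolding eq by (rule horizontal_curve_velocity[OF u \<gamma>(1) that])
  show "horizontal_lift A g (x, u) X \<in> tangent_space FA (x, u)"
    unfolding eq \<gamma>(2) by (rule FA.coord_vec_tangent[OF fc_charts_at[OF u c]])
qed

end

text \<open>Linearity is given in the first argument and on T only. One argument at a time is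
  therefore extended from the generators to their span, with symmetry exchanging the two.\<close>

lemma sym_bilinear_on_agree:
  assumes b: "sym_bilinear_on T b" "sym_bilinear_on T b'" and T: "subspace T" "B \<subseteq> T" "T \<subseteq> span B"
    and eq: "\<And>v w. v \<in> B \<Longrightarrow> w \<in> B \<Longrightarrow> b v w = b' v w" and vw: "v \<in> T" "w \<in> T"
  shows "b v w = b' v w"
proof -
  have sub: "subspace {v \<in> T. b v w = b' v w}" if w: "w \<in> T" for w
  proof -
    have lin: "f (r *\<^sub>R v + s *\<^sub>R z) w = r * f v w + s * f z w" if "sym_bilinear_on T f" "v \<in> T" "z \<in> T" for f r v s z
      using that w by (simp add: sym_bilinear_on_def)
    show ?thesis
    proof (rule subspaceI)
      show "0 \<in> {v \<in> T. b v w = b' v w}"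
        using lin[OF b(1) w w, of 0 0] lin[OF b(2) w w, of 0 0] subspace_0[OF T(1)] by simp
      show "x + y \<in> {v \<in> T. b v w = b' v w}" if "x \<in> {v \<in> T. b v w = b' v w}" "y \<in> {v \<in> T. b v w = b' v w}" for x y
        using that lin[OF b(1), of x y 1 1] lin[OF b(2), of x y 1 1] subspace_add[OF T(1), of x y] by simp
      show "c *\<^sub>R x \<in> {v \<in> T. b v w = b' v w}" if "x \<in> {v \<in> T. b v w = b' v w}" for c x
        using that lin[OF b(1), of x x c 0] lin[OF b(2), of x x c 0] subspace_scale[OF T(1), of x c] by simp
    qed
  qed
  have comm: "b v w = b w v" "b' v w = b' w v" if "v \<in> T" "w \<in> T" for v w
    using b that by (simp_all add: sym_bilinear_on_def)
  have 1: "b v w = b' v w" if "v \<in> T" "w \<in> B" for v w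
  proof -
    have "B \<subseteq> {v \<in> T. b v w = b' v w}" using T(2) eq that(2) by blast
    from span_minimal[OF this sub] show ?thesis using that T(2,3) by blast
  qed
  have "B \<subseteq> {z \<in> T. b z v = b' z v}"
    using T(2) 1[OF vw(1)] comm[OF vw(1)] by (auto simp: subset_iff)
  from span_minimal[OF this sub[OF vw(1)]] have "b w v = b' w v" using vw T(3) by blast
  then show ?thesis using comm[OF vw] by simp
qed

section \<open>The frame metric in a chart\<close>

context frame_bundle
begin

abbreviation "hor \<equiv> horizontal_lift A g"
abbreviation "ver \<equiv> vertical_lift A"
abbreviation "fm \<equiv> frame_metric A g \<alpha> \<beta>"

lemma frame_local: "c \<in> A \<Longrightarrow> frame_local (im c) (mc c) \<alpha> \<beta>"
  by (intro frame_local.intro local_metric frame_local_axioms.intro smooth_\<alpha> smooth_\<beta> \<alpha>_pos \<alpha>\<beta>_pos)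

lemma frame_points: "(x, u) \<in> frames A \<Longrightarrow> x \<in> points A"
  by (simp add: frames_def)

lemma frame_point_Q:
  assumes c: "c \<in> A" and r: "r \<in> snd (fc c) ` fst (fc c)"
  shows "r \<in> frame_local.Q (im c)"
  using r det_nonzero_rows(3) unfolding frame_im[OF c] frame_local.Q_def[OF frame_local[OF c]] by auto

lemma vpart_hl: "vertical_part (mc c) (snd c x, coords c u) (hl c x u a) i = 0"
  by (simp add: vertical_part_def hl_def)

lemma vpart_vertical:
  assumes c: "c \<in> charts_at A x"
  shows "vertical_part (mc c) (snd c x, coords c u) (0, axis j b) i = axis j b $ i"
proof -
  interpret local_metric "im c" "mc c" by (rule local_metric[OF charts_atD(1)[OF c]])
  show ?thesis using charts_atD(2)[OF c] by (simp add: vertical_part_def lc_simps)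
qed

text \<open>The candidate for the definite description in \<open>frame_metric\<close>, with the
  value 0 outside the tangent space that the description requires.\<close>

definition chart_form :: "('a, real^'n) chart \<Rightarrow> ('a, 'n) frame \<Rightarrow> ('a, 'n) frame_tvec \<Rightarrow> ('a, 'n) frame_tvec \<Rightarrow> real"
  where "chart_form c p V W = (if V \<in> tangent_space FA p \<and> W \<in> tangent_space FA p
     then frame_form (mc c) \<alpha> \<beta> (snd (fc c) p) (V (fc c)) (W (fc c)) else 0)"

lemma chart_form_bilinear:
  assumes u: "(x, u) \<in> frames A" and c: "c \<in> charts_at A x"
  shows "sym_bilinear_on (tangent_space FA (x, u)) (chart_form c (x, u))"
proof -
  note cA = charts_atD(1)[OF c]
  interpret L: frame_local "im c" "mc c" \<alpha> \<beta> by (rule frame_local[OF cA])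
  interpret B: local_metric L.Q "frame_form (mc c) \<alpha> \<beta>" by (rule L.frame_metric_local)
  have Q: "snd (fc c) (x, u) \<in> L.Q"
    by (rule frame_point_Q[OF cA]) (use u charts_atD(2)[OF c] in \<open>auto simp: frame_chart_simps(1)\<close>)
  note sub = FA.subspace_tangent[of "(x, u)"]
  show ?thesis
    unfolding sym_bilinear_on_def
  proof (intro conjI ballI allI)
    fix V W assume VW: "V \<in> tangent_space FA (x, u)" "W \<in> tangent_space FA (x, u)"
    show "chart_form c (x, u) V W = chart_form c (x, u) W V"
      unfolding chart_form_def by (simp add: VW B.sym[OF Q, of "V (fc c)"])
    fix Z r s assume Z: "Z \<in> tangent_space FA (x, u)"
    have "r *\<^sub>R V + s *\<^sub>R W \<in> tangent_space FA (x, u)"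
      by (intro subspace_add subspace_scale sub VW)
    then show "chart_form c (x, u) (r *\<^sub>R V + s *\<^sub>R W) Z = r * chart_form c (x, u) V Z + s * chart_form c (x, u) W Z"
      by (simp add: chart_form_def VW Z scaleR_fun_def B.G_simps Q)
  qed
qed

lemma chart_form_lifts:
  assumes u: "(x, u) \<in> frames A" and c: "c \<in> charts_at A x"
    and X: "X \<in> tangent_space A x" and Y: "Y \<in> tangent_space A x"
  shows "chart_form c (x, u) (hor (x, u) X) (hor (x, u) Y) = g x X Y"
    "chart_form c (x, u) (hor (x, u) X) (ver (x, u) i Y) = 0"
    "i \<noteq> j \<Longrightarrow> chart_form c (x, u) (ver (x, u) i X) (ver (x, u) j Y) = 0"
    "chart_form c (x, u) (ver (x, u) i X) (ver (x, u) i Y) =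
       \<alpha> (g x (u i) (u i)) * g x X Y + \<beta> (g x (u i) (u i)) * g x X (u i) * g x Y (u i)"
proof -
  note cA = charts_atD(1)[OF c]
  interpret L: frame_local "im c" "mc c" \<alpha> \<beta> by (rule frame_local[OF cA])
  have y: "snd c x \<in> im c" using charts_atD(2)[OF c] by simp
  note T = horizontal_lift_tangent[OF u] vertical_lift_tangent[OF u]
  note ap = horizontal_lift_apply[OF u _ c] vertical_lift_apply[OF u c] frame_chart_simps(2)
    vpart_hl vpart_vertical[OF c]
  note z = L.H_simps[OF y] L.G_simps[OF y]
  show "chart_form c (x, u) (hor (x, u) X) (hor (x, u) Y) = g x X Y"
    by (simp add: chart_form_def T X Y ap frame_form_def z g_coord[OF c] hl_def[of _ _ _ "_ c", THEN arg_cong[of _ _ fst]])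
  show "chart_form c (x, u) (hor (x, u) X) (ver (x, u) i Y) = 0"
    by (simp add: chart_form_def T X Y ap frame_form_def z)
  have single: "(\<Sum>k\<in>UNIV. L.H (snd c x) (u k c) (axis i (X c) $ k) (axis j (Y c) $ k)) =
    L.H (snd c x) (u i c) (X c) (axis j (Y c) $ i)" for i j
    by (subst sum_single[of i]) (simp_all add: axis_def z)
  show "chart_form c (x, u) (ver (x, u) i X) (ver (x, u) j Y) = 0" if "i \<noteq> j"
    by (simp add: chart_form_def T X Y ap frame_form_def z single) (use that in \<open>simp add: axis_def z\<close>)
  show "chart_form c (x, u) (ver (x, u) i X) (ver (x, u) i Y) =
       \<alpha> (g x (u i) (u i)) * g x X Y + \<beta> (g x (u i) (u i)) * g x X (u i) * g x Y (u i)"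
    by (simp add: chart_form_def T X Y ap frame_form_def z single)
      (simp add: fibre_form_def g_coord[OF c] X Y frames_coords(2)[OF u c])
qed

lemma lifts_span:
  assumes u: "(x, u) \<in> frames A"
  defines "B \<equiv> hor (x, u) ` tangent_space A x \<union> (\<Union>i. ver (x, u) i ` tangent_space A x)"
  shows "B \<subseteq> tangent_space FA (x, u)" "tangent_space FA (x, u) \<subseteq> span B"
proof -
  show "B \<subseteq> tangent_space FA (x, u)"
    unfolding B_def using horizontal_lift_tangent[OF u] vertical_lift_tangent[OF u] by blast
  obtain c where c: "c \<in> charts_at A x" using points_chart[OF frame_points[OF u]] by blast
  show "tangent_space FA (x, u) \<subseteq> span B"
  proof
    fix V assume V: "V \<in> tangent_space FA (x, u)"
    \<comment> \<open>X is the base velocity of V and the \<open>Y i\<close> are its vertical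
      components. A horizontal lift has no vertical component, so the lifts of X and of the
      \<open>Y i\<close> add up to V in the chart c.\<close>
    define X where "X = coord_vec A c x (fst (V (fc c)))"
    define Y where "Y i = coord_vec A c x (vertical_part (mc c) (snd c x, coords c u) (V (fc c)) i)" for i
    have XY: "X \<in> tangent_space A x" "Y i \<in> tangent_space A x" for i
      unfolding X_def Y_def by (rule coord_vec_tangent[OF c])+
    have XYc: "X c = fst (V (fc c))" "Y i c = vertical_part (mc c) (snd c x, coords c u) (V (fc c)) i" for i
      unfolding X_def Y_def by (rule coord_vec_self[OF c])+
    let ?W = "hor (x, u) X + (\<Sum>i\<in>UNIV. ver (x, u) i (Y i))"
    have W: "?W \<in> span B"
      using XY by (intro span_add span_sum span_base) (auto simp: B_def)
    have "?W \<in> tangent_space FA (x, u)"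
      by (intro subspace_add subspace_sum FA.subspace_tangent horizontal_lift_tangent[OF u] vertical_lift_tangent[OF u] XY)
    moreover have "?W (fc c) = V (fc c)"
    proof -
      have "(\<Sum>i\<in>UNIV. axis i (Y i c)) $ j = Y j c" for j
        unfolding sum_component by (subst sum_single[of j]) (simp_all add: axis_def)
      moreover have "(\<Sum>i\<in>UNIV. ver (x, u) i (Y i)) (fc c) = (0, \<Sum>i\<in>UNIV. axis i (Y i c))"
        unfolding sum_fun_apply vertical_lift_apply[OF u c] by (simp add: prod_eq_iff fst_sum snd_sum)
      ultimately show ?thesis
        unfolding plus_fun_apply horizontal_lift_apply[OF u XY(1) c]
        by (simp add: prod_eq_iff vec_eq_iff hl_def XYc vertical_part_def)
    qed
    ultimately have "?W = V" by (rule FA.tangent_eqI[OF _ V fc_charts_at[OF u c]])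
    with W show "V \<in> span B" by simp
  qed
qed

text \<open>The chart form takes the prescribed values on lifts, and lifts span the tangent space,
  so no other symmetric bilinear form does. In particular the chart form is the same for all charts
  around x.\<close>

lemma frame_metric_chart:
  assumes u: "(x, u) \<in> frames A" and c: "c \<in> charts_at A x"
  shows "fm (x, u) = chart_form c (x, u)"
  unfolding frame_metric_def Let_def fst_conv snd_conv
proof (rule the_equality, goal_cases)
  case 1
  then show ?case
    using chart_form_bilinear[OF u c] chart_form_lifts[OF u c] by (auto simp: chart_form_def[of _ _ "_ :: ('a, 'n) frame_tvec"])
next
  case (2 b)
  note b = conjunct1[OF 2] and out = conjunct1[OF conjunct2[OF 2]]
    and L = bspec[OF bspec[OF conjunct2[OF conjunct2[OF 2]]]]
  have lifts: "b (hor (x, u) X) (hor (x, u) Y) = g x X Y" "b (hor (x, u) X) (ver (x, u) i Y) = 0"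
      "i \<noteq> j \<Longrightarrow> b (ver (x, u) i X) (ver (x, u) j Y) = 0"
      "b (ver (x, u) i X) (ver (x, u) i Y) =
        \<alpha> (g x (u i) (u i)) * g x X Y + \<beta> (g x (u i) (u i)) * g x X (u i) * g x Y (u i)"
    if "X \<in> tangent_space A x" "Y \<in> tangent_space A x" for X Y i j
    using L[OF that] by simp_all
  note f = chart_form_bilinear[OF u c]
  have comm: "f V W = f W V" if "sym_bilinear_on (tangent_space FA (x, u)) f" "V \<in> tangent_space FA (x, u)" "W \<in> tangent_space FA (x, u)" for f V W
    using that by (simp add: sym_bilinear_on_def)
  note hT = horizontal_lift_tangent[OF u] and vT = vertical_lift_tangent[OF u]
  have agree: "b V W = chart_form c (x, u) V W"
    if "V \<in> hor (x, u) ` tangent_space A x \<union> (\<Union>i. ver (x, u) i ` tangent_space A x)"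
       "W \<in> hor (x, u) ` tangent_space A x \<union> (\<Union>i. ver (x, u) i ` tangent_space A x)" for V W
  proof -
    \<comment> \<open>The description prescribes mixed products with the horizontal lift first; the
      other order follows by symmetry.\<close>
    have vh: "b (ver (x, u) i X) (hor (x, u) Y) = chart_form c (x, u) (ver (x, u) i X) (hor (x, u) Y)"
      if "X \<in> tangent_space A x" "Y \<in> tangent_space A x" for X Y i
      using comm[OF b vT[OF that(1), of i] hT[OF that(2)]] comm[OF f vT[OF that(1), of i] hT[OF that(2)]]
        lifts(2)[OF that(2,1), of i] chart_form_lifts(2)[OF u c that(2,1), of i] by simp
    have vv: "b (ver (x, u) i X) (ver (x, u) j Y) = chart_form c (x, u) (ver (x, u) i X) (ver (x, u) j Y)"
      if "X \<in> tangent_space A x" "Y \<in> tangent_space A x" for X Y i j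
      using lifts(3)[OF that, of i j] lifts(4)[OF that, of i] chart_form_lifts(3)[OF u c that, of i j]
        chart_form_lifts(4)[OF u c that, of i] by (cases "i = j") simp_all
    show ?thesis
      using that vh vv lifts(1,2) chart_form_lifts(1,2)[OF u c] by auto
  qed
  show ?case
  proof (intro ext)
    fix V W
    show "b V W = chart_form c (x, u) V W"
    proof (cases "V \<in> tangent_space FA (x, u) \<and> W \<in> tangent_space FA (x, u)")
      case True
      then show ?thesis
        using sym_bilinear_on_agree[OF b f FA.subspace_tangent lifts_span[OF u] agree] by blast
    next
      case False
      then show ?thesis using out by (auto simp: chart_form_def)
    qed
  qed
qed

lemma frame_metric_coeff:
  assumes c: "c \<in> A" and r: "r \<in> snd (fc c) ` fst (fc c)"
  shows "metric_coeff FA fm (fc c) r = frame_form (mc c) \<alpha> \<beta> r"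
proof (intro ext)
  fix V W
  obtain x u where xu: "chart_inv (fc c) r = (x, u)" by fastforce
  have in_c: "(x, u) \<in> fst (fc c)" using FA.chart_inv_in[OF r] xu by simp
  then have u: "(x, u) \<in> frames A" and cx: "c \<in> charts_at A x"
    using c by (auto simp: frame_chart_simps charts_at_def)
  note C = fc_charts_at[OF u cx]
  show "metric_coeff FA fm (fc c) r V W = frame_form (mc c) \<alpha> \<beta> r V W"
    using FA.snd_chart_inv[OF r]
    by (simp add: metric_coeff_def xu frame_metric_chart[OF u cx] chart_form_def FA.coord_vec_tangent[OF C] FA.coord_vec_self[OF C])
qed

sublocale FB: riem_manifold FA fm
proof
  have form: "sym_bilinear_on (tangent_space FA p) (fm p) \<and> (\<forall>v\<in>tangent_space FA p. v \<noteq> 0 \<longrightarrow> fm p v v > 0)"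
    if p: "p \<in> points FA" for p
  proof -
    obtain x u where xu: "p = (x, u)" by fastforce
    have u: "(x, u) \<in> frames A" using p xu by (simp add: points_frame)
    obtain c where c: "c \<in> charts_at A x" using points_chart[OF frame_points[OF u]] by blast
    note cA = charts_atD(1)[OF c]
    interpret L: frame_local "im c" "mc c" \<alpha> \<beta> by (rule frame_local[OF cA])
    have Q: "snd (fc c) (x, u) \<in> L.Q"
      by (rule frame_point_Q[OF cA]) (use u charts_atD(2)[OF c] in \<open>auto simp: frame_chart_simps(1)\<close>)
    have "fm p v v > 0" if v: "v \<in> tangent_space FA p" "v \<noteq> 0" for v
    proof -
      have "v (fc c) \<noteq> 0"
      proof
        assume "v (fc c) = 0"
        then have "v = 0"
          using FA.tangent_eqI[OF v(1) subspace_0[OF FA.subspace_tangent]] fc_charts_at[OF u c] by (simp add: xu)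
        with v(2) show False by simp
      qed
      then show ?thesis
        using v local_metric.pos[OF L.frame_metric_local Q] by (simp add: xu frame_metric_chart[OF u c] chart_form_def)
    qed
    then show ?thesis using chart_form_bilinear[OF u c] by (simp add: xu frame_metric_chart[OF u c])
  qed
  have "smooth_on (snd C ` fst C) (\<lambda>r. metric_coeff FA fm C r V W)" if C: "C \<in> FA" for C V W
  proof -
    obtain c where c: "c \<in> A" "C = fc c" using C by (auto simp: frame_atlas_def)
    interpret L: frame_local "im c" "mc c" \<alpha> \<beta> by (rule frame_local[OF c(1)])
    have "smooth_on (snd (fc c) ` fst (fc c)) (\<lambda>r. frame_form (mc c) \<alpha> \<beta> r V W)"
      by (rule smooth_on_subset[OF L.smooth_B]) (use frame_point_Q[OF c(1)] in blast)
    then show ?thesis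
      unfolding c(2) by (rule smooth_on_transform[OF _ FA.open_im[OF fc_in[OF c(1)]]]) (simp add: frame_metric_coeff[OF c(1)])
  qed
  then show "riemannian_metric FA fm" using form by (simp add: riemannian_metric_def)
qed

end

section \<open>Sectional curvatures\<close>

context riem_manifold
begin

text \<open>The hypothesis speaks of independent pairs, while polarisation needs all pairs. Where
  the Gram determinant vanishes, a is a multiple of b or b = 0, and both sides are zero.\<close>

lemma constant_curvature_tensor:
  assumes K: "constant_sectional_curvature A g \<kappa>" and p: "p \<in> points A"
    and T: "X \<in> tangent_space A p" "Y \<in> tangent_space A p" "Z \<in> tangent_space A p"
  shows "curvature A g p X Y Z = (\<kappa> * g p Y Z) *\<^sub>R X - (\<kappa> * g p X Z) *\<^sub>R Y"
proof -
  obtain c where c: "c \<in> charts_at A p" using points_chart[OF p] by blast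
  interpret L: local_metric "im c" "mc c" by (rule local_metric[OF charts_atD(1)[OF c]])
  let ?y = "snd c p" and ?v = "coord_vec A c p"
  have y: "?y \<in> im c" using charts_atD(2)[OF c] by simp
  have "mc c ?y (L.R ?y a b b) a = \<kappa> * (mc c ?y a a * mc c ?y b b - (mc c ?y a b)\<^sup>2)" for a b
  proof (cases "mc c ?y a a * mc c ?y b b - (mc c ?y a b)\<^sup>2 = 0")
    case False
    have "a \<noteq> r *\<^sub>R b" for r
      using False by (auto simp: L.G_simps[OF y] power2_eq_square)
    moreover have "b \<noteq> 0" using False by (auto simp: L.G_simps[OF y])
    moreover have "?v a = r *\<^sub>R ?v b \<Longrightarrow> a = r *\<^sub>R b" for r
      using coord_vec_self[OF c] coord_vec_linear(2)[OF c, of r b] by metis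
    moreover have "?v b = 0 \<Longrightarrow> b = 0"
      using coord_vec_self[OF c, of b] by simp
    ultimately have "?v a \<noteq> ?v b" "independent {?v a, ?v b}"
      using \<open>\<And>r. a \<noteq> r *\<^sub>R b\<close>[of 1]
      by (auto simp: independent_insert span_singleton coord_vec_self[OF c] dest: arg_cong[of "?v a" _ "\<lambda>v. v c"])
    then have "sectional_curvature A g p (?v a) (?v b) = \<kappa>"
      using K p coord_vec_tangent[OF c] unfolding constant_sectional_curvature_def by blast
    then show ?thesis
      using False by (simp add: sectional_curvature_coord[OF c] coord_vec_tangent[OF c] coord_vec_self[OF c] field_simps)
  next
    case True
    have "b = 0 \<or> (\<exists>r. a = r *\<^sub>R b)"
    proof (cases "b = 0")
      case False
      then have b: "mc c ?y b b > 0" by (rule L.pos[OF y])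
      \<comment> \<open>The component of a orthogonal to b, scaled by |b|^2; its squared length is
        |b|^2 times the Gram determinant, so it vanishes here.\<close>
      let ?w = "mc c ?y b b *\<^sub>R a - mc c ?y a b *\<^sub>R b"
      have "mc c ?y ?w ?w = mc c ?y b b * (mc c ?y a a * mc c ?y b b - (mc c ?y a b)\<^sup>2)"
        by (simp add: L.G_simps[OF y] L.sym[OF y, of b a] power2_eq_square algebra_simps)
      then have "?w = 0" using True L.pos[OF y, of ?w] by (cases "?w = 0") auto
      then have "a = (mc c ?y a b / mc c ?y b b) *\<^sub>R b"
        using b by (metis (no_types) divideR_right eq_iff_diff_eq_0 less_irrefl scaleR_scaleR divide_inverse_commute)
      then show ?thesis by blast
    qed simp
    moreover have "L.R ?y (r *\<^sub>R b) b b = 0" for r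
      using L.riem_linear(4)[OF y, of r b b b] by (simp add: local_curvature_def)
    moreover have "L.R ?y a 0 0 = 0"
      using L.riem_linear(6)[OF y, of a 0 0 0] by simp
    ultimately have "L.R ?y a b b = 0" by auto
    then show ?thesis using True by (simp add: L.G_simps[OF y])
  qed
  note R = L.riem_constant_curvature[OF y this]
  show ?thesis
  proof (rule tangent_eqI[OF curvature_tangent[OF p T] _ c])
    show "(\<kappa> * g p Y Z) *\<^sub>R X - (\<kappa> * g p X Z) *\<^sub>R Y \<in> tangent_space A p"
      by (intro subspace_diff subspace_scale subspace_tangent T)
    show "curvature A g p X Y Z c = ((\<kappa> * g p Y Z) *\<^sub>R X - (\<kappa> * g p X Z) *\<^sub>R Y) c"
      unfolding curvature_apply[OF c T] R
      by (simp add: g_coord[OF c] T scaleR_fun_def scaleR_diff_right fun_diff_def)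
  qed
qed

end

section \<open>Sectional curvatures of the frame bundle\<close>

context frame_bundle
begin

text \<open>The numerator moves to a chart, where the local computation applies; the area in the
  denominator stays invariant, since the prescription on lifts evaluates it directly.\<close>

lemma frame_sectional_curvature:
  assumes u: "(x, u) \<in> frames A" and c: "c \<in> charts_at A x"
    and VW: "V \<in> tangent_space FA (x, u)" "W \<in> tangent_space FA (x, u)"
  shows "sectional_curvature FA fm (x, u) V W =
    frame_form (mc c) \<alpha> \<beta> (snd c x, coords c u) (local_curvature (frame_form (mc c) \<alpha> \<beta>) (snd c x, coords c u) (V (fc c)) (W (fc c)) (W (fc c))) (V (fc c))
     / (fm (x, u) V V * fm (x, u) W W - (fm (x, u) V W)\<^sup>2)"
proof -
  note cA = charts_atD(1)[OF c] and C = fc_charts_at[OF u c]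
  have r: "snd (fc c) (x, u) \<in> snd (fc c) ` fst (fc c)"
    using FA.atlas C charts_atD(2)[OF C] by blast
  have "local_curvature (metric_coeff FA fm (fc c)) (snd (fc c) (x, u)) = local_curvature (frame_form (mc c) \<alpha> \<beta>) (snd (fc c) (x, u))"
    by (rule riem_cong[OF FA.open_im[OF fc_in[OF cA]] r frame_metric_coeff[OF cA]])
  then show ?thesis
    unfolding FB.sectional_curvature_coord[OF C VW] FB.g_coord[OF C VW(1) VW(1)] FB.g_coord[OF C VW(2) VW(2)] FB.g_coord[OF C VW]
    by (simp add: frame_metric_coeff[OF cA r[unfolded frame_chart_simps(2)]] frame_chart_simps(2))
qed

lemma frame_point:
  assumes u: "(x, u) \<in> frames A" and c: "c \<in> charts_at A x"
  shows "frame_point (im c) (mc c) \<alpha> \<beta> (snd c x) (coords c u)"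
  by (rule frame_point.intro[OF frame_local[OF charts_atD(1)[OF c]]], unfold_locales)
    (use charts_atD(2)[OF c] det_nonzero_rows(3)[OF frames_coords(1)[OF u c]] in auto)

lemma frame_norm_pos:
  assumes u: "(x, u) \<in> frames A"
  shows "g x (u i) (u i) > 0"
proof -
  obtain c where c: "c \<in> charts_at A x" using points_chart[OF frame_points[OF u]] by blast
  interpret P: frame_point "im c" "mc c" \<alpha> \<beta> "snd c x" "coords c u" by (rule frame_point[OF u c])
  show ?thesis using P.pos[OF P.y0 P.m_nz, of i] frames_coords(2)[OF u c, of i] by (simp add: g_coord[OF c])
qed

lemma frame_sectional_curvatures:
  assumes u: "(x, u) \<in> frames A" and X: "X \<in> tangent_space A x" and Y: "Y \<in> tangent_space A x"
    and on: "g x X X = 1" "g x Y Y = 1" "g x X Y = 0"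
  defines "K' \<equiv> sectional_curvature FA fm (x, u)" and "R \<equiv> curvature A g x" and "N \<equiv> \<lambda>i. g x (u i) (u i)"
  shows "K' (hor (x, u) X) (hor (x, u) Y) = sectional_curvature A g x X Y
      - 3/4 * (\<Sum>k\<in>UNIV. \<alpha> (N k) * g x (R X Y (u k)) (R X Y (u k)))" (is ?hh)
    and "K' (hor (x, u) X) (ver (x, u) i Y) = (\<alpha> (N i))\<^sup>2 / (4 * (\<alpha> (N i) + \<beta> (N i) * (g x Y (u i))\<^sup>2)) *
      g x (R (u i) Y X) (R (u i) Y X)" (is ?hv)
    and "K' (ver (x, u) i X) (ver (x, u) i Y) =
      (coeff_A \<alpha> \<beta> (N i) * ((g x X (u i))\<^sup>2 + (g x Y (u i))\<^sup>2) + coeff_B \<alpha> \<beta> (N i)) /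
      (\<alpha> (N i) + \<beta> (N i) * ((g x X (u i))\<^sup>2 + (g x Y (u i))\<^sup>2))" (is ?vv)
    and "i \<noteq> j \<Longrightarrow> K' (ver (x, u) i X) (ver (x, u) j Y) = 0"
proof -
  obtain c where c: "c \<in> charts_at A x" using points_chart[OF frame_points[OF u]] by blast
  interpret P: frame_point "im c" "mc c" \<alpha> \<beta> "snd c x" "coords c u" by (rule frame_point[OF u c])
  note F = P.frame_curvatures[unfolded coords_nth]
  note uT = frames_coords(2)[OF u c]
  note hT = horizontal_lift_tangent[OF u] and vT = vertical_lift_tangent[OF u]
  note K' = frame_sectional_curvature[OF u c, folded K'_def]
  have hl: "hor (x, u) X (fc c) = P.hlift (X c)" if "X \<in> tangent_space A x" for X
    unfolding horizontal_lift_apply[OF u that c] by (simp add: hl_def P.hlift_def)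
  note lifts = hl vertical_lift_apply[OF u c]
  note forms = chart_form_lifts[OF u c, folded frame_metric_chart[OF u c]]
  have RT: "R X Y Z \<in> tangent_space A x" "R X Y Z c = P.R (snd c x) (X c) (Y c) (Z c)"
    if "X \<in> tangent_space A x" "Y \<in> tangent_space A x" "Z \<in> tangent_space A x" for X Y Z
    unfolding R_def using curvature_tangent[OF frame_points[OF u] that] curvature_apply[OF c that] by auto
  have Nc: "N i = mc c (snd c x) (u i c) (u i c)" for i
    by (simp add: N_def g_coord[OF c] uT)
  have RR: "g x (R X Y Z) (R X Y Z) = mc c (snd c x) (P.R (snd c x) (X c) (Y c) (Z c)) (P.R (snd c x) (X c) (Y c) (Z c))"
    if "X \<in> tangent_space A x" "Y \<in> tangent_space A x" "Z \<in> tangent_space A x" for X Y Z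
    by (simp add: g_coord[OF c] RT that)
  show ?hh
    unfolding K'[OF hT[OF X] hT[OF Y]] lifts(1)[OF X] lifts(1)[OF Y] F(1) forms(1)[OF X X] forms(1)[OF Y Y] forms(1)[OF X Y]
      RR[OF X Y uT] Nc sectional_curvature_coord[OF c X Y]
    using on by (simp add: g_coord[OF c] X Y)
  show ?hv
    unfolding K'[OF hT[OF X] vT[OF Y]] lifts(1)[OF X] lifts(2) F(2) forms(1)[OF X X] forms(4)[OF Y Y] forms(2)[OF X Y]
      RR[OF uT Y X] Nc[symmetric]
    using on by (simp add: N_def power2_eq_square)
  show "K' (ver (x, u) i X) (ver (x, u) j Y) = 0" if "i \<noteq> j"
    unfolding K'[OF vT[OF X] vT[OF Y]] lifts(2) F(3)[OF that] by simp
  have oc: "mc c (snd c x) (X c) (X c) = 1" "mc c (snd c x) (Y c) (Y c) = 1" "mc c (snd c x) (X c) (Y c) = 0"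
    using on by (simp_all add: g_coord[OF c] X Y)
  have "\<alpha> (N i) > 0" unfolding N_def by (rule \<alpha>_pos[OF frame_norm_pos[OF u]])
  \<comment> \<open>The Gram determinant of the two vertical lifts: the \<beta>^2 terms cancel and a
    factor \<alpha> splits off, which cancels the \<alpha> in the numerator from
    \<open>riem_vv\<close>.\<close>
  then have canc: "\<alpha> (N i) * a / ((\<alpha> (N i) + \<beta> (N i) * s * s) * (\<alpha> (N i) + \<beta> (N i) * t * t) - (\<beta> (N i) * s * t)\<^sup>2) =
      a / (\<alpha> (N i) + \<beta> (N i) * (s\<^sup>2 + t\<^sup>2))" for a s t
  proof -
    have "(\<alpha> (N i) + \<beta> (N i) * s * s) * (\<alpha> (N i) + \<beta> (N i) * t * t) - (\<beta> (N i) * s * t)\<^sup>2 =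
        \<alpha> (N i) * (\<alpha> (N i) + \<beta> (N i) * (s\<^sup>2 + t\<^sup>2))"
      by (simp add: power2_eq_square algebra_simps)
    then show ?thesis using \<open>\<alpha> (N i) > 0\<close> by simp
  qed
  show ?vv
    unfolding K'[OF vT[OF X] vT[OF Y]] lifts(2) F(4)[OF oc] forms(4)[OF X X] forms(4)[OF Y Y] forms(4)[OF X Y]
    using on canc by (simp add: N_def g_coord[OF c, symmetric] X Y uT)
qed

end

theorem corollary3p5:
  fixes A :: "('a, real^'n::finite) chart set"
    and g :: "('a, real^'n) metric"
    and \<alpha> \<beta> :: "real \<Rightarrow> real"
    and x :: 'a
    and u :: "'n \<Rightarrow> ('a, real^'n) tvec"
    and X Y :: "('a, real^'n) tvec"
  assumes "manifold A" and "riemannian_metric A g"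
    and "smooth_half_line \<alpha>" and "smooth_half_line \<beta>"
    and "\<And>t. t \<ge> 0 \<Longrightarrow> \<alpha> t > 0" and "\<And>t. t \<ge> 0 \<Longrightarrow> \<alpha> t + t * \<beta> t > 0"
    and "(x, u) \<in> frames A"
    and "X \<in> tangent_space A x" and "Y \<in> tangent_space A x"
    and "g x X X = 1" and "g x Y Y = 1" and "g x X Y = 0"
  shows
    "let R = curvature A g x;
         K = sectional_curvature A g x;
         K' = sectional_curvature (frame_atlas A) (frame_metric A g \<alpha> \<beta>) (x, u);
         h = horizontal_lift A g (x, u);
         v = vertical_lift A (x, u);
         nsq = (\<lambda>Z. g x Z Z);
         a = (\<lambda>i. \<alpha> (nsq (u i)));
         b = (\<lambda>i. \<beta> (nsq (u i)));
         cA = (\<lambda>i. coeff_A \<alpha> \<beta> (nsq (u i)));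
         cB = (\<lambda>i. coeff_B \<alpha> \<beta> (nsq (u i)))
     in
       K' (h X) (h Y) = K X Y - 3/4 * (\<Sum>k\<in>UNIV. a k * nsq (R X Y (u k))) \<and>
       (\<forall>i. K' (h X) (v i Y) =
          (a i)\<^sup>2 / (4 * (a i + b i * (g x Y (u i))\<^sup>2)) * nsq (R (u i) Y X)) \<and>
       (\<forall>i. K' (v i X) (v i Y) =
          (cA i * ((g x X (u i))\<^sup>2 + (g x Y (u i))\<^sup>2) + cB i) /
          (a i + b i * ((g x X (u i))\<^sup>2 + (g x Y (u i))\<^sup>2))) \<and>
       (\<forall>i j. i \<noteq> j \<longrightarrow> K' (v i X) (v j Y) = 0) \<and>
       (\<forall>\<kappa>. constant_sectional_curvature A g \<kappa> \<longrightarrow>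
          K' (h X) (h Y) =
            \<kappa> - 3/4 * \<kappa>\<^sup>2 * (\<Sum>k\<in>UNIV. a k * ((g x X (u k))\<^sup>2 + (g x Y (u k))\<^sup>2)) \<and>
          (\<forall>i. K' (h X) (v i Y) =
                 \<kappa>\<^sup>2 * (a i)\<^sup>2 * (g x X (u i))\<^sup>2 / (4 * (a i + b i * (g x Y (u i))\<^sup>2)) \<and>
               K' (h X) (v i Y) \<ge> 0) \<and>
          (\<kappa> > 0 \<and> (\<forall>t :: 'n \<Rightarrow> real. (\<forall>k. t k > 0) \<longrightarrow>
                (\<Sum>k\<in>UNIV. \<alpha> (t k) * t k) < 4 / (3 * \<kappa>)) \<longrightarrow>
             K' (h X) (h Y) > 0))"
proof -
  note X = assms(8) and Y = assms(9) and u = assms(7) and on = assms(10-12)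
  interpret frame_bundle A g \<alpha> \<beta>
    by unfold_locales
      (use assms(1,2,5,6) smooth_half_line_smooth_on[OF assms(3)] smooth_half_line_smooth_on[OF assms(4)] in
        \<open>auto simp: manifold_def\<close>)
  have xp: "x \<in> points A" by (rule frame_points[OF u])
  obtain c where c: "c \<in> charts_at A x" using points_chart[OF xp] by blast
  interpret P: frame_point "im c" "mc c" \<alpha> \<beta> "snd c x" "coords c u" by (rule frame_point[OF u c])
  note uT = frames_coords(2)[OF u c]
  let ?R = "curvature A g x" and ?K' = "sectional_curvature FA fm (x, u)"
  let ?N = "\<lambda>i. g x (u i) (u i)" and ?s = "\<lambda>i. g x X (u i)" and ?t = "\<lambda>i. g x Y (u i)"
  note F = frame_sectional_curvatures[OF u X Y on]
  have N: "?N i > 0" for i by (rule frame_norm_pos[OF u])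
  have \<alpha>N: "\<alpha> (?N i) > 0" for i by (rule \<alpha>_pos[OF N])
  have bessel: "(?s i)\<^sup>2 + (?t i)\<^sup>2 \<le> ?N i" for i
  proof -
    let ?y = "snd c x" and ?G = "mc c (snd c x)"
    \<comment> \<open>The component of u_i orthogonal to the plane of X and Y; its squared length is
      the defect in Bessel's inequality.\<close>
    let ?w = "u i c - ?s i *\<^sub>R X c - ?t i *\<^sub>R Y c"
    have "0 \<le> ?G ?w ?w"
      using P.pos[OF P.y0, of ?w] by (cases "?w = 0") (auto simp: P.G_simps[OF P.y0])
    also have "?G ?w ?w = ?N i - (?s i)\<^sup>2 - (?t i)\<^sup>2"
      using on by (simp add: P.G_simps[OF P.y0] g_coord[OF c] X Y uT P.sym[OF P.y0, of "Y c" "X c"]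
          P.sym[OF P.y0, of "u i c" "X c"] P.sym[OF P.y0, of "u i c" "Y c"] power2_eq_square algebra_simps)
    finally show ?thesis by simp
  qed
  have mixed_pos: "\<alpha> (?N i) + \<beta> (?N i) * (?t i)\<^sup>2 > 0" for i
  proof (cases "\<beta> (?N i) \<ge> 0")
    case True
    then show ?thesis using \<alpha>N[of i] by (simp add: add_pos_nonneg)
  next
    case False
    \<comment> \<open>For negative \<beta> this reduces the claim to \<alpha> + N \<beta> > 0, with
      N = |u_i|^2.\<close>
    have "(?t i)\<^sup>2 \<le> ?N i" using bessel[of i] zero_le_power2[of "?s i"] by linarith
    then have "\<beta> (?N i) * (?t i)\<^sup>2 \<ge> \<beta> (?N i) * ?N i"
      using False by (intro mult_left_mono_neg) auto
    then show ?thesis using \<alpha>\<beta>_pos[OF N[of i]] by (simp add: mult.commute)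
  qed
  have const: "?K' (hor (x, u) X) (hor (x, u) Y) =
        \<kappa> - 3/4 * \<kappa>\<^sup>2 * (\<Sum>k\<in>UNIV. \<alpha> (?N k) * ((?s k)\<^sup>2 + (?t k)\<^sup>2))"
    "?K' (hor (x, u) X) (ver (x, u) i Y) = \<kappa>\<^sup>2 * (\<alpha> (?N i))\<^sup>2 * (?s i)\<^sup>2 / (4 * (\<alpha> (?N i) + \<beta> (?N i) * (?t i)\<^sup>2))"
    if \<kappa>: "constant_sectional_curvature A g \<kappa>" for \<kappa> i
  proof -
    note R = constant_curvature_tensor[OF \<kappa> xp]
    have YX: "g x Y X = 0" using g_sym[OF xp Y X] on by simp
    have norm: "g x (r *\<^sub>R X - s *\<^sub>R Y) (r *\<^sub>R X - s *\<^sub>R Y) = r\<^sup>2 + s\<^sup>2" for r s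
    proof -
      have T: "r *\<^sub>R X - s *\<^sub>R Y \<in> tangent_space A x"
        by (intro subspace_diff subspace_scale subspace_tangent X Y)
      have lin: "g x (r *\<^sub>R X - s *\<^sub>R Y) Z = r * g x X Z - s * g x Y Z" if "Z \<in> tangent_space A x" for Z
        using g_linear[OF xp X Y that, of r "- s"] by simp
      have "g x X (r *\<^sub>R X - s *\<^sub>R Y) = r" "g x Y (r *\<^sub>R X - s *\<^sub>R Y) = - s"
        using g_sym[OF xp X T] g_sym[OF xp Y T] lin[OF X] lin[OF Y] on YX by simp_all
      then show ?thesis unfolding lin[OF T] by (simp add: power2_eq_square)
    qed
    have RXY: "g x (?R X Y (u k)) (?R X Y (u k)) = \<kappa>\<^sup>2 * ((?s k)\<^sup>2 + (?t k)\<^sup>2)" for k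
      unfolding R[OF X Y uT] norm by (simp add: power_mult_distrib algebra_simps)
    have "?R (u i) Y X = (0::real) *\<^sub>R X - (\<kappa> * ?s i) *\<^sub>R Y"
    proof -
      have "?R (u i) Y X = 0 *\<^sub>R u i - (\<kappa> * g x (u i) X) *\<^sub>R Y"
        unfolding R[OF uT Y X] YX by simp
      then show ?thesis using g_sym[OF xp uT X, of i] by simp
    qed
    then have RuY: "g x (?R (u i) Y X) (?R (u i) Y X) = \<kappa>\<^sup>2 * (?s i)\<^sup>2"
      using norm[of 0 "\<kappa> * ?s i"] by (simp add: power_mult_distrib)
    have "g x (?R X Y Y) X = \<kappa>"
    proof -
      have "?R X Y Y = \<kappa> *\<^sub>R X - 0 *\<^sub>R Y" unfolding R[OF X Y Y] using on by simp
      then show ?thesis using g_linear[OF xp X Y X, of \<kappa> 0] on by simp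
    qed
    then have K: "sectional_curvature A g x X Y = \<kappa>" using on by (simp add: sectional_curvature_def)
    show "?K' (hor (x, u) X) (hor (x, u) Y) =
        \<kappa> - 3/4 * \<kappa>\<^sup>2 * (\<Sum>k\<in>UNIV. \<alpha> (?N k) * ((?s k)\<^sup>2 + (?t k)\<^sup>2))"
    proof -
      have "(\<Sum>k\<in>UNIV. \<alpha> (?N k) * (\<kappa>\<^sup>2 * ((?s k)\<^sup>2 + (?t k)\<^sup>2))) =
          \<kappa>\<^sup>2 * (\<Sum>k\<in>UNIV. \<alpha> (?N k) * ((?s k)\<^sup>2 + (?t k)\<^sup>2))"
        unfolding sum_distrib_left by (simp only: mult.left_commute)
      then show ?thesis unfolding F(1) K RXY by simp
    qed
    show "?K' (hor (x, u) X) (ver (x, u) i Y) = \<kappa>\<^sup>2 * (\<alpha> (?N i))\<^sup>2 * (?s i)\<^sup>2 / (4 * (\<alpha> (?N i) + \<beta> (?N i) * (?t i)\<^sup>2))"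
      unfolding F(2) RuY by simp
  qed
  have nonneg: "?K' (hor (x, u) X) (ver (x, u) i Y) \<ge> 0" if "constant_sectional_curvature A g \<kappa>" for \<kappa> i
    unfolding const(2)[OF that] using mixed_pos[of i] by simp
  have pos: "?K' (hor (x, u) X) (hor (x, u) Y) > 0"
    if \<kappa>: "constant_sectional_curvature A g \<kappa>" "\<kappa> > 0"
      and small: "\<forall>t :: 'n \<Rightarrow> real. (\<forall>k. t k > 0) \<longrightarrow> (\<Sum>k\<in>UNIV. \<alpha> (t k) * t k) < 4 / (3 * \<kappa>)" for \<kappa>
  proof -
    have "(\<Sum>k\<in>UNIV. \<alpha> (?N k) * ((?s k)\<^sup>2 + (?t k)\<^sup>2)) \<le> (\<Sum>k\<in>UNIV. \<alpha> (?N k) * ?N k)"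
      using \<alpha>N bessel by (intro sum_mono mult_left_mono) (auto intro: less_imp_le)
    \<comment> \<open>The smallness condition is applied with t_k = |u_k|^2, which are positive. Its
      bound is the one for which 3/4 \<kappa>^2 times the sum stays below \<kappa>.\<close>
    also have "\<dots> < 4 / (3 * \<kappa>)" using small[rule_format, of ?N] N by simp
    finally have "3/4 * \<kappa>\<^sup>2 * (\<Sum>k\<in>UNIV. \<alpha> (?N k) * ((?s k)\<^sup>2 + (?t k)\<^sup>2)) < 3/4 * \<kappa>\<^sup>2 * (4 / (3 * \<kappa>))"
      using \<kappa>(2) by (intro mult_strict_left_mono) auto
    also have "\<dots> = \<kappa>" using \<kappa>(2) by (simp add: power2_eq_square)
    finally show ?thesis unfolding const(1)[OF \<kappa>(1)] by simp
  qed
  show ?thesis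
    unfolding Let_def
  proof (intro conjI allI impI, goal_cases)
    case 1
    show ?case by (rule F(1))
  next
    case (2 i)
    show ?case by (rule F(2))
  next
    case (3 i)
    show ?case by (rule F(3))
  next
    case (4 i j)
    then show ?case by (rule F(4))
  next
    case (5 \<kappa>)
    then show ?case by (rule const(1))
  next
    case (6 \<kappa> i)
    then show ?case by (rule const(2))
  next
    case (7 \<kappa> i)
    then show ?case by (rule nonneg)
  next
    case (8 \<kappa>)
    then show ?case by (elim conjE) (rule pos)
  qed
qed

end
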